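(* Let $W \in \mathbb{Z}^{m \times n}$, $w \in \mathbb{Z}^m$, $k \le n$, $q \in \mathbb{Z}^k_{>0}$, $h \in \mathbb{Z}^n$, and consider the integer quadratic program $$(\mathcal{IQP}) \qquad \min\ \sum_{i=1}^k - q_i x_i^2 + h^\top x \quad \text{s.t.}\quad Wx \le w,\ x \in \mathbb{Z}^n .$$ Let $\Delta$ denote the largest absolute value of any subdeterminant of $W$. For every $\epsilon \in (0,1]$ there is an algorithm that finds an $\epsilon$-approximate solution to $(\mathcal{IQP})$ by solving $$\left(3 + \left\lceil\sqrt{k \left((2n\Delta)^2 + \frac{1}{\epsilon}\right)}\right\rceil \right)^k$$ integer linear programs (ILPs) of size polynomial in the size of $(\mathcal{IQP})$. Moreover, each ILP has integral data, at most $n$ variables, at most $m$ linear inequalities and possibly additional variable bounds, and a constraint matrix with subdeterminants bounded by $\Delta$ in absolute value.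
   Context: A subdeterminant of a matrix is the determinant of one of its square submatrices. An integer linear program (ILP) is the problem of minimizing or maximizing a linear function over the integral points satisfying a system of linear inequalities. The size of a problem is the binary encoding length of its data. $\epsilon$-approximate solution: consider an instance of a minimization problem with objective function $f$ that has an optimal solution $x^*$, and let $f_{\max}$ be the maximum value of $f$ on the feasible region. For $\epsilon \in [0,1]$, a feasible point $x^\diamond$ is an $\epsilon$-approximate solution if $f(x^* ) = f_{\max}$, or if $f(x^* ) < f_{\max}$ and $$\frac{f(x^\diamond) - f(x^* )}{f_{\max} - f(x^* )} \le \epsilon .$$ If $f$ has no upper bound on the feasible region, every feasible point is regarded as an $\epsilon$-approximate solution for every $\epsilon>0$. If the problem is infeasible or unbounded, an $\epsilon$-approximate solution is not defined, and the algorithm is expected to return an indicator that the problem is infeasible or unbounded. *)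

theory Defs
  imports
    "HOL-Library.Log_Nat"
    "HOL-Computational_Algebra.Polynomial"
    "Jordan_Normal_Form.Determinant"
    "Jordan_Normal_Form.DL_Submatrix"
begin

section \<open>Subdeterminants\<close>

text \<open>Square submatrices have at least one row, so the empty determinant 1 is not a
  subdeterminant and the zero matrix has largest absolute subdeterminant 0.\<close>

definition subdets :: "int mat \<Rightarrow> int set" where
  "subdets A = {det (submatrix A I J) | I J.
     I \<subseteq> {..<dim_row A} \<and> J \<subseteq> {..<dim_col A} \<and> card I = card J \<and> I \<noteq> {}}"

text \<open>The inserted 0 only matters for a matrix without rows or without columns.\<close>

definition max_subdet :: "int mat \<Rightarrow> int" where
  "max_subdet A = Max (insert 0 (abs ` subdets A))"


section \<open>The integer quadratic program\<close>

definition iqp_feasible :: "int mat \<Rightarrow> int vec \<Rightarrow> int vec set" where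
  "iqp_feasible W w = {x \<in> carrier_vec (dim_col W). W *\<^sub>v x \<le> w}"

definition iqp_objective :: "int vec \<Rightarrow> int vec \<Rightarrow> int vec \<Rightarrow> int" where
  "iqp_objective q h x = (\<Sum>i<dim_vec q. - (q $ i) * (x $ i)\<^sup>2) + h \<bullet> x"

text \<open>Approximate solutions of the problem of minimizing \<open>f\<close> over \<open>S\<close>; the problem is required to
  have an optimal solution. The supremum is the maximum whenever the latter exists, in particular
  for integer-valued \<open>f\<close> bounded above on \<open>S\<close>.\<close>

definition eps_approx :: "real \<Rightarrow> 'a set \<Rightarrow> ('a \<Rightarrow> real) \<Rightarrow> 'a \<Rightarrow> bool" where
  "eps_approx \<epsilon> S f x \<longleftrightarrow> x \<in> S \<and>
     (\<exists>x_opt\<in>S. (\<forall>y\<in>S. f x_opt \<le> f y) \<and>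
        (bdd_above (f ` S) \<longrightarrow>
          (let f_max = Sup (f ` S) in
             f x_opt = f_max \<or>
             f x_opt < f_max \<and> (f x - f x_opt) / (f_max - f x_opt) \<le> \<epsilon>)))"

datatype outcome = Infeasible | Unbounded | Solution "int vec"

definition iqp_outcome ::
  "real \<Rightarrow> int mat \<Rightarrow> int vec \<Rightarrow> int vec \<Rightarrow> int vec \<Rightarrow> outcome \<Rightarrow> bool" where
  "iqp_outcome \<epsilon> W w q h r = (case r of
      Infeasible \<Rightarrow> iqp_feasible W w = {}
    | Unbounded \<Rightarrow> iqp_feasible W w \<noteq> {} \<and> \<not> bdd_below (iqp_objective q h ` iqp_feasible W w)
    | Solution x \<Rightarrow> eps_approx \<epsilon> (iqp_feasible W w) (\<lambda>y. real_of_int (iqp_objective q h y)) x)"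


section \<open>Integer linear programs\<close>

text \<open>All data are integral by typing. Variable bounds are kept apart from the linear
  inequalities; \<open>None\<close> means that there is no bound.\<close>

record ilp =
  ilp_max :: bool
  ilp_obj :: "int vec"
  ilp_mat :: "int mat"
  ilp_rhs :: "int vec"
  ilp_lower :: "int option list"
  ilp_upper :: "int option list"

definition ilp_wf :: "ilp \<Rightarrow> bool" where
  "ilp_wf P \<longleftrightarrow>
     dim_vec (ilp_obj P) = dim_col (ilp_mat P) \<and>
     dim_vec (ilp_rhs P) = dim_row (ilp_mat P) \<and>
     length (ilp_lower P) = dim_col (ilp_mat P) \<and>
     length (ilp_upper P) = dim_col (ilp_mat P)"

definition ilp_feasible :: "ilp \<Rightarrow> int vec set" where
  "ilp_feasible P = {x \<in> carrier_vec (dim_col (ilp_mat P)).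
     ilp_mat P *\<^sub>v x \<le> ilp_rhs P \<and>
     (\<forall>i<dim_col (ilp_mat P).
        (\<forall>a. ilp_lower P ! i = Some a \<longrightarrow> a \<le> x $ i) \<and>
        (\<forall>b. ilp_upper P ! i = Some b \<longrightarrow> x $ i \<le> b))}"

definition ilp_outcome :: "ilp \<Rightarrow> outcome \<Rightarrow> bool" where
  "ilp_outcome P r = (case r of
      Infeasible \<Rightarrow> ilp_feasible P = {}
    | Unbounded \<Rightarrow> ilp_feasible P \<noteq> {} \<and>
        (if ilp_max P then \<not> bdd_above ((\<lambda>x. ilp_obj P \<bullet> x) ` ilp_feasible P)
         else \<not> bdd_below ((\<lambda>x. ilp_obj P \<bullet> x) ` ilp_feasible P))
    | Solution x \<Rightarrow> x \<in> ilp_feasible P \<and>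
        (\<forall>y\<in>ilp_feasible P.
           if ilp_max P then ilp_obj P \<bullet> y \<le> ilp_obj P \<bullet> x else ilp_obj P \<bullet> x \<le> ilp_obj P \<bullet> y))"

definition ilp_solver :: "(ilp \<Rightarrow> outcome) \<Rightarrow> bool" where
  "ilp_solver orc \<longleftrightarrow> (\<forall>P. ilp_wf P \<longrightarrow> ilp_outcome P (orc P))"


section \<open>Values, their binary size, and encodings\<close>

datatype val = Atom int | Node "val list"

fun val_size :: "val \<Rightarrow> nat" where
  "val_size (Atom i) = 1 + nat (bitlen \<bar>i\<bar>)"
| "val_size (Node vs) = 1 + sum_list (map val_size vs)"

definition enc_vec :: "int vec \<Rightarrow> val" where
  "enc_vec v = Node (map Atom (list_of_vec v))"

definition enc_mat :: "int mat \<Rightarrow> val" where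
  "enc_mat A = Node (map enc_vec (rows A))"

definition enc_bounds :: "int option list \<Rightarrow> val" where
  "enc_bounds bs = Node (map (\<lambda>b. case b of None \<Rightarrow> Node [] | Some a \<Rightarrow> Atom a) bs)"

definition enc_ilp :: "ilp \<Rightarrow> val" where
  "enc_ilp P = Node [Atom (if ilp_max P then 1 else 0), enc_vec (ilp_obj P), enc_mat (ilp_mat P),
     enc_vec (ilp_rhs P), enc_bounds (ilp_lower P), enc_bounds (ilp_upper P)]"

fun enc_outcome :: "outcome \<Rightarrow> val" where
  "enc_outcome Infeasible = Node [Atom 0]"
| "enc_outcome Unbounded = Node [Atom 1]"
| "enc_outcome (Solution x) = Node [Atom 2, enc_vec x]"

definition ilp_size :: "ilp \<Rightarrow> nat" where
  "ilp_size P = val_size (enc_ilp P)"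

definition iqp_size :: "int mat \<Rightarrow> int vec \<Rightarrow> int vec \<Rightarrow> int vec \<Rightarrow> nat" where
  "iqp_size W w q h = val_size (Node [enc_mat W, enc_vec w, enc_vec q, enc_vec h])"


section \<open>Algorithms that call an ILP solver\<close>

text \<open>A deterministic while language over integers and nested lists. An expression costs the total
  binary size of the values of its subexpressions, so that (unlike with unit costs) repeated
  squaring or repeated copying cannot build large values cheaply. Hence, for programs without
  \<open>Solve\<close>, running in polynomial time in this language agrees with the usual notion.\<close>

datatype expr =
    Var nat
  | Lit int
  | Empty
  | Plus expr expr
  | Minus expr expr
  | Times expr expr
  | Div expr expr
  | Less expr expr
  | Prepend expr expr
  | Head expr
  | Tail expr

datatype com =
    Assign nat expr
  | Solve nat expr
  | Seq com com
  | Cond expr com com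
  | While expr com

type_synonym state = "nat \<Rightarrow> val"

fun the_int :: "val \<Rightarrow> int" where
  "the_int (Atom i) = i"
| "the_int (Node vs) = 0"

fun the_list :: "val \<Rightarrow> val list" where
  "the_list (Atom i) = []"
| "the_list (Node vs) = vs"

fun eval :: "expr \<Rightarrow> state \<Rightarrow> val" where
  "eval (Var x) s = s x"
| "eval (Lit i) s = Atom i"
| "eval Empty s = Node []"
| "eval (Plus a b) s = Atom (the_int (eval a s) + the_int (eval b s))"
| "eval (Minus a b) s = Atom (the_int (eval a s) - the_int (eval b s))"
| "eval (Times a b) s = Atom (the_int (eval a s) * the_int (eval b s))"
| "eval (Div a b) s = Atom (the_int (eval a s) div the_int (eval b s))"
| "eval (Less a b) s = Atom (if the_int (eval a s) < the_int (eval b s) then 1 else 0)"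
| "eval (Prepend a b) s = Node (eval a s # the_list (eval b s))"
| "eval (Head a) s = (case the_list (eval a s) of [] \<Rightarrow> Node [] | v # vs \<Rightarrow> v)"
| "eval (Tail a) s = Node (tl (the_list (eval a s)))"

fun subexpr_cost :: "expr \<Rightarrow> state \<Rightarrow> nat" and cost :: "expr \<Rightarrow> state \<Rightarrow> nat" where
  "subexpr_cost (Var x) s = 0"
| "subexpr_cost (Lit i) s = 0"
| "subexpr_cost Empty s = 0"
| "subexpr_cost (Plus a b) s = cost a s + cost b s"
| "subexpr_cost (Minus a b) s = cost a s + cost b s"
| "subexpr_cost (Times a b) s = cost a s + cost b s"
| "subexpr_cost (Div a b) s = cost a s + cost b s"
| "subexpr_cost (Less a b) s = cost a s + cost b s"
| "subexpr_cost (Prepend a b) s = cost a s + cost b s"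
| "subexpr_cost (Head a) s = cost a s"
| "subexpr_cost (Tail a) s = cost a s"
| "cost e s = val_size (eval e s) + subexpr_cost e s"

definition truthy :: "val \<Rightarrow> bool" where
  "truthy v \<longleftrightarrow> v \<noteq> Atom 0 \<and> v \<noteq> Node []"

text \<open>\<open>exec orc c s Ps t s'\<close>: started in \<open>s\<close>, the program \<open>c\<close> terminates in \<open>s'\<close> after solving exactly
  the ILPs in the list \<open>Ps\<close>, in this order and with repetitions, by calls to \<open>orc\<close>, and spends
  time \<open>t\<close>, where a call is charged only for writing down the ILP and its outcome.
  A program that calls the solver on anything but a well-formed ILP has no execution.\<close>

inductive exec ::
  "(ilp \<Rightarrow> outcome) \<Rightarrow> com \<Rightarrow> state \<Rightarrow> ilp list \<Rightarrow> nat \<Rightarrow> state \<Rightarrow> bool" for orc where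
  Assign: "exec orc (Assign x e) s [] (1 + cost e s) (s(x := eval e s))"
| Solve: "eval e s = enc_ilp P \<Longrightarrow> ilp_wf P \<Longrightarrow>
    exec orc (Solve x e) s [P] (1 + cost e s + val_size (enc_outcome (orc P)))
      (s(x := enc_outcome (orc P)))"
| Seq: "exec orc c s Ps t s' \<Longrightarrow> exec orc d s' Qs u s'' \<Longrightarrow>
    exec orc (Seq c d) s (Ps @ Qs) (1 + t + u) s''"
| CondTrue: "truthy (eval e s) \<Longrightarrow> exec orc c s Ps t s' \<Longrightarrow>
    exec orc (Cond e c d) s Ps (1 + cost e s + t) s'"
| CondFalse: "\<not> truthy (eval e s) \<Longrightarrow> exec orc d s Ps t s' \<Longrightarrow>
    exec orc (Cond e c d) s Ps (1 + cost e s + t) s'"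
| WhileTrue: "truthy (eval e s) \<Longrightarrow> exec orc c s Ps t s' \<Longrightarrow>
    exec orc (While e c) s' Qs u s'' \<Longrightarrow>
    exec orc (While e c) s (Ps @ Qs) (1 + cost e s + t + u) s''"
| WhileFalse: "\<not> truthy (eval e s) \<Longrightarrow> exec orc (While e c) s [] (1 + cost e s) s"

text \<open>The input and the result are passed in variable 0. Besides the data of the quadratic program,
  the program is told the largest absolute subdeterminant \<open>\<Delta>\<close> of the constraint matrix.\<close>

definition iqp_input :: "int mat \<Rightarrow> int vec \<Rightarrow> int vec \<Rightarrow> int vec \<Rightarrow> int \<Rightarrow> state" where
  "iqp_input W w q h \<Delta> =
     (\<lambda>x. Node [])(0 := Node [enc_mat W, enc_vec w, enc_vec q, enc_vec h, Atom \<Delta>])"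


section \<open>Executions are unique\<close>

lemma inj_Atom: "inj Atom"
  by (simp add: inj_def)

lemma enc_vec_inj: "enc_vec v = enc_vec w \<longleftrightarrow> v = w"
  unfolding enc_vec_def by (metis inj_Atom inj_map_eq_map val.inject(2) vec_list)

lemma enc_mat_inj:
  assumes "enc_mat A = enc_mat B" and "dim_col A = dim_col B"
  shows "A = B"
proof -
  have "inj enc_vec"
    by (simp add: inj_def enc_vec_inj)
  with assms(1) have "rows A = rows B"
    unfolding enc_mat_def by (simp add: inj_map_eq_map)
  with assms(2) show ?thesis
    by (metis mat_of_rows_rows)
qed

lemma enc_bounds_inj: "enc_bounds bs = enc_bounds cs \<longleftrightarrow> bs = cs"
proof -
  have "inj (\<lambda>b. case b of None \<Rightarrow> Node [] | Some a \<Rightarrow> Atom a)"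
    by (auto simp: inj_def split: option.splits)
  then show ?thesis
    unfolding enc_bounds_def by (simp add: inj_map_eq_map)
qed

lemma enc_ilp_inj:
  assumes "ilp_wf P" "ilp_wf Q" "enc_ilp P = enc_ilp Q"
  shows "P = Q"
  using assms enc_mat_inj[of "ilp_mat P" "ilp_mat Q"]
  by (auto simp: enc_ilp_def ilp_wf_def enc_vec_inj enc_bounds_inj split: if_splits
      intro!: ilp.equality)

inductive_cases AssignE: "exec orc (Assign x e) s Ps t s'"
inductive_cases SolveE: "exec orc (Solve x e) s Ps t s'"
inductive_cases SeqE: "exec orc (Seq c d) s Ps t s'"
inductive_cases CondE: "exec orc (Cond e c d) s Ps t s'"
inductive_cases WhileE: "exec orc (While e c) s Ps t s'"

lemma exec_deterministic:
  assumes "exec orc c s Ps t s'" and "exec orc c s Qs u s''"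
  shows "Ps = Qs \<and> t = u \<and> s' = s''"
  using assms
proof (induction arbitrary: Qs u s'' rule: exec.induct)
  case (Assign x e s)
  then show ?case by (auto elim: AssignE)
next
  case (Solve e s P x)
  from Solve.prems show ?case
    by (rule SolveE) (use Solve.hyps in \<open>auto dest: enc_ilp_inj\<close>)
next
  case (Seq c s Ps t s' d Qs' u' s2)
  from Seq.prems show ?case
    by (rule SeqE) (auto dest!: Seq.IH)
next
  case (CondTrue e s c Ps t s' d)
  from CondTrue.prems show ?case
    by (rule CondE) (use CondTrue.hyps in \<open>auto dest!: CondTrue.IH\<close>)
next
  case (CondFalse e s d Ps t s' c)
  from CondFalse.prems show ?case
    by (rule CondE) (use CondFalse.hyps in \<open>auto dest!: CondFalse.IH\<close>)
next
  case (WhileTrue e s c Ps t s' Qs' u' s2)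
  from WhileTrue.prems show ?case
    by (rule WhileE) (use WhileTrue.hyps in \<open>auto dest!: WhileTrue.IH\<close>)
next
  case (WhileFalse e s c)
  from WhileFalse.prems show ?case
    by (rule WhileE) (use WhileFalse.hyps in auto)
qed

end

theory Submission
  imports Defs
begin

text \<open>
  Let \<open>l\<^sub>i\<close> and \<open>u\<^sub>i\<close> be the minimum and maximum of \<open>x\<^sub>i\<close> over the feasible points, for \<open>i < k\<close>; these
  take \<open>2 k\<close> ILPs. If one of them is infinite, a ray of the recession cone shows that the objective is
  unbounded. Otherwise cut every interval into \<open>g\<close> parts, where \<open>g\<close> is least with
  \<open>g\<^sup>2 \<ge> k ((2 n \<Delta>)\<^sup>2 + \<lceil>1 / \<epsilon>\<rceil>)\<close>, replace the objective on each of the \<open>g\<^sup>k\<close> boxes by its secant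
  underestimator, solve the resulting ILPs and return the best solution.

  The error is at most a quarter of the sum of \<open>q\<^sub>i wd\<^sub>i\<^sup>2\<close>, where \<open>wd\<^sub>i = \<lfloor>(u\<^sub>i - l\<^sub>i) / g\<rfloor>\<close>. For the spread of the
  objective, take feasible points with \<open>x\<^sub>j = l\<^sub>j\<close> and \<open>x\<^sub>j = u\<^sub>j\<close> and write their difference \<open>d\<close> as a nonnegative
  combination of at most \<open>n\<close> integral vectors with entries bounded by \<open>\<Delta>\<close> that are sign-compatible
  with \<open>d\<close>. Rounding half the coefficients down gives two more feasible integral points that are
  symmetric about the midpoint and at distance at most \<open>2 n \<Delta>\<close> from each other, whence the objective
  varies by at least \<open>q\<^sub>j ((u\<^sub>j - l\<^sub>j)\<^sup>2 - (2 n \<Delta>)\<^sup>2) / 4\<close>.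
\<close>


section \<open>Minors\<close>

text \<open>The size of \<open>g\<close> comes from comparing two estimates. In the coordinate with
  the largest \<open>q wd^2\<close>, let \<open>D = u - l\<close>. The error is at most
  \<open>k q wd^2 / 4\<close> and the spread at least \<open>q (D^2 - (2 n \<Delta>)^2) / 4\<close>.
  Since \<open>g wd \<le> D\<close>, their ratio is at most \<open>1 / E\<close> once
  \<open>g^2 \<ge> k ((2 n \<Delta>)^2 + E)\<close>. The program computes with integers only, so
  \<open>E\<close> is \<open>1 / \<epsilon>\<close> rounded up. This costs at most 1 in
  \<open>g\<close> beyond the rounded root; the other 2 of the constant 3 in the claimed count pay
  for the \<open>2 k\<close> coordinate ILPs. Two obstacles lie outside the approximation argument.
  First, \<Delta> says nothing about \<open>w\<close>, so that \<open>l\<close> and \<open>u\<close>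
  have polynomial size is derived from the Leibniz formula for the homogenized system. Second, a
  solver may return optimal solutions of any size, so the numbers of a run are bounded in terms of
  the input together with all outcomes.\<close>

definition minor :: "(nat \<Rightarrow> nat \<Rightarrow> int) \<Rightarrow> nat \<Rightarrow> (nat \<Rightarrow> nat) \<Rightarrow> (nat \<Rightarrow> nat) \<Rightarrow> int" where
  "minor A r f g = det (mat r r (\<lambda>(a, b). A (f a) (g b)))"

definition minors_le :: "int \<Rightarrow> nat \<Rightarrow> nat \<Rightarrow> (nat \<Rightarrow> nat \<Rightarrow> int) \<Rightarrow> bool" where
  "minors_le \<Delta> m n A \<longleftrightarrow>
     (\<forall>r f g. (\<forall>a<r. f a < m) \<longrightarrow> (\<forall>b<r. g b < n) \<longrightarrow> \<bar>minor A r f g\<bar> \<le> \<Delta>)"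

lemma minor_transpose: "minor A r f g = minor (\<lambda>i j. A j i) r g f"
proof -
  have "minor (\<lambda>i j. A j i) r g f = det (transpose_mat (mat r r (\<lambda>(a, b). A (f a) (g b))))"
    unfolding minor_def by (rule arg_cong[where f = det]) auto
  then show ?thesis
    unfolding minor_def by (subst (asm) det_transpose[of _ r]) auto
qed

lemma minor_eq_rows:
  assumes "i < r" "j < r" "i \<noteq> j" "f i = f j"
  shows "minor A r f g = 0"
  unfolding minor_def
  by (rule det_identical_rows[of _ r i j]) (use assms in \<open>auto intro!: eq_vecI\<close>)

lemma minor_inj_rows: "minor A r f g \<noteq> 0 \<Longrightarrow> inj_on f {..<r}"
  using minor_eq_rows unfolding inj_on_def by blast

lemma minor_inj_cols: "minor A r f g \<noteq> 0 \<Longrightarrow> inj_on g {..<r}"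
  by (subst (asm) minor_transpose) (rule minor_inj_rows)

lemma minor_permute_rows:
  assumes "p permutes {0..<r}"
  shows "\<bar>minor A r (f \<circ> p) g\<bar> = \<bar>minor A r f g\<bar>"
proof -
  let ?M = "mat r r (\<lambda>(a, b). A (f a) (g b))"
  have "mat r r (\<lambda>(a, b). A ((f \<circ> p) a) (g b)) = mat r r (\<lambda>(a, b). ?M $$ (p a, b))"
    by (rule eq_matI) (use permutes_in_image[OF assms] in auto)
  then have "minor A r (f \<circ> p) g = signof p * det ?M"
    unfolding minor_def using det_permute_rows[of ?M r p] assms by simp
  then show ?thesis
    by (simp add: minor_def abs_mult sign_def)
qed

lemma minor_permute_cols:
  assumes "p permutes {0..<r}"
  shows "\<bar>minor A r f (g \<circ> p)\<bar> = \<bar>minor A r f g\<bar>"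
  using minor_permute_rows[OF assms, of "\<lambda>i j. A j i" g f]
  unfolding minor_transpose[of "\<lambda>i j. A j i"] .

text \<open>\<open>submatrix\<close> lists its indices increasingly through \<open>pick\<close>, so
  an arbitrary injective selection has to be sorted; \<open>p\<close> is the sorting
  permutation.\<close>

lemma inj_on_pick_permute:
  assumes f: "inj_on f {..<r}"
  obtains p where "p permutes {0..<r}" "\<And>a. a < r \<Longrightarrow> f a = pick (f ` {..<r}) (p a)"
proof -
  let ?I = "f ` {..<r}"
  have card: "card ?I = r"
    using card_image[OF f] by simp
  have "inj_on (pick ?I) {..<r}"
  proof (rule inj_onI)
    fix a b assume "a \<in> {..<r}" "b \<in> {..<r}" "pick ?I a = pick ?I b"
    then show "a = b"
      using pick_mono_le[of a ?I b] pick_mono_le[of b ?I a] card by (cases a b rule: linorder_cases) auto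
  qed
  moreover have "pick ?I ` {..<r} \<subseteq> ?I"
  proof (rule image_subsetI)
    fix a assume "a \<in> {..<r}"
    then show "pick ?I a \<in> ?I"
      using pick_in_set_le[of a ?I] by (simp add: card)
  qed
  ultimately have bij: "bij_betw (pick ?I) {..<r} ?I"
    using card_image[OF \<open>inj_on (pick ?I) {..<r}\<close>] card
    by (simp add: bij_betw_def card_subset_eq)
  define p where "p a = (if a < r then inv_into {..<r} (pick ?I) (f a) else a)" for a
  have fb: "bij_betw f {..<r} ?I"
    using f by (simp add: bij_betw_def)
  have "bij_betw (inv_into {..<r} (pick ?I) \<circ> f) {..<r} {..<r}"
    using bij_betw_trans[OF fb bij_betw_inv_into[OF bij]] .
  then have "bij_betw p {..<r} {..<r}"
    by (rule bij_betw_cong[THEN iffD1, rotated]) (simp add: p_def)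
  then have "p permutes {0..<r}"
    by (intro bij_imp_permutes) (auto simp: p_def lessThan_atLeast0)
  moreover have "f a = pick ?I (p a)" if "a < r" for a
    using bij_betw_inv_into_right[OF bij, of "f a"] that by (simp add: p_def)
  ultimately show ?thesis
    using that by blast
qed

section \<open>Subdeterminants and minors\<close>

lemma finite_subdets: "finite (subdets A)"
proof -
  have "subdets A \<subseteq> (\<lambda>(I, J). det (submatrix A I J)) ` (Pow {..<dim_row A} \<times> Pow {..<dim_col A})"
    unfolding subdets_def by fast
  then show ?thesis
    by (rule finite_subset) simp
qed

lemma subdets_le_max_subdet: "d \<in> subdets A \<Longrightarrow> \<bar>d\<bar> \<le> max_subdet A"
  unfolding max_subdet_def using finite_subdets by (intro Max_ge) auto

lemma max_subdet_nonneg: "0 \<le> max_subdet A"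
  unfolding max_subdet_def using finite_subdets by (intro Max_ge) auto

lemma minor_pick_in_subdets:
  assumes "I \<subseteq> {..<dim_row A}" "J \<subseteq> {..<dim_col A}" "card I = r" "card J = r" "0 < r"
  shows "minor (\<lambda>i j. A $$ (i, j)) r (pick I) (pick J) \<in> subdets A"
proof -
  have "{i. i < dim_row A \<and> i \<in> I} = I" "{j. j < dim_col A \<and> j \<in> J} = J"
    using assms by auto
  then have "submatrix A I J = mat r r (\<lambda>(a, b). A $$ (pick I a, pick J b))"
    using assms by (simp add: submatrix_def)
  moreover have "I \<noteq> {}"
    using assms by auto
  ultimately show ?thesis
    unfolding minor_def subdets_def mem_Collect_eq using assms
    by (intro exI[of _ I] exI[of _ J]) simp
qed

text \<open>A nonzero minor repeats no index, so after permuting rows and columns, which affects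
  only the sign, it is the determinant of a submatrix.\<close>

lemma abs_minor_le_max_subdet:
  assumes "0 < r" and f: "\<And>a. a < r \<Longrightarrow> f a < dim_row A" and g: "\<And>b. b < r \<Longrightarrow> g b < dim_col A"
  shows "\<bar>minor (\<lambda>i j. A $$ (i, j)) r f g\<bar> \<le> max_subdet A"
proof (cases "minor (\<lambda>i j. A $$ (i, j)) r f g = 0")
  case True
  then show ?thesis by (simp add: max_subdet_nonneg)
next
  case False
  let ?A = "\<lambda>i j. A $$ (i, j)" and ?I = "f ` {..<r}" and ?J = "g ` {..<r}"
  note fi = minor_inj_rows[OF False] and gi = minor_inj_cols[OF False]
  from inj_on_pick_permute[OF fi] obtain p
    where p: "p permutes {0..<r}" and fp: "\<And>a. a < r \<Longrightarrow> f a = pick ?I (p a)" by blast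
  from inj_on_pick_permute[OF gi] obtain s
    where s: "s permutes {0..<r}" and gs: "\<And>a. a < r \<Longrightarrow> g a = pick ?J (s a)" by blast
  have "minor ?A r f g = minor ?A r (pick ?I \<circ> p) (pick ?J \<circ> s)"
    unfolding minor_def by (rule arg_cong[where f = det]) (auto simp: fp[symmetric] gs[symmetric])
  then have "\<bar>minor ?A r f g\<bar> = \<bar>minor ?A r (pick ?I \<circ> p) (pick ?J \<circ> s)\<bar>"
    by simp
  also have "\<dots> = \<bar>minor ?A r (pick ?I) (pick ?J \<circ> s)\<bar>"
    by (rule minor_permute_rows[OF p])
  also have "\<dots> = \<bar>minor ?A r (pick ?I) (pick ?J)\<bar>"
    by (rule minor_permute_cols[OF s])
  finally have "\<bar>minor ?A r f g\<bar> = \<bar>minor ?A r (pick ?I) (pick ?J)\<bar>" .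
  moreover have "\<bar>minor ?A r (pick ?I) (pick ?J)\<bar> \<le> max_subdet A"
  proof (rule subdets_le_max_subdet, rule minor_pick_in_subdets)
    show "?I \<subseteq> {..<dim_row A}" "?J \<subseteq> {..<dim_col A}"
      using f g by (simp_all add: image_subset_iff)
    show "card ?I = r" "card ?J = r"
      using card_image[OF fi] card_image[OF gi] by simp_all
  qed (rule assms(1))
  ultimately show ?thesis by linarith
qed

text \<open>The hypothesis accommodates the empty minor 1: for a zero matrix
  \<open>max_subdet\<close> is 0.\<close>

lemma minors_le_max_subdet:
  assumes "1 \<le> max_subdet A"
  shows "minors_le (max_subdet A) (dim_row A) (dim_col A) (\<lambda>i j. A $$ (i, j))"
  unfolding minors_le_def
proof (intro allI impI)
  fix r :: nat and f g :: "nat \<Rightarrow> nat" assume *: "\<forall>a<r. f a < dim_row A" "\<forall>b<r. g b < dim_col A"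
  show "\<bar>minor (\<lambda>i j. A $$ (i, j)) r f g\<bar> \<le> max_subdet A"
  proof (cases "r = 0")
    case True
    then show ?thesis using assms by (simp add: minor_def det_def)
  next
    case False
    with * show ?thesis by (intro abs_minor_le_max_subdet) auto
  qed
qed

text \<open>The Leibniz formula has \<open>r!\<close>, hence at most \<open>r ^ r\<close>, terms.
  The bound is crude but has polynomially many bits, and it also covers matrices that contain the
  right-hand side \<open>w\<close>.\<close>

lemma minors_le_Leibniz:
  assumes A: "\<And>i j. i < m \<Longrightarrow> j < n \<Longrightarrow> \<bar>A i j\<bar> \<le> c" and c: "1 \<le> c"
  shows "minors_le ((int n * c) ^ n) m n A"
  unfolding minors_le_def
proof (intro allI impI)
  fix r :: nat and f g :: "nat \<Rightarrow> nat" assume f: "\<forall>a<r. f a < m" and g: "\<forall>b<r. g b < n"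
  let ?M = "mat r r (\<lambda>(a, b). A (f a) (g b))"
  have nc: "1 \<le> int n * c" if "n \<noteq> 0"
    using mult_mono[of 1 "int n" 1 c] c that by simp
  show "\<bar>minor A r f g\<bar> \<le> (int n * c) ^ n"
  proof (cases "minor A r f g = 0")
    case True
    then show ?thesis using c by simp
  next
    case False
    \<comment> \<open>The columns of a nonzero minor are distinct, which limits its order and makes
      the exponent \<open>n\<close> sufficient.\<close>
    have "r = card (g ` {..<r})"
      using card_image[OF minor_inj_cols[OF False]] by simp
    also have "\<dots> \<le> card {..<n}"
      using g by (intro card_mono) auto
    finally have r: "r \<le> n" by simp
    have "\<bar>minor A r f g\<bar> \<le> (\<Sum>p\<in>{p. p permutes {0..<r}}. \<bar>signof p * (\<Prod>i = 0..<r. ?M $$ (i, p i))\<bar>)"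
      unfolding minor_def by (subst det_def'[OF mat_carrier]) (auto simp: sum_abs)
    also have "\<dots> \<le> (\<Sum>p\<in>{p. p permutes {0..<r}}. c ^ r)"
    proof (rule sum_mono)
      fix p assume "p \<in> {p. p permutes {0..<r}}"
      then have p: "p i < r" if "i < r" for i
        using permutes_in_image[of p "{0..<r}" i] that by auto
      have "\<bar>signof p * (\<Prod>i = 0..<r. ?M $$ (i, p i))\<bar> = (\<Prod>i = 0..<r. \<bar>?M $$ (i, p i)\<bar>)"
        by (simp add: abs_mult abs_prod sign_def)
      also have "\<dots> \<le> (\<Prod>i = 0..<r. c)"
        by (rule prod_mono) (use p f g A in auto)
      finally show "\<bar>signof p * (\<Prod>i = 0..<r. ?M $$ (i, p i))\<bar> \<le> c ^ r" by simp
    qed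
    also have "\<dots> = int (fact r) * c ^ r"
      by (simp add: card_permutations[of _ r])
    also have "\<dots> \<le> int (r ^ r) * c ^ r"
      using fact_le_power[of r, where ?'a = int] c by (intro mult_right_mono) auto
    also have "\<dots> = (int r * c) ^ r"
      by (simp add: power_mult_distrib)
    also have "\<dots> \<le> (int n * c) ^ r"
      using r c by (intro power_mono mult_right_mono) auto
    also have "\<dots> \<le> (int n * c) ^ n"
      using nc r by (cases "n = 0") (auto intro: power_increasing)
    finally show ?thesis .
  qed
qed

section \<open>Integral null vectors with bounded entries\<close>

lemma minor_bordered:
  "minor A (Suc r) (f(r := i)) g = 
    (\<Sum>b<Suc r. A i (g b) * ((-1) ^ (r + b) * minor A r f (\<lambda>c. g (if c < b then c else Suc c))))"
proof -
  \<comment> \<open>The cofactors of the last row do not involve row \<open>i\<close>, so one vector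
    of cofactors serves all rows at once.\<close>
  let ?M = "mat (Suc r) (Suc r) (\<lambda>(a, b). A ((f(r := i)) a) (g b))"
  have "minor A (Suc r) (f(r := i)) g = (\<Sum>b<Suc r. ?M $$ (r, b) * cofactor ?M r b)"
    unfolding minor_def by (rule laplace_expansion_row) auto
  also have "\<dots> = (\<Sum>b<Suc r. A i (g b) * ((-1) ^ (r + b) * minor A r f (\<lambda>c. g (if c < b then c else Suc c))))"
  proof (rule sum.cong[OF refl])
    fix b assume b: "b \<in> {..<Suc r}"
    have "mat_delete ?M r b = mat r r (\<lambda>(a, c). A (f a) (g (if c < b then c else Suc c)))"
      by (rule eq_matI) (use b in \<open>auto simp: mat_delete_def\<close>)
    then show "?M $$ (r, b) * cofactor ?M r b =
        A i (g b) * ((-1) ^ (r + b) * minor A r f (\<lambda>c. g (if c < b then c else Suc c)))"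
      using b by (simp add: cofactor_def minor_def)
  qed
  finally show ?thesis .
qed

lemma minor_nonzero_trivial_kernel:
  fixes e :: "nat \<Rightarrow> real"
  assumes "minor A r f g \<noteq> 0" and "\<And>a. a < r \<Longrightarrow> (\<Sum>b<r. real_of_int (A (f a) (g b)) * e b) = 0"
    and "b < r"
  shows "e b = 0"
proof (rule ccontr)
  assume "e b \<noteq> 0"
  let ?M = "mat r r (\<lambda>(a, b). A (f a) (g b))"
  let ?R = "map_mat real_of_int ?M"
  have "?R *\<^sub>v vec r e = 0\<^sub>v r"
    by (rule eq_vecI) (use assms(2) in \<open>auto simp: scalar_prod_def lessThan_atLeast0\<close>)
  moreover have "vec r e \<noteq> 0\<^sub>v r"
    using \<open>e b \<noteq> 0\<close> \<open>b < r\<close> by (metis index_vec index_zero_vec(1))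
  ultimately have "det ?R = 0"
    using det_0_iff_vec_prod_zero[of ?R r] by (metis map_carrier_mat mat_carrier vec_carrier)
  then show False
    using assms(1) by (simp add: of_int_hom.hom_det minor_def)
qed

text \<open>The entries of \<open>v\<close> are the cofactors along the last row of a bordered maximal nonsingular
  submatrix; Cramer's rule makes it annihilate every row that annihilates \<open>d\<close>.\<close>

lemma bounded_null_vector:
  fixes d :: "nat \<Rightarrow> real"
  assumes bnd: "minors_le \<Delta> m n A" and j1: "j1 < n" "d j1 \<noteq> 0"
  obtains v :: "nat \<Rightarrow> int" and j0
  where "j0 < n" "v j0 \<noteq> 0" "\<And>j. j < n \<Longrightarrow> \<bar>v j\<bar> \<le> \<Delta>" "\<And>j. j < n \<Longrightarrow> d j = 0 \<Longrightarrow> v j = 0"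
    "\<And>i. i < m \<Longrightarrow> (\<Sum>j<n. real_of_int (A i j) * d j) = 0 \<Longrightarrow> (\<Sum>j<n. A i j * v j) = 0"
proof -
  define I where "I = {i. i < m \<and> (\<Sum>j<n. real_of_int (A i j) * d j) = 0}"
  define J where "J = {j. j < n \<and> d j \<noteq> 0}"
  define P where "P r \<longleftrightarrow> (\<exists>f g. (\<forall>a<r. f a \<in> I) \<and> (\<forall>b<r. g b \<in> J) \<and> minor A r f g \<noteq> 0)" for r
  have J: "finite J" "J \<subseteq> {..<n}"
    by (auto simp: J_def)
  have "P 0"
    by (simp add: P_def minor_def det_def)
  moreover have "\<forall>r. P r \<longrightarrow> r \<le> card J"
  proof (intro allI impI)
    fix r assume "P r"
    then obtain f g where g: "\<forall>b<r. g b \<in> J" and nz: "minor A r f g \<noteq> 0"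
      unfolding P_def by blast
    have "r = card (g ` {..<r})"
      using card_image[OF minor_inj_cols[OF nz]] by simp
    also have "\<dots> \<le> card J"
      using g by (intro card_mono J) auto
    finally show "r \<le> card J" .
  qed
  ultimately obtain r where r: "P r" and rmax: "\<And>s. P s \<Longrightarrow> s \<le> r"
    using GreatestI_nat[of P 0 "card J"] Greatest_le_nat[of P _ "card J"] by blast
  from r obtain f g where f: "\<forall>a<r. f a \<in> I" and g: "\<forall>b<r. g b \<in> J" and nz: "minor A r f g \<noteq> 0"
    unfolding P_def by blast
  note ginj = minor_inj_cols[OF nz]
  \<comment> \<open>If the minor used all columns of the support of \<open>d\<close>, its
    nonsingularity would force \<open>d\<close> to vanish there. So a column \<open>j0\<close> is
    left for bordering.\<close>
  have "g ` {..<r} \<noteq> J"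
  proof
    assume eq: "g ` {..<r} = J"
    have *: "(\<Sum>b<r. real_of_int (A (f a) (g b)) * d (g b)) = 0" if "a < r" for a
    proof -
      have "(\<Sum>b<r. real_of_int (A (f a) (g b)) * d (g b)) = (\<Sum>j\<in>J. real_of_int (A (f a) j) * d j)"
        unfolding eq[symmetric] by (subst sum.reindex[OF ginj]) simp
      also have "\<dots> = (\<Sum>j<n. real_of_int (A (f a) j) * d j)"
        by (rule sum.mono_neutral_left) (auto simp: J_def)
      also have "\<dots> = 0"
        using f that by (simp add: I_def)
      finally show ?thesis .
    qed
    have "d (g b) = 0" if "b < r" for b
      by (rule minor_nonzero_trivial_kernel[OF nz, of "\<lambda>b. d (g b)"]) (use * that in auto)
    moreover obtain b where "b < r" "j1 = g b"
      using eq j1 by (auto simp: J_def)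
    ultimately show False using j1(2) by simp
  qed
  then obtain j0 where j0: "j0 \<in> J" "j0 \<notin> g ` {..<r}"
    using g by blast
  define g' where "g' = g(r := j0)"
  define C where "C b = (-1) ^ (r + b) * minor A r f (\<lambda>c. g' (if c < b then c else Suc c))" for b
  define v where "v j = (\<Sum>b<Suc r. if g' b = j then C b else 0)" for j
  have g'J: "g' b \<in> J" if "b < Suc r" for b
    using that g j0 by (auto simp: g'_def less_Suc_eq)
  have inj: "inj_on g' {..<Suc r}"
    using ginj j0(2) by (auto simp: g'_def inj_on_def less_Suc_eq)
  have v: "v (g' b) = C b" if "b < Suc r" for b
  proof -
    have "v (g' b) = (\<Sum>c<Suc r. if c = b then C c else 0)"
      unfolding v_def by (rule sum.cong[OF refl]) (use inj that in \<open>auto dest: inj_onD\<close>)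
    also have "\<dots> = C b"
      using that by (subst sum.delta) auto
    finally show ?thesis .
  qed
  have v0: "v j = 0" if "j \<notin> g' ` {..<Suc r}" for j
    unfolding v_def by (rule sum.neutral) (use that in auto)
  have row: "(\<Sum>j<n. A i j * v j) = minor A (Suc r) (f(r := i)) g'" for i
  proof -
    have "(\<Sum>j<n. A i j * v j) = (\<Sum>j<n. \<Sum>b<Suc r. A i j * (if g' b = j then C b else 0))"
      unfolding v_def by (simp only: sum_distrib_left)
    also have "\<dots> = (\<Sum>b<Suc r. \<Sum>j<n. A i j * (if g' b = j then C b else 0))"
      by (rule sum.swap)
    also have "\<dots> = (\<Sum>b<Suc r. A i (g' b) * C b)"
    proof (rule sum.cong[OF refl])
      fix b assume "b \<in> {..<Suc r}"
      then have "g' b < n" using g'J J by blast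
      moreover have "(\<Sum>j<n. A i j * (if g' b = j then C b else 0)) = (\<Sum>j<n. if g' b = j then A i j * C b else 0)"
        by (rule sum.cong) auto
      ultimately show "(\<Sum>j<n. A i j * (if g' b = j then C b else 0)) = A i (g' b) * C b"
        by (simp add: sum.delta')
    qed
    also have "\<dots> = minor A (Suc r) (f(r := i)) g'"
      unfolding C_def by (rule minor_bordered[symmetric])
    finally show ?thesis .
  qed
  have C_le: "\<bar>C b\<bar> \<le> \<Delta>" if "b < Suc r" for b
  proof -
    have "\<forall>a<r. f a < m"
      using f by (simp add: I_def)
    moreover have "\<forall>c<r. g' (if c < b then c else Suc c) < n"
      using g'J J by (auto simp: subset_iff)
    ultimately show ?thesis
      using bnd unfolding minors_le_def C_def by (simp add: abs_mult)
  qed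
  have Delta0: "0 \<le> \<Delta>"
    using C_le[of r] by linarith
  show ?thesis
  proof
    show "j0 < n" using j0 J by blast
    have "v j0 = C r"
      using v[of r] by (simp add: g'_def)
    also have "\<dots> = minor A r f g"
      unfolding C_def minor_def
      by (simp add: g'_def mult_2[symmetric]) (rule arg_cong[where f = det], auto intro!: eq_matI)
    finally show "v j0 \<noteq> 0" using nz by simp
    show "\<bar>v j\<bar> \<le> \<Delta>" for j
    proof (cases "j \<in> g' ` {..<Suc r}")
      case True
      then obtain b where "b < Suc r" "j = g' b" by blast
      then show ?thesis using v[of b] C_le[of b] by simp
    next
      case False
      then show ?thesis using v0 Delta0 by simp
    qed
    show "v j = 0" if "j < n" "d j = 0" for j
    proof (rule v0)
      show "j \<notin> g' ` {..<Suc r}"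
        using g'J that by (auto simp: J_def)
    qed
    show "(\<Sum>j<n. A i j * v j) = 0" if "i < m" "(\<Sum>j<n. real_of_int (A i j) * d j) = 0" for i
    proof (rule ccontr)
      assume "(\<Sum>j<n. A i j * v j) \<noteq> 0"
      \<comment> \<open>The row product is the minor bordered by row \<open>i\<close> and column
        \<open>j0\<close>; were it nonzero, \<open>r\<close> would not be maximal.\<close>
      then have "P (Suc r)"
        unfolding P_def row using f g'J that
        by (intro exI[of _ "f(r := i)"] exI[of _ g']) (auto simp: I_def less_Suc_eq)
      then show False using rmax by fastforce
    qed
  qed
qed

section \<open>Conformal decompositions\<close>

text \<open>Sign compatibility of \<open>x\<close> with \<open>y\<close>: \<open>x\<close> may
  always vanish, and must vanish if \<open>y\<close> does, since then both conjuncts apply.\<close>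

definition conf :: "real \<Rightarrow> real \<Rightarrow> bool" where
  "conf x y \<longleftrightarrow> (0 \<le> y \<longrightarrow> 0 \<le> x) \<and> (y \<le> 0 \<longrightarrow> x \<le> 0)"

lemma conf_trans: "conf x y \<Longrightarrow> conf y z \<Longrightarrow> conf x z"
  by (auto simp: conf_def)

lemma conf_sum_nonneg:
  assumes "\<And>t. t \<in> T \<Longrightarrow> 0 \<le> c t" "\<And>t. t \<in> T \<Longrightarrow> conf (x t) y"
  shows "conf (\<Sum>t\<in>T. c t * x t) y"
  using assms unfolding conf_def by (auto intro!: sum_nonneg sum_nonpos mult_nonneg_nonneg mult_nonneg_nonpos)

text \<open>Row \<open>i\<close> of the identity matrix stacked on \<open>A\<close>. Signs of
  coordinates and of constraint values are thus treated uniformly.\<close>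

definition rowval :: "(nat \<Rightarrow> nat \<Rightarrow> int) \<Rightarrow> nat \<Rightarrow> nat \<Rightarrow> (nat \<Rightarrow> real) \<Rightarrow> real" where
  "rowval A n i x = (if i < n then x i else (\<Sum>j<n. real_of_int (A (i - n) j) * x j))"

lemma rowval_add_mult: "rowval A n i (\<lambda>j. x j + c * y j) = rowval A n i x + c * rowval A n i y"
  by (simp add: rowval_def algebra_simps sum.distrib sum_distrib_left)

lemma rowval_mult: "rowval A n i (\<lambda>j. c * y j) = c * rowval A n i y"
  by (simp add: rowval_def algebra_simps sum_distrib_left)

lemma rowval_sum: "rowval A n i (\<lambda>j. \<Sum>t\<in>T. c t * y t j) = (\<Sum>t\<in>T. c t * rowval A n i (y t))"
proof (cases "i < n")
  case False
  have "(\<Sum>j<n. real_of_int (A (i - n) j) * (\<Sum>t\<in>T. c t * y t j)) =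
        (\<Sum>j<n. \<Sum>t\<in>T. c t * (real_of_int (A (i - n) j) * y t j))"
    by (simp add: sum_distrib_left ac_simps)
  also have "\<dots> = (\<Sum>t\<in>T. \<Sum>j<n. c t * (real_of_int (A (i - n) j) * y t j))"
    by (rule sum.swap)
  finally show ?thesis
    using False by (simp add: rowval_def sum_distrib_left)
qed (simp add: rowval_def)

lemma rowval_cong: "(\<And>j. j < n \<Longrightarrow> x j = y j) \<Longrightarrow> rowval A n i x = rowval A n i y"
  by (auto simp: rowval_def intro!: sum.cong)

text \<open>The ratio test of the simplex method: \<open>\<mu>\<close> is the first step length at
  which some entry moving towards 0 reaches it, so no entry has changed sign before.\<close>

lemma exists_conformal_shift:
  fixes a b :: "'i \<Rightarrow> real"
  assumes "finite R" and zero: "\<And>i. i \<in> R \<Longrightarrow> a i = 0 \<Longrightarrow> b i = 0"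
    and neg: "i0 \<in> R" "a i0 * b i0 < 0"
  obtains \<mu> i where "0 < \<mu>" "\<And>i. i \<in> R \<Longrightarrow> conf (a i + \<mu> * b i) (a i)"
    "i \<in> R" "a i \<noteq> 0" "a i + \<mu> * b i = 0"
proof -
  define N where "N = {i \<in> R. a i * b i < 0}"
  define \<mu> where "\<mu> = Min ((\<lambda>i. - a i / b i) ` N)"
  have N: "finite ((\<lambda>i. - a i / b i) ` N)" "(\<lambda>i. - a i / b i) ` N \<noteq> {}"
    using assms by (auto simp: N_def)
  have "\<mu> \<in> (\<lambda>i. - a i / b i) ` N"
    unfolding \<mu>_def using N by (rule Min_in)
  then obtain i1 where i1: "i1 \<in> N" "\<mu> = - a i1 / b i1" by blast
  have pos: "0 < - a i / b i" if "i \<in> N" for i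
    using that by (auto simp: N_def mult_less_0_iff divide_less_0_iff)
  have mu: "0 < \<mu>" using i1 pos by simp
  show ?thesis
  proof
    show "0 < \<mu>" by (rule mu)
    show "conf (a i + \<mu> * b i) (a i)" if "i \<in> R" for i
    proof (cases "i \<in> N")
      case True
      then have le: "\<mu> \<le> - a i / b i"
        unfolding \<mu>_def using N by (intro Min_le) auto
      consider "a i > 0" "b i < 0" | "a i < 0" "b i > 0"
        using True by (auto simp: N_def mult_less_0_iff)
      then show ?thesis
        using le by cases (simp_all add: conf_def field_simps)
    next
      case False
      then have "0 \<le> a i * b i" using that by (simp add: N_def)
      then show ?thesis
        using mu zero[OF that] unfolding conf_def zero_le_mult_iff
        by (auto intro: add_nonneg_nonneg add_nonpos_nonpos simp: mult_nonneg_nonpos)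
    qed
    show "i1 \<in> R" "a i1 \<noteq> 0" "a i1 + \<mu> * b i1 = 0"
      using i1 by (auto simp: N_def)
  qed
qed

lemma conf_zero: "conf x 0 \<longleftrightarrow> x = 0"
  by (auto simp: conf_def)

definition conformal :: "(nat \<Rightarrow> nat \<Rightarrow> int) \<Rightarrow> nat \<Rightarrow> nat \<Rightarrow> (nat \<Rightarrow> real) \<Rightarrow> (nat \<Rightarrow> real) \<Rightarrow> bool" where
  "conformal A m n x y \<longleftrightarrow> (\<forall>i<n + m. conf (rowval A n i x) (rowval A n i y))"

lemma conformal_trans: "conformal A m n x y \<Longrightarrow> conformal A m n y z \<Longrightarrow> conformal A m n x z"
  unfolding conformal_def using conf_trans by blast

abbreviation nonzeros :: "(nat \<Rightarrow> nat \<Rightarrow> int) \<Rightarrow> nat \<Rightarrow> nat \<Rightarrow> (nat \<Rightarrow> real) \<Rightarrow> nat set" where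
  "nonzeros A m n x \<equiv> {i. i < n + m \<and> rowval A n i x \<noteq> 0}"

lemma card_nonzeros_less:
  assumes "conformal A m n x y" "i < n + m" "rowval A n i y \<noteq> 0" "rowval A n i x = 0"
  shows "card (nonzeros A m n x) < card (nonzeros A m n y)"
proof (rule psubset_card_mono)
  have "nonzeros A m n x \<subseteq> nonzeros A m n y"
    using assms(1) by (auto simp: conformal_def conf_zero)
  then show "nonzeros A m n x \<subset> nonzeros A m n y"
    using assms(2-4) by blast
qed simp

lemma exists_conformal_step:
  assumes zero: "\<And>i. i < n + m \<Longrightarrow> rowval A n i d = 0 \<Longrightarrow> rowval A n i v = 0"
    and j: "j < n" "d j * v j < 0"
  obtains \<mu> where "0 < \<mu>" "conformal A m n (\<lambda>j. d j + \<mu> * v j) d"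
    "card (nonzeros A m n (\<lambda>j. d j + \<mu> * v j)) < card (nonzeros A m n d)"
proof -
  have "rowval A n j d * rowval A n j v < 0"
    using j by (simp add: rowval_def)
  with exists_conformal_shift[of "{..<n + m}" "\<lambda>i. rowval A n i d" "\<lambda>i. rowval A n i v" j] zero j(1)
  obtain \<mu> i where mu: "0 < \<mu>" "\<And>i. i < n + m \<Longrightarrow> conf (rowval A n i d + \<mu> * rowval A n i v) (rowval A n i d)"
    and i: "i < n + m" "rowval A n i d \<noteq> 0" "rowval A n i d + \<mu> * rowval A n i v = 0"
    by (metis (no_types, lifting) finite_lessThan lessThan_iff trans_less_add1)
  have c: "conformal A m n (\<lambda>j. d j + \<mu> * v j) d"
    using mu(2) by (simp add: conformal_def rowval_add_mult)
  show ?thesis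
    by (rule that[OF mu(1) c]) (rule card_nonzeros_less[OF c i(1,2)], use i(3) in \<open>simp add: rowval_add_mult\<close>)
qed

text \<open>The bounded null vector \<open>v\<close> need not be sign-compatible with
  \<open>d\<close>. If \<open>d\<close> is a multiple of \<open>v\<close>, then \<open>v\<close> or
  its negative is. Otherwise a shift of \<open>d\<close> along \<open>v\<close> annihilates another
  row value while staying compatible with \<open>d\<close>, and induction applies to the shifted
  vector.\<close>

lemma exists_conformal_vector:
  assumes bnd: "minors_le \<Delta> m n A" and "j < n" "d j \<noteq> 0"
  shows "\<exists>v j. j < n \<and> v j \<noteq> 0 \<and> (\<forall>j<n. \<bar>v j\<bar> \<le> \<Delta>) \<and> conformal A m n (\<lambda>j. real_of_int (v j)) d"
  using assms(2-)
proof (induction "card (nonzeros A m n d)" arbitrary: d j rule: less_induct)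
  case less
  obtain v j0
    where v: "j0 < n" "v j0 \<noteq> 0" "\<And>j. j < n \<Longrightarrow> \<bar>v j\<bar> \<le> \<Delta>" "\<And>j. j < n \<Longrightarrow> d j = 0 \<Longrightarrow> v j = 0"
    "\<And>i. i < m \<Longrightarrow> (\<Sum>j<n. real_of_int (A i j) * d j) = 0 \<Longrightarrow> (\<Sum>j<n. A i j * v j) = 0"
    by (rule bounded_null_vector[where d = d, OF bnd less.prems]) blast
  define V where "V s j = real_of_int s * real_of_int (v j)" for s :: int and j
  have rV: "rowval A n i (V s) = real_of_int s * rowval A n i (\<lambda>j. real_of_int (v j))" for i s
    unfolding V_def by (rule rowval_mult)
  have zero: "rowval A n i (V s) = 0" if "i < n + m" "rowval A n i d = 0" for i s
  proof (cases "i < n")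
    case True
    then show ?thesis using v(4) that by (simp add: rowval_def V_def)
  next
    case False
    then have "(\<Sum>j<n. A (i - n) j * v j) = 0"
      using v(5)[of "i - n"] that by (simp add: rowval_def)
    then have "(\<Sum>j<n. real_of_int (A (i - n) j) * real_of_int (v j)) = 0"
      by (metis (mono_tags, lifting) of_int_0 of_int_mult of_int_sum sum.cong)
    then show ?thesis
      unfolding rV using False by (simp add: rowval_def)
  qed
  show ?case
  proof (cases "\<exists>c :: real. \<forall>j<n. d j = c * real_of_int (v j)")
    case True
    then obtain c :: real where c: "\<And>j. j < n \<Longrightarrow> d j = c * real_of_int (v j)" by blast
    define s :: int where "s = (if c > 0 then 1 else - 1)"
    have "c \<noteq> 0" using c less.prems by auto
    have "rowval A n i d = c * rowval A n i (\<lambda>j. real_of_int (v j))" for i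
      using rowval_cong[of n d "\<lambda>j. c * real_of_int (v j)" A i] c by (simp add: rowval_mult)
    then have "conformal A m n (\<lambda>j. real_of_int (s * v j)) d"
      using \<open>c \<noteq> 0\<close> rV[of _ s] unfolding conformal_def conf_def V_def
      by (auto simp: s_def zero_le_mult_iff mult_le_0_iff)
    then show ?thesis
      using v by (intro exI[of _ "\<lambda>j. s * v j"] exI[of _ j0]) (auto simp: s_def abs_mult)
  next
    case False
    define s :: int where "s = (if d j0 * v j0 > 0 then - 1 else 1)"
    have "d j0 \<noteq> 0" using v by auto
    then have neg: "d j0 * V s j0 < 0"
      using v(2) by (auto simp: V_def s_def mult_less_0_iff zero_less_mult_iff)
    obtain \<mu> where mu: "conformal A m n (\<lambda>j. d j + \<mu> * V s j) d"
      "card (nonzeros A m n (\<lambda>j. d j + \<mu> * V s j)) < card (nonzeros A m n d)"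
      by (rule exists_conformal_step[where d = d and v = "V s", OF zero v(1) neg])
    define d' where "d' j = d j + \<mu> * V s j" for j
    note mu = mu[folded d'_def]
    \<comment> \<open>The induction hypothesis needs a nonzero vector; this is where
      \<open>d\<close> not being a multiple of \<open>v\<close> enters.\<close>
    have "\<exists>j<n. d' j \<noteq> 0"
    proof (rule ccontr)
      assume "\<not> (\<exists>j<n. d' j \<noteq> 0)"
      then have "d j = (- \<mu> * s) * real_of_int (v j)" if "j < n" for j
        using that by (auto simp: d'_def V_def add_eq_0_iff algebra_simps)
      then have "\<exists>c. \<forall>j<n. d j = c * real_of_int (v j)"
        by (intro exI[of _ "- \<mu> * s"]) simp
      with False show False by simp
    qed
    then obtain j' where j': "j' < n" "d' j' \<noteq> 0" by blast
    from less.hyps[OF mu(2) j'] obtain u i where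
      "i < n" "u i \<noteq> 0" "\<forall>j<n. \<bar>u j\<bar> \<le> \<Delta>" "conformal A m n (\<lambda>j. real_of_int (u j)) d'"
      by (elim exE conjE)
    then show ?thesis
      by (intro exI[of _ u] exI[of _ i] conjI conformal_trans[OF _ mu(1)])
  qed
qed

text \<open>Subtracting a suitable multiple of a compatible vector annihilates a row value, and
  vectors compatible with the remainder are compatible with \<open>d\<close>. The number of terms is
  governed by the nonzero row values, up to \<open>n + m\<close> of them, so it still has to be
  reduced to \<open>n\<close>.\<close>

lemma conformal_decomposition_aux:
  assumes bnd: "minors_le \<Delta> m n A"
  shows "\<exists>(N :: nat) v lam. (\<forall>t<N. 0 \<le> lam t \<and> (\<forall>j<n. \<bar>v t j\<bar> \<le> \<Delta>) \<and>
      conformal A m n (\<lambda>j. real_of_int (v t j)) d) \<and> (\<forall>j<n. d j = (\<Sum>t<N. lam t * real_of_int (v t j)))"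
proof (induction "card (nonzeros A m n d)" arbitrary: d rule: less_induct)
  case less
  show ?case
  proof (cases "\<exists>j<n. d j \<noteq> 0")
    case False
    then show ?thesis by (intro exI[of _ 0]) auto
  next
    case True
    then obtain v j where v: "j < n" "v j \<noteq> 0" "\<forall>j<n. \<bar>v j\<bar> \<le> \<Delta>"
      and vc: "conformal A m n (\<lambda>j. real_of_int (v j)) d"
      using exists_conformal_vector[OF bnd] by blast
    let ?v = "\<lambda>j. real_of_int (v j)"
    have vci: "conf (rowval A n i ?v) (rowval A n i d)" if "i < n + m" for i
      using vc that by (simp add: conformal_def)
    have zero: "rowval A n i (\<lambda>j. - ?v j) = 0" if "i < n + m" "rowval A n i d = 0" for i
      using vci[OF that(1)] that(2) rowval_mult[of A n i "- 1" ?v] by (simp add: conf_zero)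
    have "conf (v j) (d j)"
      using vci[of j] v(1) by (simp add: rowval_def)
    then have neg: "d j * - ?v j < 0"
      using v(2) unfolding conf_def mult_less_0_iff by (cases "d j" "0 :: real" rule: linorder_cases) auto
    obtain \<mu> where mu: "0 < \<mu>" "conformal A m n (\<lambda>j. d j + \<mu> * - ?v j) d"
      "card (nonzeros A m n (\<lambda>j. d j + \<mu> * - ?v j)) < card (nonzeros A m n d)"
      by (rule exists_conformal_step[where d = d and v = "\<lambda>j. - ?v j", OF zero v(1) neg])
    define d' where "d' j = d j + \<mu> * - ?v j" for j
    note mu = mu[folded d'_def]
    from less[OF mu(3)] obtain N :: nat and u lam where
      IH: "\<forall>t<N. 0 \<le> lam t \<and> (\<forall>j<n. \<bar>u t j\<bar> \<le> \<Delta>) \<and> conformal A m n (\<lambda>j. real_of_int (u t j)) d'"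
        "\<forall>j<n. d' j = (\<Sum>t<N. lam t * real_of_int (u t j))"
      by blast
    have *: "conformal A m n (\<lambda>j. real_of_int (u t j)) d" if "t < N" for t
      using IH(1) that conformal_trans[OF _ mu(2)] by blast
    show ?thesis
      using IH mu(1) v vc *
      by (intro exI[of _ "Suc N"] exI[of _ "u(N := v)"] exI[of _ "lam(N := \<mu>)"])
        (auto simp: less_Suc_eq d'_def algebra_simps)
  qed
qed

section \<open>Reducing the number of terms\<close>

lemma exists_linear_dependence:
  fixes u :: "'t \<Rightarrow> nat \<Rightarrow> real"
  assumes T: "finite T" "n < card T"
  obtains c where "\<exists>t\<in>T. c t \<noteq> 0" "\<And>j. j < n \<Longrightarrow> (\<Sum>t\<in>T. c t * u t j) = 0"
proof -
  obtain h where h: "bij_betw h {..<card T} T"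
    using ex_bij_betw_nat_finite[OF T(1)] by (auto simp: lessThan_atLeast0)
  let ?N = "card T"
  \<comment> \<open>The vectors are the columns, padded with zero rows to a square matrix. As
    \<open>n < card T\<close>, row \<open>n\<close> is zero and the determinant vanishes.\<close>
  let ?M = "mat ?N ?N (\<lambda>(i, t). if i < n then u (h t) i else 0)"
  have "det ?M = (\<Sum>j<?N. ?M $$ (n, j) * cofactor ?M n j)"
    by (rule laplace_expansion_row) (use T in auto)
  also have "\<dots> = 0"
    by (rule sum.neutral) (use T in auto)
  finally obtain x where x: "x \<in> carrier_vec ?N" "x \<noteq> 0\<^sub>v ?N" "?M *\<^sub>v x = 0\<^sub>v ?N"
    using det_0_iff_vec_prod_zero[of ?M ?N] by auto
  define c where "c t = x $ (inv_into {..<?N} h t)" for t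
  have ch: "c (h i) = x $ i" if "i < ?N" for i
    using bij_betw_inv_into_left[OF h] that by (simp add: c_def)
  show ?thesis
  proof
    obtain i where "i < ?N" "x $ i \<noteq> 0"
      using x(1,2) by (metis carrier_vecD eq_vecI index_zero_vec)
    then show "\<exists>t\<in>T. c t \<noteq> 0"
      using ch h by (metis bij_betwE lessThan_iff)
    show "(\<Sum>t\<in>T. c t * u t j) = 0" if "j < n" for j
    proof -
      have "(\<Sum>t\<in>T. c t * u t j) = (\<Sum>i<?N. c (h i) * u (h i) j)"
        by (rule sum.reindex_bij_betw[OF h, symmetric])
      also have "\<dots> = (\<Sum>i<?N. u (h i) j * x $ i)"
        by (rule sum.cong) (simp_all add: ch)
      also have "\<dots> = (?M *\<^sub>v x) $ j"
        using that T x(1) by (simp add: scalar_prod_def lessThan_atLeast0)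
      also have "\<dots> = 0"
        using x(3) that T by simp
      finally show ?thesis .
    qed
  qed
qed

text \<open>The ratio test again, now on the coefficients: moving along a linear dependence keeps
  the sum and drives some coefficient to 0. The sign \<open>s\<close> ensures that at least one
  coefficient decreases.\<close>

lemma conic_Caratheodory:
  fixes u :: "'t \<Rightarrow> nat \<Rightarrow> real"
  assumes "finite T" "\<And>t. t \<in> T \<Longrightarrow> 0 \<le> lam t"
  shows "\<exists>T' lam'. T' \<subseteq> T \<and> card T' \<le> n \<and> (\<forall>t\<in>T'. 0 \<le> lam' t) \<and>
    (\<forall>j<n. (\<Sum>t\<in>T'. lam' t * u t j) = (\<Sum>t\<in>T. lam t * u t j))"
  using assms
proof (induction "card T" arbitrary: T lam rule: less_induct)
  case less
  show ?case
  proof (cases "card T \<le> n")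
    case True
    then show ?thesis using less.prems by blast
  next
    case False
    have "\<exists>lam'. (\<forall>t\<in>T. 0 \<le> lam' t) \<and> (\<exists>t\<in>T. lam' t = 0) \<and>
        (\<forall>j<n. (\<Sum>t\<in>T. lam' t * u t j) = (\<Sum>t\<in>T. lam t * u t j))"
    proof (cases "\<exists>t\<in>T. lam t = 0")
      case True
      then show ?thesis using less.prems by blast
    next
      case nz: False
      obtain c where c: "\<exists>t\<in>T. c t \<noteq> 0" "\<And>j. j < n \<Longrightarrow> (\<Sum>t\<in>T. c t * u t j) = 0"
        using exists_linear_dependence[of T n u] less.prems(1) False by (metis not_le)
      then obtain t0 where t0: "t0 \<in> T" "c t0 \<noteq> 0" by blast
      define s :: real where "s = (if c t0 > 0 then - 1 else 1)"
      have pos: "0 < lam t" if "t \<in> T" for t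
        using nz less.prems(2)[OF that] that by (metis order_le_less)
      have "lam t0 * (s * c t0) < 0"
        using pos[OF t0(1)] t0(2) by (auto simp: s_def mult_less_0_iff zero_less_mult_iff)
      from exists_conformal_shift[of T lam "\<lambda>t. s * c t" t0] this t0(1) less.prems(1) nz
      obtain \<mu> t1 where mu: "\<And>t. t \<in> T \<Longrightarrow> conf (lam t + \<mu> * (s * c t)) (lam t)"
        "t1 \<in> T" "lam t1 + \<mu> * (s * c t1) = 0"
        by (metis (no_types, lifting))
      have "(\<Sum>t\<in>T. (lam t + \<mu> * (s * c t)) * u t j) = (\<Sum>t\<in>T. lam t * u t j)" if "j < n" for j
      proof -
        have "(\<Sum>t\<in>T. (lam t + \<mu> * (s * c t)) * u t j) =
            (\<Sum>t\<in>T. lam t * u t j) + \<mu> * s * (\<Sum>t\<in>T. c t * u t j)"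
          by (simp add: algebra_simps sum.distrib sum_distrib_left)
        then show ?thesis using c(2)[OF that] by simp
      qed
      moreover have "0 \<le> lam t + \<mu> * (s * c t)" if "t \<in> T" for t
        using mu(1)[OF that] pos[OF that] by (simp add: conf_def)
      ultimately show ?thesis
        using mu(2,3) by (intro exI[of _ "\<lambda>t. lam t + \<mu> * (s * c t)"]) auto
    qed
    then obtain lam' t where lam': "\<forall>t\<in>T. 0 \<le> lam' t" "t \<in> T" "lam' t = 0"
        "\<forall>j<n. (\<Sum>t\<in>T. lam' t * u t j) = (\<Sum>t\<in>T. lam t * u t j)" by blast
    have "card (T - {t}) < card T"
      using lam'(2) less.prems(1) by (intro card_Diff1_less)
    from less.hyps[OF this, of lam'] less.prems(1) lam'(1)
    obtain T' lam'' where *: "T' \<subseteq> T - {t}" "card T' \<le> n" "\<forall>t\<in>T'. 0 \<le> lam'' t"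
      "\<forall>j<n. (\<Sum>t\<in>T'. lam'' t * u t j) = (\<Sum>s\<in>T - {t}. lam' s * u s j)" by auto
    have "(\<Sum>s\<in>T - {t}. lam' s * u s j) = (\<Sum>s\<in>T. lam' s * u s j)" for j
      using lam'(2,3) less.prems(1) by (simp add: sum.remove)
    with * lam'(4) show ?thesis
      by (intro exI[of _ T'] exI[of _ lam'']) auto
  qed
qed

lemma conformal_decomposition:
  assumes bnd: "minors_le \<Delta> m n A"
  obtains T :: "nat set" and v lam where "finite T" "card T \<le> n" "\<And>t. t \<in> T \<Longrightarrow> 0 \<le> lam t"
    "\<And>t j. t \<in> T \<Longrightarrow> j < n \<Longrightarrow> \<bar>v t j\<bar> \<le> \<Delta>"
    "\<And>t. t \<in> T \<Longrightarrow> conformal A m n (\<lambda>j. real_of_int (v t j)) d"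
    "\<And>j. j < n \<Longrightarrow> d j = (\<Sum>t\<in>T. lam t * real_of_int (v t j))"
proof -
  obtain N :: nat and v lam where *: "\<forall>t<N. 0 \<le> lam t \<and> (\<forall>j<n. \<bar>v t j\<bar> \<le> \<Delta>) \<and>
      conformal A m n (\<lambda>j. real_of_int (v t j)) d" "\<forall>j<n. d j = (\<Sum>t<N. lam t * real_of_int (v t j))"
    using conformal_decomposition_aux[OF bnd, of d] by blast
  obtain T lam' where T: "T \<subseteq> {..<N}" "card T \<le> n" "\<forall>t\<in>T. 0 \<le> lam' t"
    "\<forall>j<n. (\<Sum>t\<in>T. lam' t * real_of_int (v t j)) = (\<Sum>t<N. lam t * real_of_int (v t j))"
    using conic_Caratheodory[of "{..<N}" lam n "\<lambda>t j. real_of_int (v t j)"] *(1) by auto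
  show ?thesis
  proof (rule that[of T lam' v])
    show "finite T" using finite_subset[OF T(1)] by simp
    show "card T \<le> n" by (rule T(2))
    show "0 \<le> lam' t" if "t \<in> T" for t using T(3) that by blast
    show "\<bar>v t j\<bar> \<le> \<Delta>" if "t \<in> T" "j < n" for t j using *(1) T(1) that by blast
    show "conformal A m n (\<lambda>j. real_of_int (v t j)) d" if "t \<in> T" for t using *(1) T(1) that by blast
    show "d j = (\<Sum>t\<in>T. lam' t * real_of_int (v t j))" if "j < n" for j using *(2) T(4) that by simp
  qed
qed

section \<open>Rounding conformal decompositions\<close>

lemma abs_diff_double_le:
  fixes y d :: int
  assumes "conf (real_of_int y) (real_of_int d)" "conf (real_of_int (d - y)) (real_of_int d)"
  shows "min 0 d \<le> y" "y \<le> max 0 d" "\<bar>d - 2 * y\<bar> \<le> \<bar>d\<bar>"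
  using assms by (auto simp: conf_def)

lemma minors_le_nonneg:
  assumes "minors_le \<Delta> m n A"
  shows "0 \<le> \<Delta>"
proof -
  have "\<bar>minor A 0 f g\<bar> \<le> \<Delta>" for f g
    using assms unfolding minors_le_def by blast
  then show ?thesis
    by (rule order_trans[OF abs_ge_zero])
qed

text \<open>Both \<open>y\<close> and \<open>d - y\<close> are nonnegative combinations of vectors
  compatible with \<open>d\<close>, so each row value of \<open>y\<close> lies between 0 and that of
  \<open>d\<close>; this will keep both new points feasible. In \<open>d - 2 y\<close> at most
  \<open>n\<close> terms remain, with coefficients at most 2 and entries at most
  \<open>\<Delta>\<close> in absolute value.\<close>

lemma conformal_halving:
  fixes d :: "nat \<Rightarrow> int"
  assumes bnd: "minors_le \<Delta> m n A"
  obtains y :: "nat \<Rightarrow> int" where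
    "\<And>i. i < m \<Longrightarrow> min 0 (\<Sum>j<n. A i j * d j) \<le> (\<Sum>j<n. A i j * y j)"
    "\<And>i. i < m \<Longrightarrow> (\<Sum>j<n. A i j * y j) \<le> max 0 (\<Sum>j<n. A i j * d j)"
    "\<And>j. j < n \<Longrightarrow> \<bar>d j - 2 * y j\<bar> \<le> \<bar>d j\<bar>"
    "\<And>j. j < n \<Longrightarrow> \<bar>d j - 2 * y j\<bar> \<le> 2 * int n * \<Delta>"
proof -
  obtain T :: "nat set" and v lam where T: "finite T" "card T \<le> n" "\<And>t. t \<in> T \<Longrightarrow> 0 \<le> lam t"
    "\<And>t j. t \<in> T \<Longrightarrow> j < n \<Longrightarrow> \<bar>v t j\<bar> \<le> \<Delta>"
    "\<And>t. t \<in> T \<Longrightarrow> conformal A m n (\<lambda>j. real_of_int (v t j)) (\<lambda>j. real_of_int (d j))"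
    "\<And>j. j < n \<Longrightarrow> real_of_int (d j) = (\<Sum>t\<in>T. lam t * real_of_int (v t j))"
    by (rule conformal_decomposition[OF bnd, of "\<lambda>j. real_of_int (d j)"]) blast
  define k where "k t = \<lfloor>lam t / 2\<rfloor>" for t
  have k: "0 \<le> real_of_int (k t)" "0 \<le> lam t - real_of_int (k t)" "\<bar>lam t - 2 * real_of_int (k t)\<bar> \<le> 2"
    if "t \<in> T" for t
  proof -
    have "0 \<le> real_of_int (k t)"
      using T(3)[OF that] by (simp add: k_def)
    moreover have "real_of_int (k t) \<le> lam t / 2" "lam t / 2 < real_of_int (k t) + 1"
      unfolding k_def by linarith+
    ultimately show "0 \<le> real_of_int (k t)" "0 \<le> lam t - real_of_int (k t)"
      "\<bar>lam t - 2 * real_of_int (k t)\<bar> \<le> 2"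
      using T(3)[OF that] by linarith+
  qed
  define y where "y j = (\<Sum>t\<in>T. k t * v t j)" for j
  have y: "real_of_int (y j) = (\<Sum>t\<in>T. real_of_int (k t) * real_of_int (v t j))" for j
    by (simp add: y_def)
  have conf_y: "conf (rowval A n i (\<lambda>j. real_of_int (y j))) (rowval A n i (\<lambda>j. real_of_int (d j)))"
    if "i < n + m" for i
    unfolding y rowval_sum using T(5) k that by (intro conf_sum_nonneg) (auto simp: conformal_def)
  have diff: "real_of_int (d j - y j) = (\<Sum>t\<in>T. (lam t - real_of_int (k t)) * real_of_int (v t j))" if "j < n" for j
    using that T(6) y by (simp add: left_diff_distrib sum_subtractf)
  have conf_dy: "conf (rowval A n i (\<lambda>j. real_of_int (d j - y j))) (rowval A n i (\<lambda>j. real_of_int (d j)))"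
    if "i < n + m" for i
  proof -
    have "rowval A n i (\<lambda>j. real_of_int (d j - y j)) =
        (\<Sum>t\<in>T. (lam t - real_of_int (k t)) * rowval A n i (\<lambda>j. real_of_int (v t j)))"
      unfolding rowval_sum[symmetric] by (rule rowval_cong) (rule diff)
    then show ?thesis
      using T(5) k that by (auto simp: conformal_def intro!: conf_sum_nonneg)
  qed
  have row: "rowval A n (n + i) (\<lambda>j. real_of_int (x j)) = real_of_int (\<Sum>j<n. A i j * x j)" for i x
    by (simp add: rowval_def)
  have rowdiff: "(\<Sum>j<n. A i j * (d j - y j)) = (\<Sum>j<n. A i j * d j) - (\<Sum>j<n. A i j * y j)" for i
    by (simp add: right_diff_distrib sum_subtractf)
  show ?thesis
  proof
    show "min 0 (\<Sum>j<n. A i j * d j) \<le> (\<Sum>j<n. A i j * y j)"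
      "(\<Sum>j<n. A i j * y j) \<le> max 0 (\<Sum>j<n. A i j * d j)" if "i < m" for i
      using conf_y[of "n + i"] conf_dy[of "n + i"] that unfolding row rowdiff
      by (auto intro: abs_diff_double_le)
    fix j assume j: "j < n"
    show "\<bar>d j - 2 * y j\<bar> \<le> \<bar>d j\<bar>"
      using conf_y[of j] conf_dy[of j] j by (intro abs_diff_double_le) (simp_all add: rowval_def)
    have "real_of_int (d j - 2 * y j) = (\<Sum>t\<in>T. (lam t - 2 * real_of_int (k t)) * real_of_int (v t j))"
      using j T(6) y by (simp add: left_diff_distrib sum_subtractf sum_distrib_left mult.assoc)
    also have "\<bar>\<dots>\<bar> \<le> (\<Sum>t\<in>T. 2 * real_of_int \<Delta>)"
    proof (rule order_trans[OF sum_abs sum_mono])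
      fix t assume t: "t \<in> T"
      have "\<bar>real_of_int (v t j)\<bar> \<le> real_of_int \<Delta>"
        using T(4)[OF t j] by linarith
      then show "\<bar>(lam t - 2 * real_of_int (k t)) * real_of_int (v t j)\<bar> \<le> 2 * real_of_int \<Delta>"
        unfolding abs_mult using k(3)[OF t] by (intro mult_mono) auto
    qed
    finally have le: "\<bar>real_of_int (d j - 2 * y j)\<bar> \<le> real (card T) * (2 * real_of_int \<Delta>)" by simp
    have "0 \<le> \<Delta>"
      by (rule minors_le_nonneg[OF bnd])
    then have "real (card T) * (2 * real_of_int \<Delta>) \<le> real n * (2 * real_of_int \<Delta>)"
      using T(2) by (intro mult_right_mono) auto
    with le have "real_of_int \<bar>d j - 2 * y j\<bar> \<le> real_of_int (2 * int n * \<Delta>)" by simp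
    then show "\<bar>d j - 2 * y j\<bar> \<le> 2 * int n * \<Delta>"
      unfolding of_int_le_iff .
  qed
qed

text \<open>The conformal decomposition of \<open>(x, 1)\<close> in the homogenization of the system \<open>A x \<le> w\<close>:
  the terms with last entry 0 are rays of the recession cone.\<close>

lemma bounded_solution_plus_ray:
  fixes x :: "nat \<Rightarrow> int"
  assumes bnd: "minors_le \<Delta> m (Suc n) (\<lambda>i j. if j < n then A i j else - w i)"
    and x: "\<And>i. i < m \<Longrightarrow> (\<Sum>j<n. A i j * x j) \<le> w i"
  obtains r :: "nat \<Rightarrow> int" where
    "\<And>i. i < m \<Longrightarrow> (\<Sum>j<n. A i j * r j) \<le> 0"
    "\<And>i. i < m \<Longrightarrow> (\<Sum>j<n. A i j * (x j - r j)) \<le> w i"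
    "\<And>j. j < n \<Longrightarrow> \<bar>x j - r j\<bar> \<le> int (Suc n) * \<Delta>"
proof -
  define B where "B i j = (if j < n then A i j else - w i)" for i j
  define d where "d j = (if j < n then x j else 1)" for j
  from bnd have bndB: "minors_le \<Delta> m (Suc n) B"
    by (simp add: B_def[abs_def])
  obtain T :: "nat set" and v lam where T: "finite T" "card T \<le> Suc n" "\<And>t. t \<in> T \<Longrightarrow> 0 \<le> lam t"
    "\<And>t j. t \<in> T \<Longrightarrow> j < Suc n \<Longrightarrow> \<bar>v t j\<bar> \<le> \<Delta>"
    "\<And>t. t \<in> T \<Longrightarrow> conformal B m (Suc n) (\<lambda>j. real_of_int (v t j)) (\<lambda>j. real_of_int (d j))"
    "\<And>j. j < Suc n \<Longrightarrow> real_of_int (d j) = (\<Sum>t\<in>T. lam t * real_of_int (v t j))"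
    by (rule conformal_decomposition[OF bndB, of "\<lambda>j. real_of_int (d j)"]) blast
  have row: "rowval B (Suc n) (Suc n + i) (\<lambda>j. real_of_int (z j)) = real_of_int ((\<Sum>j<n. A i j * z j) - w i * z n)" for i z
    by (simp add: rowval_def B_def)
  have vn: "0 \<le> v t n" if "t \<in> T" for t
    using T(5)[OF that] unfolding conformal_def by (auto simp: rowval_def conf_def d_def dest: spec[of _ n])
  have vrow: "(\<Sum>j<n. A i j * v t j) - w i * v t n \<le> 0" if "t \<in> T" "i < m" for t i
  proof -
    have "conf (real_of_int ((\<Sum>j<n. A i j * v t j) - w i * v t n)) (real_of_int ((\<Sum>j<n. A i j * d j) - w i * d n))"
      using T(5)[OF that(1)] that(2) unfolding conformal_def row[symmetric] by auto
    moreover have "(\<Sum>j<n. A i j * d j) - w i * d n \<le> 0"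
      using x[OF that(2)] by (simp add: d_def)
    ultimately show ?thesis
      unfolding conf_def by (metis of_int_0_le_iff of_int_le_0_iff)
  qed
  \<comment> \<open>Only rays are split off, in integral multiples. Every remaining coefficient is
    at most 1: for a ray it is a fractional part; for another term the last entry is a positive
    integer, and the last entries combine to 1.\<close>
  define k where "k t = (if v t n = 0 then \<lfloor>lam t\<rfloor> else 0)" for t
  define \<mu> where "\<mu> t = lam t - real_of_int (k t)" for t
  define r where "r j = (\<Sum>t\<in>T. k t * v t j)" for j
  have k0: "0 \<le> k t" and \<mu>0: "0 \<le> \<mu> t" if "t \<in> T" for t
    using T(3)[OF that] by (auto simp: k_def \<mu>_def)
  have \<mu>1: "\<mu> t \<le> 1" if "t \<in> T" for t
  proof (cases "v t n = 0")
    case True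
    then show ?thesis unfolding \<mu>_def k_def by simp linarith
  next
    case False
    have "lam t * 1 \<le> lam t * real_of_int (v t n)"
      using False vn[OF that] T(3)[OF that] by (intro mult_left_mono) auto
    also have "\<dots> \<le> (\<Sum>t\<in>T. lam t * real_of_int (v t n))"
      using that T(1,3) vn by (intro member_le_sum) auto
    also have "\<dots> = 1"
      using T(6)[of n] by (simp add: d_def)
    finally show ?thesis using False by (simp add: \<mu>_def k_def)
  qed
  have rn: "r n = 0"
    unfolding r_def k_def by (rule sum.neutral) auto
  have dr: "real_of_int (d j - r j) = (\<Sum>t\<in>T. \<mu> t * real_of_int (v t j))" if "j < Suc n" for j
    using T(6)[OF that] by (simp add: \<mu>_def r_def left_diff_distrib sum_subtractf)
  show ?thesis
  proof
    fix i assume i: "i < m"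
    have "(\<Sum>j<n. A i j * r j) = (\<Sum>t\<in>T. k t * (\<Sum>j<n. A i j * v t j))"
      unfolding r_def sum_distrib_left by (subst sum.swap) (simp add: ac_simps)
    also have "\<dots> \<le> 0"
    proof (rule sum_nonpos)
      fix t assume t: "t \<in> T"
      show "k t * (\<Sum>j<n. A i j * v t j) \<le> 0"
        using vrow[OF t i] k0[OF t] by (cases "v t n = 0") (auto simp: k_def mult_nonneg_nonpos)
    qed
    finally show "(\<Sum>j<n. A i j * r j) \<le> 0" .
    have "real_of_int ((\<Sum>j<n. A i j * (d j - r j)) - w i * (d n - r n)) =
        rowval B (Suc n) (Suc n + i) (\<lambda>j. real_of_int (d j - r j))"
      unfolding row ..
    also have "\<dots> = (\<Sum>t\<in>T. \<mu> t * rowval B (Suc n) (Suc n + i) (\<lambda>j. real_of_int (v t j)))"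
      unfolding rowval_sum[symmetric] by (rule rowval_cong) (rule dr)
    also have "\<dots> \<le> 0"
      unfolding row using vrow[OF _ i] \<mu>0
      by (intro sum_nonpos mult_nonneg_nonpos) (auto simp only: of_int_le_0_iff)
    finally have "(\<Sum>j<n. A i j * (d j - r j)) - w i * (d n - r n) \<le> 0"
      by (simp only: of_int_le_0_iff)
    then show "(\<Sum>j<n. A i j * (x j - r j)) \<le> w i"
      using rn by (simp add: d_def)
  next
    fix j assume j: "j < n"
    have "\<bar>real_of_int (d j - r j)\<bar> \<le> (\<Sum>t\<in>T. real_of_int \<Delta>)"
      unfolding dr[OF less_SucI[OF j]]
    proof (rule order_trans[OF sum_abs sum_mono])
      fix t assume t: "t \<in> T"
      have "\<bar>real_of_int (v t j)\<bar> \<le> real_of_int \<Delta>"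
        using T(4)[OF t, of j] j by linarith
      moreover have "\<bar>\<mu> t\<bar> \<le> 1"
        using \<mu>0[OF t] \<mu>1[OF t] by simp
      ultimately show "\<bar>\<mu> t * real_of_int (v t j)\<bar> \<le> real_of_int \<Delta>"
        unfolding abs_mult using mult_mono[of "\<bar>\<mu> t\<bar>" 1 "\<bar>real_of_int (v t j)\<bar>" "real_of_int \<Delta>"] by simp
    qed
    then have le: "\<bar>real_of_int (d j - r j)\<bar> \<le> real (card T) * real_of_int \<Delta>" by simp
    have "0 \<le> \<Delta>"
      by (rule minors_le_nonneg[OF bnd])
    then have "real (card T) * real_of_int \<Delta> \<le> real (Suc n) * real_of_int \<Delta>"
      using T(2) by (intro mult_right_mono) (simp_all del: of_nat_Suc)
    with le have "real_of_int \<bar>x j - r j\<bar> \<le> real_of_int (int (Suc n) * \<Delta>)"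
      using j by (simp add: d_def)
    then show "\<bar>x j - r j\<bar> \<le> int (Suc n) * \<Delta>"
      unfolding of_int_le_iff .
  qed
qed

section \<open>Structure of the integer quadratic program\<close>

locale iqp =
  fixes m n k :: nat and W :: "int mat" and w q h :: "int vec"
  assumes W: "W \<in> carrier_mat m n" and w: "w \<in> carrier_vec m" and kn: "k \<le> n"
    and q: "q \<in> carrier_vec k" and q_pos: "\<And>i. i < k \<Longrightarrow> 0 < q $ i" and h: "h \<in> carrier_vec n"
begin

abbreviation "S \<equiv> iqp_feasible W w"
abbreviation "f \<equiv> iqp_objective q h"

abbreviation A :: "nat \<Rightarrow> nat \<Rightarrow> int" where "A \<equiv> \<lambda>i j. W $$ (i, j)"

lemma mult_le_w_iff:
  assumes "x \<in> carrier_vec n"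
  shows "W *\<^sub>v x \<le> w \<longleftrightarrow> (\<forall>i<m. (\<Sum>j<n. A i j * x $ j) \<le> w $ i)"
proof -
  have "(W *\<^sub>v x) $ i = (\<Sum>j<n. A i j * x $ j)" if "i < m" for i
    using assms W that by (simp add: scalar_prod_def lessThan_atLeast0)
  moreover have "dim_vec (W *\<^sub>v x) = m" "dim_vec w = m"
    using W w by auto
  ultimately show ?thesis
    unfolding less_eq_vec_def by auto
qed

lemma S_iff: "x \<in> S \<longleftrightarrow> x \<in> carrier_vec n \<and> (\<forall>i<m. (\<Sum>j<n. A i j * x $ j) \<le> w $ i)"
proof -
  have "dim_col W = n" using W by simp
  then show ?thesis
    unfolding iqp_feasible_def using mult_le_w_iff by auto
qed

lemma vec_in_S_iff: "vec n x \<in> S \<longleftrightarrow> (\<forall>i<m. (\<Sum>j<n. A i j * x j) \<le> w $ i)"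
  by (simp add: S_iff)

lemma f_eq:
  assumes "x \<in> carrier_vec n"
  shows "f x = (\<Sum>i<k. - (q $ i) * (x $ i)\<^sup>2) + (\<Sum>j<n. h $ j * x $ j)"
  using assms q by (simp add: iqp_objective_def scalar_prod_def lessThan_atLeast0)

lemma f_vec: "f (vec n x) = (\<Sum>i<k. - (q $ i) * (x i)\<^sup>2) + (\<Sum>j<n. h $ j * x j)"
  using kn by (simp add: f_eq)

section \<open>Recession rays and the size of extremal coordinates\<close>

lemma ray_in_S:
  assumes x: "vec n x \<in> S" and r: "\<And>i. i < m \<Longrightarrow> (\<Sum>j<n. A i j * r j) \<le> 0" and c: "0 \<le> c"
  shows "vec n (\<lambda>j. x j + c * r j) \<in> S"
  unfolding vec_in_S_iff
proof (intro allI impI)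
  fix i assume i: "i < m"
  have "(\<Sum>j<n. A i j * (x j + c * r j)) = (\<Sum>j<n. A i j * x j) + c * (\<Sum>j<n. A i j * r j)"
    by (simp add: algebra_simps sum.distrib sum_distrib_left)
  also have "\<dots> \<le> w $ i + 0"
    using x r[OF i] c i by (intro add_mono) (auto simp: vec_in_S_iff mult_nonneg_nonpos)
  finally show "(\<Sum>j<n. A i j * (x j + c * r j)) \<le> w $ i" by simp
qed

lemma f_unbounded_along_ray:
  assumes x: "vec n x \<in> S" and r: "\<And>i. i < m \<Longrightarrow> (\<Sum>j<n. A i j * r j) \<le> 0"
    and i: "i < k" "r i \<noteq> 0"
  shows "\<not> bdd_below (f ` S)"
proof
  assume "bdd_below (f ` S)"
  then obtain B where B: "\<And>y. y \<in> S \<Longrightarrow> B \<le> f y"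
    unfolding bdd_below_def by auto
  define Q where "Q = (\<Sum>i<k. q $ i * (r i)\<^sup>2)"
  define L where "L = (\<Sum>i<k. - 2 * q $ i * x i * r i) + (\<Sum>j<n. h $ j * r j)"
  have f: "f (vec n (\<lambda>j. x j + c * r j)) = f (vec n x) + c * L - c\<^sup>2 * Q" for c
    unfolding f_vec L_def Q_def
    by (simp add: power2_eq_square algebra_simps sum.distrib sum_subtractf sum_distrib_left sum_negf)
  have "1 \<le> q $ i * (r i)\<^sup>2"
    using q_pos[OF i(1)] i(2) by (simp add: int_one_le_iff_zero_less)
  also have "\<dots> \<le> Q"
    unfolding Q_def using q_pos i by (intro member_le_sum) (auto simp: less_imp_le)
  finally have Q: "1 \<le> Q" .
  \<comment> \<open>As \<open>1 \<le> Q\<close>, the change along the ray is at most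
    \<open>- (c * (c - \<bar>L\<bar>))\<close>. With this \<open>c\<close> the first factor is at
    least 1 and the second large enough to get below \<open>B\<close>.\<close>
  define c where "c = \<bar>L\<bar> + \<bar>f (vec n x)\<bar> + \<bar>B\<bar> + 1"
  have "c * L - c\<^sup>2 * Q \<le> c * \<bar>L\<bar> - c\<^sup>2 * 1"
    using Q by (intro diff_mono mult_left_mono) (auto simp: c_def)
  also have "\<dots> = - (c * (c - \<bar>L\<bar>))"
    by (simp add: power2_eq_square algebra_simps)
  also have "\<dots> \<le> - (1 * (\<bar>f (vec n x)\<bar> + \<bar>B\<bar> + 1))"
    unfolding neg_le_iff_le by (intro mult_mono) (auto simp: c_def)
  finally have le: "c * L - c\<^sup>2 * Q \<le> - (1 * (\<bar>f (vec n x)\<bar> + \<bar>B\<bar> + 1))" .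
  have "f (vec n (\<lambda>j. x j + c * r j)) = f (vec n x) + (c * L - c\<^sup>2 * Q)"
    unfolding f by simp
  also have "\<dots> \<le> f (vec n x) - (\<bar>f (vec n x)\<bar> + \<bar>B\<bar> + 1)"
    using add_left_mono[OF le, of "f (vec n x)"] by simp
  also have "\<dots> < B"
    by linarith
  finally have "f (vec n (\<lambda>j. x j + c * r j)) < B" .
  moreover have "B \<le> f (vec n (\<lambda>j. x j + c * r j))"
    by (rule B, rule ray_in_S) (use x r in \<open>auto simp: c_def\<close>)
  ultimately show False by linarith
qed

text \<open>At most \<open>Suc n\<close> terms in the decomposition of a homogenized point, each
  with entries within the Leibniz bound for \<open>Suc n\<close> columns.\<close>

definition M :: "int \<Rightarrow> int" where
  "M c = int (Suc n) * (int (Suc n) * c) ^ Suc n"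

definition entries_le :: "int \<Rightarrow> bool" where
  "entries_le c \<longleftrightarrow> 1 \<le> c \<and> (\<forall>i<m. \<forall>j<n. \<bar>A i j\<bar> \<le> c) \<and> (\<forall>i<m. \<bar>w $ i\<bar> \<le> c)"

lemma ex_entries_le: "\<exists>c. entries_le c"
proof -
  define c where "c = 1 + (\<Sum>i<m. \<Sum>j<n. \<bar>A i j\<bar>) + (\<Sum>i<m. \<bar>w $ i\<bar>)"
  have "\<bar>A i j\<bar> \<le> (\<Sum>i<m. \<Sum>j<n. \<bar>A i j\<bar>)" if "i < m" "j < n" for i j
  proof -
    have "\<bar>A i j\<bar> \<le> (\<Sum>j<n. \<bar>A i j\<bar>)"
      using that by (intro member_le_sum[of _ _ "\<lambda>j. \<bar>A i j\<bar>"]) auto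
    also have "\<dots> \<le> (\<Sum>i<m. \<Sum>j<n. \<bar>A i j\<bar>)"
      using that by (intro member_le_sum[of _ _ "\<lambda>i. \<Sum>j<n. \<bar>A i j\<bar>"]) (auto intro: sum_nonneg)
    finally show ?thesis .
  qed
  moreover have "\<bar>w $ i\<bar> \<le> (\<Sum>i<m. \<bar>w $ i\<bar>)" if "i < m" for i
    using that by (intro member_le_sum[of _ _ "\<lambda>i. \<bar>w $ i\<bar>"]) auto
  moreover have "0 \<le> (\<Sum>i<m. \<Sum>j<n. \<bar>A i j\<bar>)" "0 \<le> (\<Sum>i<m. \<bar>w $ i\<bar>)"
    by (auto intro!: sum_nonneg)
  ultimately have "entries_le c"
    unfolding entries_le_def c_def by fastforce
  then show ?thesis ..
qed

lemma S_decompose: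
  assumes c: "entries_le c" and x: "x \<in> S"
  obtains r where "\<And>i. i < m \<Longrightarrow> (\<Sum>j<n. A i j * r j) \<le> 0" "vec n (\<lambda>j. x $ j - r j) \<in> S"
    "\<And>j. j < n \<Longrightarrow> \<bar>x $ j - r j\<bar> \<le> M c"
proof -
  have "minors_le ((int (Suc n) * c) ^ Suc n) m (Suc n) (\<lambda>i j. if j < n then A i j else - w $ i)"
    by (rule minors_le_Leibniz) (use c in \<open>auto simp: entries_le_def\<close>)
  then obtain r where "\<And>i. i < m \<Longrightarrow> (\<Sum>j<n. A i j * r j) \<le> 0"
    "\<And>i. i < m \<Longrightarrow> (\<Sum>j<n. A i j * (x $ j - r j)) \<le> w $ i"
    "\<And>j. j < n \<Longrightarrow> \<bar>x $ j - r j\<bar> \<le> int (Suc n) * (int (Suc n) * c) ^ Suc n"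
    by (rule bounded_solution_plus_ray[where x = "\<lambda>j. x $ j" and w = "\<lambda>i. w $ i"])
      (use x in \<open>auto simp: S_iff\<close>)
  then show ?thesis
    using that[of r] by (simp add: vec_in_S_iff M_def)
qed

lemma vec_S_eta: "x \<in> S \<Longrightarrow> vec n (\<lambda>j. x $ j) = x"
  by (rule eq_vecI) (auto simp: S_iff)

text \<open>A point whose coordinate exceeds \<open>M c\<close> has a ray part that is nonzero in
  this coordinate, and along that ray the concave quadratic part outweighs the linear one.\<close>

lemma coordinate_unbounded:
  assumes i: "i < k" and unb: "\<And>B. \<exists>x\<in>S. B < \<bar>x $ i\<bar>"
  shows "S \<noteq> {} \<and> \<not> bdd_below (f ` S)"
proof -
  obtain c where c: "entries_le c" using ex_entries_le by blast
  obtain x where x: "x \<in> S" "M c < \<bar>x $ i\<bar>" using unb by blast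
  obtain r where r: "\<And>i. i < m \<Longrightarrow> (\<Sum>j<n. A i j * r j) \<le> 0" "vec n (\<lambda>j. x $ j - r j) \<in> S"
    "\<And>j. j < n \<Longrightarrow> \<bar>x $ j - r j\<bar> \<le> M c"
    by (rule S_decompose[OF c x(1)]) blast
  have "r i \<noteq> 0"
    using r(3)[of i] x(2) i kn by auto
  then have "\<not> bdd_below (f ` S)"
    by (rule f_unbounded_along_ray[where r = r, rotated 3]) (use r(1,2) i in auto)
  with x(1) show ?thesis
    by auto
qed

text \<open>If \<open>r\<close> is the ray part of \<open>x\<close>, then \<open>x - r\<close> and
  \<open>x + r\<close> are both feasible, so extremality forces \<open>r i = 0\<close>. The sign
  \<open>s\<close> treats minima and maxima together.\<close>

lemma extremal_coordinate_le:
  assumes c: "entries_le c" and x: "x \<in> S" and i: "i < n" and s: "s = 1 \<or> s = - 1"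
    and min: "\<And>y. y \<in> S \<Longrightarrow> s * x $ i \<le> s * y $ i"
  shows "\<bar>x $ i\<bar> \<le> M c"
proof -
  obtain r where r: "\<And>i. i < m \<Longrightarrow> (\<Sum>j<n. A i j * r j) \<le> 0" "vec n (\<lambda>j. x $ j - r j) \<in> S"
    "\<And>j. j < n \<Longrightarrow> \<bar>x $ j - r j\<bar> \<le> M c"
    by (rule S_decompose[OF c x]) blast
  have "s * x $ i \<le> s * (x $ i - r i)"
    using min[OF r(2)] i by simp
  moreover have "s * x $ i \<le> s * (x $ i + 1 * r i)"
    using min[OF ray_in_S[OF _ r(1), of "\<lambda>j. x $ j" 1]] x i by (simp add: vec_S_eta)
  ultimately have "r i = 0"
    using s by auto
  then show ?thesis using r(3)[OF i] by simp
qed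

text \<open>The new points have the same sum as \<open>xl\<close> and \<open>xu\<close>, so the
  linear terms cancel and twice the gain is a sum of terms \<open>q (d^2 - (d - 2 y)^2)\<close>.
  Compatibility makes each of them nonnegative, so all but one may be dropped; in that one,
  \<open>d - 2 y\<close> is controlled by the rounding.\<close>

lemma objective_spread:
  assumes bnd: "minors_le \<Delta> m n A" and S: "xl \<in> S" "xu \<in> S" and i: "i < k"
  obtains y z where "y \<in> S" "z \<in> S"
    "q $ i * ((xu $ i - xl $ i)\<^sup>2 - (2 * int n * \<Delta>)\<^sup>2) \<le> 2 * (f y + f z - f xl - f xu)"
proof -
  define d where "d j = xu $ j - xl $ j" for j
  obtain y where y: "\<And>i. i < m \<Longrightarrow> min 0 (\<Sum>j<n. A i j * d j) \<le> (\<Sum>j<n. A i j * y j)"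
    "\<And>i. i < m \<Longrightarrow> (\<Sum>j<n. A i j * y j) \<le> max 0 (\<Sum>j<n. A i j * d j)"
    "\<And>j. j < n \<Longrightarrow> \<bar>d j - 2 * y j\<bar> \<le> \<bar>d j\<bar>"
    "\<And>j. j < n \<Longrightarrow> \<bar>d j - 2 * y j\<bar> \<le> 2 * int n * \<Delta>"
    by (rule conformal_halving[OF bnd, of d]) blast
  let ?y = "vec n (\<lambda>j. xl $ j + y j)" and ?z = "vec n (\<lambda>j. xu $ j - y j)"
  have d: "(\<Sum>j<n. A i j * d j) = (\<Sum>j<n. A i j * xu $ j) - (\<Sum>j<n. A i j * xl $ j)" for i
    by (simp add: d_def right_diff_distrib sum_subtractf)
  have bounds: "(\<Sum>j<n. A i j * xl $ j) \<le> w $ i" "(\<Sum>j<n. A i j * xu $ j) \<le> w $ i" if "i < m" for i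
    using S that by (auto simp: S_iff)
  have "?y \<in> S" "?z \<in> S"
    unfolding vec_in_S_iff right_diff_distrib distrib_left sum.distrib sum_subtractf
    using y(1,2) bounds unfolding d by (fastforce simp: min_def max_def split: if_splits)+
  moreover have "q $ i * ((xu $ i - xl $ i)\<^sup>2 - (2 * int n * \<Delta>)\<^sup>2) \<le> 2 * (f ?y + f ?z - f xl - f xu)"
  proof -
    have "2 * (f ?y + f ?z - f xl - f xu) = 2 * (f ?y + f ?z - f (vec n (\<lambda>j. xl $ j)) - f (vec n (\<lambda>j. xu $ j)))"
      using S by (simp add: vec_S_eta)
    also have "\<dots> = (\<Sum>i<k. q $ i * ((d i)\<^sup>2 - (d i - 2 * y i)\<^sup>2))"
      unfolding f_vec
      by (simp add: d_def power2_eq_square algebra_simps sum.distrib sum_subtractf sum_distrib_left sum_negf)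
    finally have eq: "2 * (f ?y + f ?z - f xl - f xu) = (\<Sum>i<k. q $ i * ((d i)\<^sup>2 - (d i - 2 * y i)\<^sup>2))" .
    have "q $ i * ((d i)\<^sup>2 - (2 * int n * \<Delta>)\<^sup>2) \<le> q $ i * ((d i)\<^sup>2 - (d i - 2 * y i)\<^sup>2)"
    proof (intro mult_left_mono diff_mono order_refl)
      show "(d i - 2 * y i)\<^sup>2 \<le> (2 * int n * \<Delta>)\<^sup>2"
        unfolding abs_le_square_iff[symmetric] using y(4)[of i] i kn by linarith
    qed (use q_pos[OF i] in simp)
    also have "\<dots> \<le> (\<Sum>i<k. q $ i * ((d i)\<^sup>2 - (d i - 2 * y i)\<^sup>2))"
    proof (rule member_le_sum)
      fix j assume "j \<in> {..<k} - {i}"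
      then have "0 \<le> q $ j" "(d j - 2 * y j)\<^sup>2 \<le> (d j)\<^sup>2"
        using q_pos[of j] y(3)[of j] kn by (auto simp: abs_le_square_iff)
      then show "0 \<le> q $ j * ((d j)\<^sup>2 - (d j - 2 * y j)\<^sup>2)" by simp
    qed (use i in auto)
    finally show ?thesis unfolding eq d_def .
  qed
  ultimately show ?thesis by (rule that)
qed

text \<open>For a zero matrix every direction is a ray, so a coordinate that is bounded above forces
  a nonzero entry, which is a subdeterminant of order 1. This provides the hypothesis of
  \<open>minors_le_max_subdet\<close>.\<close>

lemma max_subdet_ge_1_if_bounded:
  assumes i: "i < n" and x: "x \<in> S" and bdd: "\<And>y. y \<in> S \<Longrightarrow> y $ i \<le> B"
  shows "1 \<le> max_subdet W"
proof (rule ccontr)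
  assume "\<not> 1 \<le> max_subdet W"
  then have 0: "max_subdet W = 0" using max_subdet_nonneg[of W] by simp
  have "A a b = 0" if "a < m" "b < n" for a b
  proof -
    have "minor A 1 (\<lambda>_. a) (\<lambda>_. b) = A a b"
      unfolding minor_def by (subst det_single) auto
    then show ?thesis
      using abs_minor_le_max_subdet[of 1 "\<lambda>_. a" W "\<lambda>_. b"] that W 0 by simp
  qed
  then have "vec n (\<lambda>j. x $ j + (\<bar>B\<bar> + \<bar>x $ i\<bar> + 1) * (if j = i then 1 else 0)) \<in> S"
    by (intro ray_in_S) (use x in \<open>auto simp: vec_S_eta\<close>)
  from bdd[OF this] show False using i by simp
qed

end

section \<open>The grid of boxes\<close>

lemma exists_digits:
  fixes t :: "nat \<Rightarrow> nat"
  assumes "\<And>i. i < k \<Longrightarrow> t i < g"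
  shows "\<exists>c<g ^ k. \<forall>i<k. c div g ^ (k - 1 - i) mod g = t i"
  using assms
proof (induction k)
  case (Suc k)
  then obtain c where c: "c < g ^ k" "\<And>i. i < k \<Longrightarrow> c div g ^ (k - 1 - i) mod g = t i"
    by force
  have tk: "t k < g" using Suc.prems by simp
  \<comment> \<open>The new coordinate becomes the least significant digit; all earlier digits move
    up by one place.\<close>
  have "c * g + t k < g ^ Suc k"
  proof -
    have "Suc c * g \<le> g ^ k * g"
      using c(1) by (intro mult_right_mono) auto
    then show ?thesis using tk by (simp add: mult.commute)
  qed
  moreover have "(c * g + t k) div g ^ (k - i) mod g = t i" if "i < Suc k" for i
  proof (cases "i = k")
    case False
    then have "k - i = Suc (k - 1 - i)" using that by simp
    then have "(c * g + t k) div g ^ (k - i) = (c * g + t k) div g div g ^ (k - 1 - i)"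
      by (metis div_mult2_eq power_Suc)
    also have "(c * g + t k) div g = c"
      using tk by simp
    finally show ?thesis using c(2) False that by simp
  qed (use tk in simp)
  ultimately show ?case by (intro exI[of _ "c * g + t k"]) auto
qed auto

lemma int_bdd_below_attains_min:
  fixes f :: "'a \<Rightarrow> int"
  assumes "x \<in> S" and bdd: "\<And>y. y \<in> S \<Longrightarrow> B \<le> f y"
  shows "\<exists>x\<in>S. \<forall>y\<in>S. f x \<le> f y"
proof -
  obtain x' where x': "x' \<in> S" "\<And>y. y \<in> S \<Longrightarrow> nat (f x' - B) \<le> nat (f y - B)"
    using ex_has_least_nat[of "\<lambda>y. y \<in> S" x "\<lambda>y. nat (f y - B)"] assms(1) by blast
  have "f x' \<le> f y" if "y \<in> S" for y
    using x'(2)[OF that] bdd[OF that] bdd[OF x'(1)] by linarith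
  with x'(1) show ?thesis by blast
qed

lemma exists_maximal_index:
  fixes \<phi> :: "nat \<Rightarrow> 'a :: linorder"
  assumes "0 < k"
  obtains j where "j < k" "\<And>i. i < k \<Longrightarrow> \<phi> i \<le> \<phi> j"
proof -
  have "Max (\<phi> ` {..<k}) \<in> \<phi> ` {..<k}"
    using assms by (intro Max_in) auto
  then obtain j where "j < k" "Max (\<phi> ` {..<k}) = \<phi> j" by blast
  then show ?thesis
    using that[of j] by (metis Max_ge finite_imageI finite_lessThan imageI lessThan_iff)
qed

lemma le_average_imp: "4 * a \<le> 2 * (b + c - d - d) \<Longrightarrow> a \<le> b - d \<or> a \<le> c - d" for a b c d :: int
  by presburger

locale iqp_alg = iqp +
  fixes orc :: "ilp \<Rightarrow> outcome" and E :: int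
  assumes solver: "ilp_solver orc" and E: "1 \<le> E"
begin

definition coord_ilp :: "bool \<Rightarrow> nat \<Rightarrow> ilp" where
  "coord_ilp b i = \<lparr>ilp_max = b, ilp_obj = unit_vec n i, ilp_mat = W, ilp_rhs = w,
     ilp_lower = replicate n None, ilp_upper = replicate n None\<rparr>"

definition coord_val :: "bool \<Rightarrow> nat \<Rightarrow> int" where
  "coord_val b i = (case orc (coord_ilp b i) of Solution x \<Rightarrow> x $ i | _ \<Rightarrow> 0)"

abbreviation "l \<equiv> coord_val False"
abbreviation "u \<equiv> coord_val True"

definition failed :: bool where
  "failed \<longleftrightarrow> (\<exists>i<k. \<exists>b. \<not> (\<exists>x. orc (coord_ilp b i) = Solution x))"

text \<open>For \<open>k = 0\<close> this is 0, so that \<open>g = 0\<close> and there is the single box \<open>c = 0 < 0\<^sup>0\<close>.\<close>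

definition X :: int where
  "X = int k * ((2 * int n * max_subdet W)\<^sup>2 + E)"

definition g :: nat where
  "g = (LEAST g. X \<le> (int g)\<^sup>2)"

text \<open>A part holds \<open>wd i + 1\<close> integers. If \<open>g\<close> is positive,
  \<open>g * (wd i + 1)\<close> exceeds \<open>u i - l i\<close>, so \<open>g\<close> disjoint parts
  cover the interval; the last ones may reach beyond \<open>u i\<close>.\<close>

definition wd :: "nat \<Rightarrow> int" where
  "wd i = (u i - l i) div int g"

text \<open>The base-\<open>g\<close> digits of the number of a box give its position; coordinate 0 has the most
  significant digit, so the program, which finds the least significant digit first, lists the
  coordinates in reverse.\<close>

definition box_lo :: "nat \<Rightarrow> nat \<Rightarrow> int" where
  "box_lo c i = l i + int (c div g ^ (k - 1 - i) mod g) * (wd i + 1)"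

definition box_hi :: "nat \<Rightarrow> nat \<Rightarrow> int" where
  "box_hi c i = box_lo c i + wd i"

text \<open>\<open>- q * (lo + hi)\<close> is the slope of the chord of \<open>- q * x^2\<close>
  over the interval from \<open>lo\<close> to \<open>hi\<close>; the constant of the chord is left
  out.\<close>

definition box_obj :: "nat \<Rightarrow> int vec" where
  "box_obj c = vec n (\<lambda>i. if i < k then h $ i - q $ i * (box_lo c i + box_hi c i) else h $ i)"

definition box_bounds :: "(nat \<Rightarrow> int) \<Rightarrow> int option list" where
  "box_bounds a = map (\<lambda>i. if i < k then Some (a i) else None) [0..<n]"

definition box_ilp :: "nat \<Rightarrow> ilp" where
  "box_ilp c = \<lparr>ilp_max = False, ilp_obj = box_obj c, ilp_mat = W, ilp_rhs = w,
     ilp_lower = box_bounds (box_lo c), ilp_upper = box_bounds (box_hi c)\<rparr>"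

text \<open>\<open>Infeasible\<close> is neutral and \<open>Unbounded\<close> absorbing; a tie keeps
  the earlier solution.\<close>

fun better :: "outcome \<Rightarrow> outcome \<Rightarrow> outcome" where
  "better b Infeasible = b"
| "better b Unbounded = Unbounded"
| "better Infeasible (Solution x) = Solution x"
| "better Unbounded (Solution x) = Unbounded"
| "better (Solution y) (Solution x) = (if f x < f y then Solution x else Solution y)"

text \<open>The program counts the boxes downwards, so this is its result when the boxes from
  \<open>j\<close> on are done.\<close>

definition best :: "nat \<Rightarrow> outcome" where
  "best j = foldl better Infeasible (map (\<lambda>c. orc (box_ilp c)) (rev [j..<g ^ k]))"

lemma best_Suc: "j < g ^ k \<Longrightarrow> best j = better (best (Suc j)) (orc (box_ilp j))"
  by (simp add: best_def upt_conv_Cons)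

lemma foldl_better:
  "foldl better Infeasible rs = Infeasible \<longleftrightarrow> (\<forall>r\<in>set rs. r = Infeasible)"
  "foldl better Infeasible rs = Unbounded \<longleftrightarrow> Unbounded \<in> set rs"
  "foldl better Infeasible rs = Solution x \<Longrightarrow> Solution x \<in> set rs \<and> (\<forall>y. Solution y \<in> set rs \<longrightarrow> f x \<le> f y)"
proof (induction rs arbitrary: x rule: rev_induct)
  case (snoc r rs)
  {
    case 1
    show ?case using snoc
      by (cases "(foldl better Infeasible rs, r)" rule: better.cases) auto
  next
    case 2
    show ?case using snoc
      by (cases "(foldl better Infeasible rs, r)" rule: better.cases) auto
  next
    case 3
    then show ?case using snoc
      by (cases "(foldl better Infeasible rs, r)" rule: better.cases) (fastforce split: if_splits)+
  }
qed auto

lemma coord_ilp_wf: "i < n \<Longrightarrow> ilp_wf (coord_ilp b i)"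
  using W w by (simp add: ilp_wf_def coord_ilp_def)

lemma box_ilp_wf: "ilp_wf (box_ilp c)"
  using W w by (simp add: ilp_wf_def box_ilp_def box_obj_def box_bounds_def)

lemma coord_ilp_feasible: "ilp_feasible (coord_ilp b i) = S"
  using W by (auto simp: ilp_feasible_def coord_ilp_def iqp_feasible_def)

lemma box_ilp_feasible:
  "ilp_feasible (box_ilp c) = {x \<in> S. \<forall>i<k. box_lo c i \<le> x $ i \<and> x $ i \<le> box_hi c i}"
  using W kn by (auto simp: ilp_feasible_def box_ilp_def iqp_feasible_def box_bounds_def)

lemma coord_outcome:
  assumes "i < k"
  shows "orc (coord_ilp b i) = Infeasible \<Longrightarrow> S = {}"
    and "orc (coord_ilp b i) = Unbounded \<Longrightarrow> S \<noteq> {} \<and> \<not> bdd_below (f ` S)"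
    and "orc (coord_ilp b i) = Solution x \<Longrightarrow> x \<in> S \<and> x $ i = coord_val b i \<and>
      (\<forall>y\<in>S. if b then y $ i \<le> x $ i else x $ i \<le> y $ i)"
proof -
  have i: "i < n" using assms kn by simp
  have out: "ilp_outcome (coord_ilp b i) (orc (coord_ilp b i))"
    using solver coord_ilp_wf[OF i] by (simp add: ilp_solver_def)
  have obj: "ilp_obj (coord_ilp b i) \<bullet> x = x $ i" if "x \<in> S" for x
    using that i by (simp add: coord_ilp_def S_iff)
  have max: "ilp_max (coord_ilp b i) = b"
    by (simp add: coord_ilp_def)
  show "S = {}" if "orc (coord_ilp b i) = Infeasible"
    using out unfolding that ilp_outcome_def coord_ilp_feasible by simp
  show "S \<noteq> {} \<and> \<not> bdd_below (f ` S)" if "orc (coord_ilp b i) = Unbounded"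
  proof -
    have *: "S \<noteq> {}" "if b then \<not> bdd_above ((\<lambda>x. x $ i) ` S) else \<not> bdd_below ((\<lambda>x. x $ i) ` S)"
      using out obj unfolding that ilp_outcome_def coord_ilp_feasible max by (auto cong: image_cong)
    have "\<exists>x\<in>S. B < \<bar>x $ i\<bar>" for B
    proof (rule ccontr)
      assume "\<not> (\<exists>x\<in>S. B < \<bar>x $ i\<bar>)"
      then have "\<And>x. x \<in> S \<Longrightarrow> - B \<le> x $ i \<and> x $ i \<le> B" by force
      then have "bdd_above ((\<lambda>x. x $ i) ` S)" "bdd_below ((\<lambda>x. x $ i) ` S)"
        by (auto intro!: bdd_aboveI2[where M = B] bdd_belowI2[where m = "- B"])
      with *(2) show False by (simp split: if_splits)
    qed
    then show ?thesis
      by (rule coordinate_unbounded[OF assms])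
  qed
  show "x \<in> S \<and> x $ i = coord_val b i \<and> (\<forall>y\<in>S. if b then y $ i \<le> x $ i else x $ i \<le> y $ i)"
    if "orc (coord_ilp b i) = Solution x"
  proof -
    have x: "x \<in> S" and le: "\<And>y. y \<in> S \<Longrightarrow> if b then ilp_obj (coord_ilp b i) \<bullet> y \<le> ilp_obj (coord_ilp b i) \<bullet> x
        else ilp_obj (coord_ilp b i) \<bullet> x \<le> ilp_obj (coord_ilp b i) \<bullet> y"
      using out unfolding that ilp_outcome_def coord_ilp_feasible max outcome.case by blast+
    have "if b then y $ i \<le> x $ i else x $ i \<le> y $ i" if "y \<in> S" for y
      using le[OF that] unfolding obj[OF that] obj[OF x] .
    with x that show ?thesis by (simp add: coord_val_def)
  qed
qed

text \<open>A failing coordinate ILP already answers the quadratic program: both have the same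
  feasible set, and an unbounded coordinate makes the objective unbounded below. The program can
  therefore return this outcome unchanged.\<close>

lemma failed_outcome:
  assumes "i < k" "\<not> (\<exists>x. orc (coord_ilp b i) = Solution x)"
  shows "iqp_outcome \<epsilon> W w q h (orc (coord_ilp b i))"
  using assms coord_outcome(1,2)[OF assms(1), of b]
  by (cases "orc (coord_ilp b i)") (simp_all add: iqp_outcome_def)

lemma not_failed:
  assumes "\<not> failed" "i < k"
  obtains xl xu where "xl \<in> S" "xu \<in> S" "xl $ i = l i" "xu $ i = u i"
    "\<And>y. y \<in> S \<Longrightarrow> l i \<le> y $ i" "\<And>y. y \<in> S \<Longrightarrow> y $ i \<le> u i"
proof -
  obtain xl xu where "orc (coord_ilp False i) = Solution xl" "orc (coord_ilp True i) = Solution xu"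
    using assms unfolding failed_def by blast
  from coord_outcome(3)[OF assms(2) this(1)] coord_outcome(3)[OF assms(2) this(2)]
  show ?thesis
    by (intro that[of xl xu]) auto
qed

lemma coord_val_le:
  assumes "\<not> failed" "i < k" "entries_le c"
  shows "\<bar>coord_val b i\<bar> \<le> M c"
proof -
  obtain xl xu where x: "xl \<in> S" "xu \<in> S" "xl $ i = l i" "xu $ i = u i"
    "\<And>y. y \<in> S \<Longrightarrow> l i \<le> y $ i" "\<And>y. y \<in> S \<Longrightarrow> y $ i \<le> u i"
    by (rule not_failed[OF assms(1,2)]) blast
  have "\<bar>xl $ i\<bar> \<le> M c"
    by (rule extremal_coordinate_le[where s = 1, OF assms(3)]) (use x assms(2) kn in auto)
  moreover have "\<bar>xu $ i\<bar> \<le> M c"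
    by (rule extremal_coordinate_le[where s = "- 1", OF assms(3)]) (use x assms(2) kn in auto)
  ultimately show ?thesis
    using x(3,4) by (cases b) auto
qed

lemma max_subdet_ge_1:
  assumes "\<not> failed" "0 < k"
  shows "1 \<le> max_subdet W"
proof -
  obtain xl xu where "xl \<in> S" "\<And>y. y \<in> S \<Longrightarrow> y $ 0 \<le> u 0"
    by (rule not_failed[OF assms]) blast
  then show ?thesis
    by (intro max_subdet_ge_1_if_bounded[of 0 xl "u 0"]) (use assms(2) kn in auto)
qed

lemma X_nonneg: "0 \<le> X"
  using E by (simp add: X_def)

lemma g_le: "X \<le> (int a)\<^sup>2 \<Longrightarrow> g \<le> a"
  unfolding g_def by (rule Least_le)

text \<open>Shows that the \<open>LEAST\<close> in \<open>g\<close> ranges over a nonempty set, and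
  yields \<open>g \<le> X\<close> for the size estimates.\<close>

lemma X_le_self: "X \<le> (int (nat X))\<^sup>2"
  using X_nonneg by (simp add: power2_eq_square) (metis mult_left_mono mult.right_neutral
    int_one_le_iff_zero_less linorder_not_le mult_eq_0_iff order_antisym_conv)

lemma X_le_g: "X \<le> (int g)\<^sup>2"
  unfolding g_def by (rule LeastI[of _ "nat X"]) (rule X_le_self)

lemma g_pos: "0 < k \<Longrightarrow> 0 < g"
proof (rule ccontr)
  assume k: "0 < k" and "\<not> 0 < g"
  then have "X \<le> 0" using X_le_g by simp
  moreover have "1 * 1 \<le> int k * ((2 * int n * max_subdet W)\<^sup>2 + E)"
    using k E by (intro mult_mono) (auto intro: add_increasing)
  ultimately show False by (simp add: X_def)
qed

lemma wd_nonneg: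
  assumes "\<not> failed" "i < k"
  shows "0 \<le> wd i"
proof -
  obtain xl xu where "xl \<in> S" "xl $ i = l i" "\<And>y. y \<in> S \<Longrightarrow> y $ i \<le> u i"
    by (rule not_failed[OF assms]) blast
  then have "l i \<le> u i" by fastforce
  then show ?thesis
    by (simp add: wd_def div_int_pos_iff)
qed

lemma box_cover:
  assumes nf: "\<not> failed" and x: "x \<in> S"
  obtains c where "c < g ^ k" "x \<in> ilp_feasible (box_ilp c)"
proof -
  define t where "t i = nat ((x $ i - l i) div (wd i + 1))" for i
  have t: "t i < g" "l i + int (t i) * (wd i + 1) \<le> x $ i" "x $ i \<le> l i + int (t i) * (wd i + 1) + wd i"
    if i: "i < k" for i
  proof -
    obtain xl xu where b: "\<And>y. y \<in> S \<Longrightarrow> l i \<le> y $ i" "\<And>y. y \<in> S \<Longrightarrow> y $ i \<le> u i"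
      by (rule not_failed[OF nf i]) blast
    have gp: "0 < int g" using g_pos i by simp
    let ?e = "x $ i - l i" and ?p = "wd i + 1"
    have p: "0 < ?p" using wd_nonneg[OF nf i] by simp
    have e: "0 \<le> ?e" using b(1)[OF x] by simp
    have "0 \<le> ?e div ?p" using e p by (simp add: pos_imp_zdiv_nonneg_iff)
    then have t: "int (t i) = ?e div ?p" by (simp add: t_def)
    have "u i - l i < int g * ?p"
      using gp mult_div_mod_eq[of "int g" "u i - l i"] pos_mod_bound[OF gp, of "u i - l i"]
      unfolding wd_def[symmetric] distrib_left by linarith
    then have lt: "?e < int g * ?p"
      using b(2)[OF x] by linarith
    have "?e div ?p < int g"
    proof (rule ccontr)
      assume "\<not> ?e div ?p < int g"
      then have "int g * ?p \<le> ?e div ?p * ?p"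
        using p by (intro mult_right_mono) auto
      also have "\<dots> \<le> ?e"
        using pos_mod_sign[OF p, of ?e] div_mult_mod_eq[of ?e ?p] by linarith
      finally show False using lt by simp
    qed
    then show "t i < g" using t by linarith
    have "?e = int (t i) * ?p + ?e mod ?p"
      unfolding t by (rule div_mult_mod_eq[symmetric])
    then show "l i + int (t i) * ?p \<le> x $ i" "x $ i \<le> l i + int (t i) * ?p + wd i"
      using pos_mod_sign[OF p, of ?e] pos_mod_bound[OF p, of ?e] by linarith+
  qed
  obtain c where c: "c < g ^ k" "\<And>i. i < k \<Longrightarrow> c div g ^ (k - 1 - i) mod g = t i"
    using exists_digits[of k t g] t(1) by blast
  have "x \<in> ilp_feasible (box_ilp c)"
    unfolding box_ilp_feasible box_hi_def box_lo_def using c(2) t x by auto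
  with c(1) show ?thesis by (rule that)
qed

text \<open>Four times the bound on the secant error: the product of the distances to both ends of
  an interval is at most a quarter of its squared width. The factor 4 keeps everything
  integral.\<close>

definition gap :: int where
  "gap = (\<Sum>i<k. q $ i * (wd i)\<^sup>2)"

text \<open>On its box, the objective of the ILP is, up to a constant, the secant underestimator of \<open>f\<close>.\<close>

lemma box_objective:
  obtains K where
    "\<And>z. z \<in> ilp_feasible (box_ilp c) \<Longrightarrow> box_obj c \<bullet> z + K \<le> f z"
    "\<And>z. z \<in> ilp_feasible (box_ilp c) \<Longrightarrow> 4 * f z \<le> 4 * (box_obj c \<bullet> z + K) + gap"
proof -
  define K where "K = (\<Sum>i<k. q $ i * (box_lo c i * box_hi c i))"
  define R where "R z = (\<Sum>i<k. q $ i * ((z $ i - box_lo c i) * (box_hi c i - z $ i)))" for z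
  have f: "f z = box_obj c \<bullet> z + K + R z" if "z \<in> ilp_feasible (box_ilp c)" for z
  proof -
    have z: "z \<in> carrier_vec n"
      using that by (simp add: box_ilp_feasible S_iff)
    have "box_obj c \<bullet> z = (\<Sum>j<n. (if j < k then h $ j - q $ j * (box_lo c j + box_hi c j) else h $ j) * z $ j)"
      using z by (simp add: scalar_prod_def box_obj_def lessThan_atLeast0)
    also have "\<dots> = (\<Sum>j<n. h $ j * z $ j - (if j < k then q $ j * (box_lo c j + box_hi c j) * z $ j else 0))"
      by (rule sum.cong) (auto simp: algebra_simps)
    also have "\<dots> = (\<Sum>j<n. h $ j * z $ j) - (\<Sum>j<n. if j < k then q $ j * (box_lo c j + box_hi c j) * z $ j else 0)"
      by (rule sum_subtractf)
    also have "(\<Sum>j<n. if j < k then q $ j * (box_lo c j + box_hi c j) * z $ j else 0) =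
        (\<Sum>j<k. q $ j * (box_lo c j + box_hi c j) * z $ j)"
      by (rule sum.mono_neutral_cong_right) (use kn in auto)
    finally show ?thesis
      unfolding f_eq[OF z] K_def R_def
      by (simp add: power2_eq_square algebra_simps sum.distrib sum_subtractf sum_negf)
  qed
  have R: "0 \<le> R z" "4 * R z \<le> gap" if "z \<in> ilp_feasible (box_ilp c)" for z
  proof -
    have z: "box_lo c i \<le> z $ i" "z $ i \<le> box_hi c i" if "i < k" for i
      using \<open>z \<in> ilp_feasible (box_ilp c)\<close> that by (auto simp: box_ilp_feasible)
    show "0 \<le> R z"
      unfolding R_def by (intro sum_nonneg mult_nonneg_nonneg) (use z q_pos in \<open>auto simp: less_imp_le\<close>)
    have "4 * ((z $ i - box_lo c i) * (box_hi c i - z $ i)) \<le> (wd i)\<^sup>2" if "i < k" for i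
    proof -
      have "(wd i)\<^sup>2 - 4 * ((z $ i - box_lo c i) * (box_hi c i - z $ i)) =
          ((z $ i - box_lo c i) - (box_hi c i - z $ i))\<^sup>2"
        unfolding box_hi_def by (simp add: power2_eq_square algebra_simps)
      then show ?thesis by (metis diff_ge_0_iff_ge zero_le_power2)
    qed
    then show "4 * R z \<le> gap"
      unfolding R_def gap_def sum_distrib_left mult.left_commute[of 4]
      using q_pos by (intro sum_mono mult_left_mono) (auto simp: less_imp_le)
  qed
  show ?thesis
    by (rule that[of K]) (use f R in force)+
qed

text \<open>The coordinate \<open>j\<close> with the largest \<open>q wd^2\<close> carries at least
  the fraction \<open>1 / k\<close> of \<open>gap\<close>, whence the factor \<open>k\<close> in
  \<open>X\<close>. For it, \<open>objective_spread\<close> gives two points that together rise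
  above \<open>xo\<close> by at least \<open>2 E (f x - f xo)\<close>, so one of them rises by half
  of that. If \<open>gap\<close> is not positive, \<open>x\<close> is itself optimal.\<close>

lemma gap_le_spread:
  assumes nf: "\<not> failed" and xo: "xo \<in> S" "\<And>y. y \<in> S \<Longrightarrow> f xo \<le> f y"
    and x: "4 * f x \<le> 4 * f xo + gap"
  shows "\<exists>y\<in>S. E * (f x - f xo) \<le> f y - f xo"
proof (cases "gap \<le> 0")
  case True
  then have "f x - f xo \<le> 0" using x by linarith
  then have "E * (f x - f xo) \<le> 0"
    using E by (intro mult_nonneg_nonpos) auto
  then show ?thesis using xo(1) by (intro bexI[of _ xo]) simp
next
  case False
  have k: "0 < k"
  proof (rule ccontr)
    assume "\<not> 0 < k"
    then have "gap = 0"
      unfolding gap_def by (intro sum.neutral) auto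
    with False show False by simp
  qed
  obtain j where j: "j < k" "\<And>i. i < k \<Longrightarrow> q $ i * (wd i)\<^sup>2 \<le> q $ j * (wd j)\<^sup>2"
    using exists_maximal_index[OF k, of "\<lambda>i. q $ i * (wd i)\<^sup>2"] by blast
  have gap: "gap \<le> int k * (q $ j * (wd j)\<^sup>2)"
    using sum_bounded_above[of "{..<k}" "\<lambda>i. q $ i * (wd i)\<^sup>2" "q $ j * (wd j)\<^sup>2"] j(2)
    by (simp add: gap_def)
  have "wd j \<noteq> 0"
    using gap False by auto
  then have wd: "1 \<le> wd j" using wd_nonneg[OF nf j(1)] by simp
  obtain xl xu where xlu: "xl \<in> S" "xu \<in> S" "xl $ j = l j" "xu $ j = u j"
    by (rule not_failed[OF nf j(1)]) blast
  let ?Y = "2 * int n * max_subdet W" and ?D = "u j - l j"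
  have "minors_le (max_subdet W) m n A"
    using minors_le_max_subdet[OF max_subdet_ge_1[OF nf k]] W by simp
  from objective_spread[OF this xlu(1,2) j(1)] obtain y z where yz: "y \<in> S" "z \<in> S"
    "q $ j * (?D\<^sup>2 - ?Y\<^sup>2) \<le> 2 * (f y + f z - f xl - f xu)"
    unfolding xlu(3,4) by blast
  have "int g * wd j \<le> ?D"
    unfolding wd_def using g_pos[OF k] mult_div_mod_eq[of "int g" ?D] pos_mod_sign[of "int g" ?D] by linarith
  then have "(int g * wd j)\<^sup>2 \<le> ?D\<^sup>2"
    using wd by (intro power_mono) auto
  moreover have "(int k * E) * (wd j)\<^sup>2 \<le> ((int g)\<^sup>2 - ?Y\<^sup>2) * (wd j)\<^sup>2"
  proof (intro mult_right_mono)
    have "1 * ?Y\<^sup>2 \<le> int k * ?Y\<^sup>2"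
      using k by (intro mult_right_mono) auto
    then show "int k * E \<le> (int g)\<^sup>2 - ?Y\<^sup>2"
      using X_le_g unfolding X_def distrib_left by linarith
  qed simp
  \<comment> \<open>A positive integral width is at least 1, so the additive loss
    \<open>?Y\<^sup>2\<close> can be charged against a multiple of
    \<open>(wd j)\<^sup>2\<close>.\<close>
  moreover have "?Y\<^sup>2 * 1 \<le> ?Y\<^sup>2 * (wd j)\<^sup>2"
    using wd by (intro mult_left_mono) auto
  ultimately have "int k * E * (wd j)\<^sup>2 \<le> ?D\<^sup>2 - ?Y\<^sup>2"
    by (simp add: power_mult_distrib left_diff_distrib)
  then have "q $ j * (int k * E * (wd j)\<^sup>2) \<le> q $ j * (?D\<^sup>2 - ?Y\<^sup>2)"
    using q_pos[OF j(1)] by (intro mult_left_mono) auto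
  moreover have "E * (4 * (f x - f xo)) \<le> E * (int k * (q $ j * (wd j)\<^sup>2))"
    using x gap E by (intro mult_left_mono) auto
  ultimately have "4 * (E * (f x - f xo)) \<le> 2 * (f y + f z - f xl - f xu)"
    using yz(3) by (simp add: ac_simps)
  also have "\<dots> \<le> 2 * (f y + f z - f xo - f xo)"
    using xo(2)[OF xlu(1)] xo(2)[OF xlu(2)] by (intro mult_left_mono) simp_all
  finally have "E * (f x - f xo) \<le> f y - f xo \<or> E * (f x - f xo) \<le> f z - f xo"
    by (rule le_average_imp)
  then show ?thesis using yz by blast
qed

lemma best_outcome:
  assumes nf: "\<not> failed" and eps: "0 < \<epsilon>" "1 \<le> \<epsilon> * real_of_int E"
  shows "iqp_outcome \<epsilon> W w q h (best 0)"
proof -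
  let ?rs = "map (\<lambda>c. orc (box_ilp c)) (rev [0..<g ^ k])"
  have out: "ilp_outcome (box_ilp c) (orc (box_ilp c))" for c
    using solver box_ilp_wf by (simp add: ilp_solver_def)
  have box: "\<not> ilp_max (box_ilp c)" "ilp_obj (box_ilp c) = box_obj c" for c
    by (simp_all add: box_ilp_def)
  have S: "x \<in> S" if "x \<in> ilp_feasible (box_ilp c)" for x c
    using that by (simp add: box_ilp_feasible)
  show ?thesis
  proof (cases "best 0")
    case Infeasible
    then have inf: "orc (box_ilp c) = Infeasible" if "c < g ^ k" for c
      using that unfolding best_def foldl_better by auto
    have "S = {}"
    proof (rule ccontr)
      assume "S \<noteq> {}"
      then obtain x where "x \<in> S" by blast
      from box_cover[OF nf this] obtain c where "c < g ^ k" "x \<in> ilp_feasible (box_ilp c)" by blast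
      then show False using out[of c] inf[of c] by (simp add: ilp_outcome_def)
    qed
    then show ?thesis using Infeasible by (simp add: iqp_outcome_def)
  next
    case Unbounded
    then obtain c where c: "c < g ^ k" "orc (box_ilp c) = Unbounded"
      unfolding best_def foldl_better by auto
    let ?F = "ilp_feasible (box_ilp c)"
    have F: "?F \<noteq> {}" "\<not> bdd_below ((\<lambda>x. box_obj c \<bullet> x) ` ?F)"
      using out[of c] c(2) box by (auto simp: ilp_outcome_def)
    have "\<not> bdd_below (f ` S)"
    proof
      assume "bdd_below (f ` S)"
      then obtain B where B: "\<And>y. y \<in> S \<Longrightarrow> B \<le> f y"
        unfolding bdd_below_def by auto
      obtain K where K: "\<And>z. z \<in> ?F \<Longrightarrow> 4 * f z \<le> 4 * (box_obj c \<bullet> z + K) + gap"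
        by (rule box_objective[of c]) blast
      have "B - K - max 0 gap \<le> box_obj c \<bullet> z" if "z \<in> ?F" for z
        using K[OF that] B[OF S[OF that]] by simp
      then have "bdd_below ((\<lambda>x. box_obj c \<bullet> x) ` ?F)"
        by (rule bdd_belowI2)
      with F(2) show False ..
    qed
    then show ?thesis using Unbounded F(1) S by (auto simp: iqp_outcome_def)
  next
    case (Solution x)
    then have x: "Solution x \<in> set ?rs" "\<And>y. Solution y \<in> set ?rs \<Longrightarrow> f x \<le> f y"
      and nu: "Unbounded \<notin> set ?rs"
      using foldl_better(2)[of ?rs] foldl_better(3)[of ?rs x] unfolding best_def by auto
    then obtain c where c: "c < g ^ k" "orc (box_ilp c) = Solution x" by auto
    then have xS: "x \<in> S"
      using out[of c] S by (auto simp: ilp_outcome_def)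
    \<comment> \<open>Let \<open>z\<close> be the solution of a box containing \<open>y\<close>.
      Then \<open>f x \<le> f z\<close>, \<open>f z\<close> is at most \<open>gap / 4\<close> above
      the secant at \<open>z\<close>, the secant at \<open>z\<close> is at most that at
      \<open>y\<close>, and this is at most \<open>f y\<close>.\<close>
    have le: "4 * f x \<le> 4 * f y + gap" if "y \<in> S" for y
    proof -
      from box_cover[OF nf that] obtain c where c: "c < g ^ k" and y: "y \<in> ilp_feasible (box_ilp c)" by blast
      then obtain z where z: "orc (box_ilp c) = Solution z"
        using out[of c] nu by (cases "orc (box_ilp c)") (force simp: ilp_outcome_def)+
      then have "z \<in> ilp_feasible (box_ilp c)" "box_obj c \<bullet> z \<le> box_obj c \<bullet> y"
        using out[of c] y box by (auto simp: ilp_outcome_def)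
      moreover obtain K where "\<And>z. z \<in> ilp_feasible (box_ilp c) \<Longrightarrow> box_obj c \<bullet> z + K \<le> f z"
        "\<And>z. z \<in> ilp_feasible (box_ilp c) \<Longrightarrow> 4 * f z \<le> 4 * (box_obj c \<bullet> z + K) + gap"
        by (rule box_objective[of c]) blast
      ultimately have "4 * f z \<le> 4 * f y + gap"
        using y by (smt (verit))
      moreover have "f x \<le> f z"
        using c z by (intro x(2)) force
      ultimately show ?thesis by linarith
    qed
    \<comment> \<open>A lower bound for an integer-valued objective, so the optimal solution
      required by \<open>eps_approx\<close> exists.\<close>
    have "f x - \<bar>gap\<bar> \<le> f y" if "y \<in> S" for y
      using le[OF that] by linarith
    then obtain xo where xo: "xo \<in> S" "\<And>y. y \<in> S \<Longrightarrow> f xo \<le> f y"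
      using int_bdd_below_attains_min[of x S "f x - \<bar>gap\<bar>" f] xS by blast
    obtain y where y: "y \<in> S" "E * (f x - f xo) \<le> f y - f xo"
      using gap_le_spread[OF nf xo le[OF xo(1)]] by blast
    let ?f = "\<lambda>y. real_of_int (f y)"
    have "?f xo = Sup (?f ` S) \<or> ?f xo < Sup (?f ` S) \<and> (?f x - ?f xo) / (Sup (?f ` S) - ?f xo) \<le> \<epsilon>"
      if bdd: "bdd_above (?f ` S)"
    proof -
      have "?f xo \<le> Sup (?f ` S)"
        using bdd xo(1) by (intro cSup_upper) auto
      moreover have "(?f x - ?f xo) / (Sup (?f ` S) - ?f xo) \<le> \<epsilon>" if "?f xo < Sup (?f ` S)"
      proof -
        have "?f y \<le> Sup (?f ` S)"
          using bdd y(1) by (intro cSup_upper) auto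
        moreover have "real_of_int (E * (f x - f xo)) \<le> real_of_int (f y - f xo)"
          using y(2) by (simp only: of_int_le_iff)
        ultimately have le: "real_of_int E * (?f x - ?f xo) \<le> Sup (?f ` S) - ?f xo"
          using \<open>real_of_int (E * (f x - f xo)) \<le> real_of_int (f y - f xo)\<close> by simp
        have "1 * (?f x - ?f xo) \<le> (\<epsilon> * real_of_int E) * (?f x - ?f xo)"
          using eps xo(2)[OF xS] by (intro mult_right_mono) auto
        also have "\<dots> \<le> \<epsilon> * (Sup (?f ` S) - ?f xo)"
          using mult_left_mono[OF le, of \<epsilon>] eps by (simp add: mult.assoc)
        finally show ?thesis
          using that by (simp add: divide_le_eq)
      qed
      ultimately show ?thesis by (auto simp: order_le_less)
    qed
    then have "eps_approx \<epsilon> S ?f x"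
      unfolding eps_approx_def Let_def using xS xo by (auto intro!: bexI[of _ xo])
    then show ?thesis using Solution by (simp add: iqp_outcome_def)
  qed
qed

end

section \<open>Bounded executions\<close>

text \<open>A syntactic factor rather than a count of nodes: evaluation enlarges the largest value
  of a state at most by this factor, and the cost grows at most by its square.\<close>

fun expr_size :: "expr \<Rightarrow> nat" where
  "expr_size (Var x) = 1"
| "expr_size (Lit i) = 1 + nat (bitlen \<bar>i\<bar>)"
| "expr_size Empty = 1"
| "expr_size (Plus a b) = expr_size a + expr_size b + 2"
| "expr_size (Minus a b) = expr_size a + expr_size b + 2"
| "expr_size (Times a b) = expr_size a + expr_size b + 2"
| "expr_size (Div a b) = expr_size a + expr_size b + 2"
| "expr_size (Less a b) = expr_size a + expr_size b + 2"
| "expr_size (Prepend a b) = expr_size a + expr_size b + 2"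
| "expr_size (Head a) = expr_size a + 1"
| "expr_size (Tail a) = expr_size a + 1"

section \<open>Growth of values and cost of expressions\<close>

lemma bitlen_le_iff: "0 \<le> a \<Longrightarrow> nat (bitlen a) \<le> b \<longleftrightarrow> a < 2 ^ b"
  using bitlen_le_iff_power[of a "int b"] bitlen_nonneg[of a] by (simp add: nat_le_iff)

lemma abs_less_bitlen: "\<bar>a\<bar> < 2 ^ nat (bitlen \<bar>a\<bar>)"
  using bitlen_le_iff[of "\<bar>a\<bar>" "nat (bitlen \<bar>a\<bar>)"] by simp

lemma val_size_pos: "1 \<le> val_size v"
  by (cases v) auto

lemma val_size_Atom_le: "\<bar>a\<bar> < 2 ^ b \<Longrightarrow> val_size (Atom a) \<le> Suc b"
  by (simp add: bitlen_le_iff)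

lemma the_int_less: "\<bar>the_int v\<bar> < 2 ^ (val_size v - 1)"
  by (cases v) (use abs_less_bitlen in auto)

lemma val_size_Atom_add_le:
  assumes "\<bar>c\<bar> \<le> \<bar>the_int v\<bar> + \<bar>the_int u\<bar>"
  shows "val_size (Atom c) \<le> val_size v + val_size u"
proof -
  have "\<bar>c\<bar> < 2 ^ (val_size v - 1) + 2 ^ (val_size u - 1)"
    using assms the_int_less[of v] the_int_less[of u] by linarith
  also have "\<dots> \<le> 2 ^ (val_size v - 1 + (val_size u - 1)) + 2 ^ (val_size v - 1 + (val_size u - 1))"
    by (intro add_mono power_increasing) auto
  also have "\<dots> = 2 ^ (val_size v + val_size u - 1)"
    using val_size_pos[of v] val_size_pos[of u] by (cases "val_size v"; cases "val_size u") auto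
  finally have "val_size (Atom c) \<le> Suc (val_size v + val_size u - 1)"
    by (rule val_size_Atom_le)
  then show ?thesis
    using val_size_pos[of v] by simp
qed

lemma val_size_Atom_mult_le:
  "val_size (Atom (the_int v * the_int u)) \<le> val_size v + val_size u"
proof -
  have "\<bar>the_int v * the_int u\<bar> \<le> 2 ^ (val_size v - 1) * 2 ^ (val_size u - 1)"
    unfolding abs_mult using the_int_less[of v] the_int_less[of u] by (intro mult_mono) auto
  also have "\<dots> < 2 ^ (val_size v + val_size u - 1)"
    using val_size_pos[of v] val_size_pos[of u]
    by (cases "val_size v"; cases "val_size u") (auto simp: power_add[symmetric])
  finally have "val_size (Atom (the_int v * the_int u)) \<le> Suc (val_size v + val_size u - 1)"
    by (rule val_size_Atom_le)
  then show ?thesis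
    using val_size_pos[of v] by simp
qed

lemma abs_div_le_abs: "\<bar>a div b\<bar> \<le> \<bar>a\<bar>" for a b :: int
proof -
  have *: "\<bar>a div b\<bar> \<le> \<bar>a\<bar>" if b: "0 < b" for a b :: int
  proof (cases "0 \<le> a")
    case True
    then show ?thesis
      using zdiv_mono2[of a 1 b] b by (simp add: pos_imp_zdiv_nonneg_iff)
  next
    case False
    then show ?thesis
      using zdiv_mono2_neg[of a 1 b] b neg_imp_zdiv_neg_iff[of a b] pos_imp_zdiv_neg_iff[of b a] by simp
  qed
  consider "0 < b" | "b = 0" | "0 < - b" by linarith
  then show ?thesis
    using *[of b a] *[of "- b" "- a"] by cases simp_all
qed

lemma val_size_Atom_div_le: "val_size (Atom (the_int v div the_int u)) \<le> val_size v + 1"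
proof -
  have "\<bar>the_int v div the_int u\<bar> < 2 ^ (val_size v - 1)"
    using abs_div_le_abs the_int_less[of v] by (rule order_le_less_trans)
  from val_size_Atom_le[OF this] show ?thesis
    using val_size_pos[of v] by simp
qed

lemma val_size_list: "val_size (Node (the_list v)) \<le> val_size v"
  by (cases v) auto

lemma eval_size_le:
  assumes s: "\<And>x. val_size (s x) \<le> B"
  shows "val_size (eval e s) \<le> expr_size e * B"
proof -
  have B: "1 \<le> B" using s[of 0] val_size_pos[of "s 0"] by linarith
  show ?thesis
  proof (induction e)
    case (Var x)
    then show ?case using s by simp
  next
    case (Lit i)
    then show ?case using B by (cases B) auto
  next
    case Empty
    then show ?case using B by simp
  next
    case (Plus a b)
    have "val_size (eval (Plus a b) s) \<le> val_size (eval a s) + val_size (eval b s)"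
      unfolding eval.simps by (rule val_size_Atom_add_le) (rule abs_triangle_ineq)
    then show ?case using Plus by (simp add: algebra_simps)
  next
    case (Minus a b)
    have "val_size (eval (Minus a b) s) \<le> val_size (eval a s) + val_size (eval b s)"
      unfolding eval.simps by (rule val_size_Atom_add_le) (rule abs_triangle_ineq4)
    then show ?case using Minus by (simp add: algebra_simps)
  next
    case (Times a b)
    have "val_size (eval (Times a b) s) \<le> val_size (eval a s) + val_size (eval b s)"
      unfolding eval.simps by (rule val_size_Atom_mult_le)
    then show ?case using Times by (simp add: algebra_simps)
  next
    case (Div a b)
    have "val_size (eval (Div a b) s) \<le> val_size (eval a s) + 1"
      unfolding eval.simps by (rule val_size_Atom_div_le)
    then show ?case using Div(1) B by (simp add: algebra_simps)
  next
    case (Less a b)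
    have "val_size (eval (Less a b) s) \<le> 2"
      using val_size_Atom_le[of 0 1] val_size_Atom_le[of 1 1] by simp
    then show ?case using B by simp
  next
    case (Prepend a b)
    have "val_size (eval (Prepend a b) s) \<le> val_size (eval a s) + val_size (eval b s)"
      using val_size_list[of "eval b s"] by simp
    then show ?case using Prepend by (simp add: algebra_simps)
  next
    case (Head a)
    have "val_size (eval (Head a) s) \<le> val_size (eval a s) + 1"
      using val_size_list[of "eval a s"] by (auto split: list.split)
    then show ?case using Head B by (simp add: algebra_simps)
  next
    case (Tail a)
    have "val_size (eval (Tail a) s) \<le> val_size (eval a s)"
      using val_size_list[of "eval a s"] by (cases "the_list (eval a s)") auto
    then show ?case using Tail B by (simp add: algebra_simps)
  qed
qed

text \<open>The square absorbs the sum over subexpressions, since \<open>a + b + 2\<close>,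
  \<open>a^2\<close> and \<open>b^2\<close> add up to at most \<open>(a + b + 2)^2\<close>.\<close>

lemma cost_le:
  assumes s: "\<And>x. val_size (s x) \<le> B"
  shows "cost e s \<le> (expr_size e)\<^sup>2 * B"
proof -
  have "val_size (eval e s) \<le> expr_size e * B" for e
    by (rule eval_size_le) (rule s)
  note * = this[of "Var _"] this[of "Lit _"] this[of Empty] this[of "Plus _ _"] this[of "Minus _ _"]
    this[of "Times _ _"] this[of "Div _ _"] this[of "Less _ _"] this[of "Prepend _ _"]
    this[of "Head _"] this[of "Tail _"]
  have add: "x + (y + z) \<le> (a + b + 2)\<^sup>2 * B"
    if "x \<le> (a + b + 2) * B" "y \<le> a\<^sup>2 * B" "z \<le> b\<^sup>2 * B" for x y z a b :: nat
    using add_mono[OF that(1) add_mono[OF that(2,3)]]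
    by (simp add: power2_eq_square algebra_simps)
  have Suc: "x + y \<le> (a + 1)\<^sup>2 * B" if "x \<le> (a + 1) * B" "y \<le> a\<^sup>2 * B" for x y a :: nat
    using add_mono[OF that] by (simp add: power2_eq_square algebra_simps)
  have leaf: "x + 0 \<le> a\<^sup>2 * B" if "x \<le> a * B" for x a :: nat
    using order_trans[OF that mult_le_mono1[of a "a\<^sup>2" B]] by (simp add: power2_eq_square)
  show ?thesis
    by (induction e) (simp only: cost.simps subexpr_cost.simps expr_size.simps; intro add Suc leaf *[unfolded expr_size.simps]; assumption)+
qed

text \<open>Executions in which every assigned value has size at most \<open>B\<close>, with the number of steps
  in place of the time.\<close>

inductive bexec :: "(ilp \<Rightarrow> outcome) \<Rightarrow> nat \<Rightarrow> com \<Rightarrow> state \<Rightarrow> ilp list \<Rightarrow> nat \<Rightarrow> state \<Rightarrow> bool" for orc B where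
  Assign: "val_size (eval e s) \<le> B \<Longrightarrow> bexec orc B (Assign x e) s [] 1 (s(x := eval e s))"
| Solve: "eval e s = enc_ilp P \<Longrightarrow> ilp_wf P \<Longrightarrow> val_size (enc_outcome (orc P)) \<le> B \<Longrightarrow>
    bexec orc B (Solve x e) s [P] 1 (s(x := enc_outcome (orc P)))"
| Seq: "bexec orc B c s Ps t s' \<Longrightarrow> bexec orc B d s' Qs u s'' \<Longrightarrow>
    bexec orc B (Seq c d) s (Ps @ Qs) (1 + t + u) s''"
| CondTrue: "truthy (eval e s) \<Longrightarrow> bexec orc B c s Ps t s' \<Longrightarrow> bexec orc B (Cond e c d) s Ps (1 + t) s'"
| CondFalse: "\<not> truthy (eval e s) \<Longrightarrow> bexec orc B d s Ps t s' \<Longrightarrow> bexec orc B (Cond e c d) s Ps (1 + t) s'"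
| WhileTrue: "truthy (eval e s) \<Longrightarrow> bexec orc B c s Ps t s' \<Longrightarrow>
    bexec orc B (While e c) s' Qs u s'' \<Longrightarrow> bexec orc B (While e c) s (Ps @ Qs) (1 + t + u) s''"
| WhileFalse: "\<not> truthy (eval e s) \<Longrightarrow> bexec orc B (While e c) s [] 1 s"

text \<open>Time of a single step in units of \<open>B\<close>. It depends on the program text only
  and is therefore a constant of the algorithm.\<close>

fun com_factor :: "com \<Rightarrow> nat" where
  "com_factor (Assign x e) = 1 + (expr_size e)\<^sup>2"
| "com_factor (Solve x e) = 2 + (expr_size e)\<^sup>2"
| "com_factor (Seq c d) = 1 + com_factor c + com_factor d"
| "com_factor (Cond e c d) = 1 + (expr_size e)\<^sup>2 + com_factor c + com_factor d"
| "com_factor (While e c) = 1 + (expr_size e)\<^sup>2 + com_factor c"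

lemma mult_com_factor_mono: "t \<le> n * (a * B) \<Longrightarrow> a \<le> b \<Longrightarrow> t \<le> n * (b * B)" for t :: nat
  by (meson mult_le_mono order_refl order_trans)

text \<open>Splits the running time into the number of steps and the size of the largest value, so
  that reasoning about the program need not follow the cost of each expression.\<close>

lemma bexec_imp_exec:
  assumes "bexec orc B c s Ps n s'" "\<And>x. val_size (s x) \<le> B" and B: "1 \<le> B"
  shows "(\<forall>x. val_size (s' x) \<le> B) \<and> (\<exists>t. exec orc c s Ps t s' \<and> t \<le> n * (com_factor c * B))"
  using assms(1,2)
proof (induction rule: bexec.induct)
  case (Assign e s x)
  from B have "1 + cost e s \<le> 1 * (com_factor (Assign x e) * B)"
    using cost_le[of s B e, OF Assign.prems] by simp
  moreover have "\<forall>y. val_size ((s(x := eval e s)) y) \<le> B"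
    using Assign by simp
  ultimately show ?case
    using exec.Assign[of orc x e s] by blast
next
  case (Solve e s P x)
  from B have "1 + cost e s + val_size (enc_outcome (orc P)) \<le> 1 * (com_factor (Solve x e) * B)"
    using cost_le[of s B e, OF Solve.prems] Solve.hyps(3) by simp
  moreover have "\<forall>y. val_size ((s(x := enc_outcome (orc P))) y) \<le> B"
    using Solve.hyps(3) Solve.prems by simp
  ultimately show ?case
    using exec.Solve[OF Solve.hyps(1,2), of orc x] by blast
next
  case (Seq c s Ps n s' d Qs n' s'')
  obtain t where t: "exec orc c s Ps t s'" "t \<le> n * (com_factor c * B)" and s': "\<And>x. val_size (s' x) \<le> B"
    using Seq.IH(1)[OF Seq.prems] by blast
  obtain u where u: "exec orc d s' Qs u s''" "u \<le> n' * (com_factor d * B)" and s'': "\<And>x. val_size (s'' x) \<le> B"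
    using Seq.IH(2)[OF s'] by blast
  have "1 + t + u \<le> (1 + n + n') * (com_factor (Seq c d) * B)"
    unfolding distrib_right
    by (intro add_mono mult_com_factor_mono[OF t(2)] mult_com_factor_mono[OF u(2)]) (use B in auto)
  with exec.Seq[OF t(1) u(1)] s'' show ?case by blast
next
  case (CondTrue e s c Ps n s' d)
  obtain t where t: "exec orc c s Ps t s'" "t \<le> n * (com_factor c * B)" and s': "\<And>x. val_size (s' x) \<le> B"
    using CondTrue.IH[OF CondTrue.prems] by blast
  have "1 + cost e s + t \<le> (1 + n) * (com_factor (Cond e c d) * B)"
    unfolding distrib_right using cost_le[of s B e, OF CondTrue.prems] B
    by (intro add_mono mult_com_factor_mono[OF t(2)]) (auto simp: algebra_simps)
  with exec.CondTrue[OF CondTrue.hyps(1) t(1)] s' show ?case by blast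
next
  case (CondFalse e s d Ps n s' c)
  obtain t where t: "exec orc d s Ps t s'" "t \<le> n * (com_factor d * B)" and s': "\<And>x. val_size (s' x) \<le> B"
    using CondFalse.IH[OF CondFalse.prems] by blast
  have "1 + cost e s + t \<le> (1 + n) * (com_factor (Cond e c d) * B)"
    unfolding distrib_right using cost_le[of s B e, OF CondFalse.prems] B
    by (intro add_mono mult_com_factor_mono[OF t(2)]) (auto simp: algebra_simps)
  with exec.CondFalse[OF CondFalse.hyps(1) t(1)] s' show ?case by blast
next
  case (WhileTrue e s c Ps n s' Qs n' s'')
  obtain t where t: "exec orc c s Ps t s'" "t \<le> n * (com_factor c * B)" and s': "\<And>x. val_size (s' x) \<le> B"
    using WhileTrue.IH(1)[OF WhileTrue.prems] by blast
  obtain u where u: "exec orc (While e c) s' Qs u s''" "u \<le> n' * (com_factor (While e c) * B)"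
    and s'': "\<And>x. val_size (s'' x) \<le> B"
    using WhileTrue.IH(2)[OF s'] by blast
  have "1 + cost e s + t + u \<le> (1 + n + n') * (com_factor (While e c) * B)"
    unfolding distrib_right using cost_le[of s B e, OF WhileTrue.prems] B
    by (intro add_mono mult_com_factor_mono[OF t(2)] u(2)) (auto simp: algebra_simps)
  with exec.WhileTrue[OF WhileTrue.hyps(1) t(1) u(1)] s'' show ?case by blast
next
  case (WhileFalse e s c)
  have "1 + cost e s \<le> 1 * (com_factor (While e c) * B)"
    using cost_le[of s B e, OF WhileFalse.prems] B by (auto simp: algebra_simps)
  with exec.WhileFalse[OF WhileFalse.hyps(1), of orc c] WhileFalse.prems show ?case by blast
qed

section \<open>Frame property and weakest preconditions\<close>

fun mods :: "com \<Rightarrow> nat set" where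
  "mods (Assign x e) = {x}"
| "mods (Solve x e) = {x}"
| "mods (Seq c d) = mods c \<union> mods d"
| "mods (Cond e c d) = mods c \<union> mods d"
| "mods (While e c) = mods c"

lemma bexec_frame: "bexec orc B c s Ps n s' \<Longrightarrow> x \<notin> mods c \<Longrightarrow> s' x = s x"
  by (induction rule: bexec.induct) auto

text \<open>Total correctness: an execution has to exist. The postcondition also sees the solved
  ILPs and the number of steps.\<close>

definition wp :: "(ilp \<Rightarrow> outcome) \<Rightarrow> nat \<Rightarrow> com \<Rightarrow> (ilp list \<Rightarrow> nat \<Rightarrow> state \<Rightarrow> bool) \<Rightarrow> state \<Rightarrow> bool" where
  "wp orc B c Q s \<longleftrightarrow> (\<exists>Ps n s'. bexec orc B c s Ps n s' \<and> Q Ps n s')"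

lemma wp_mono: "wp orc B c Q s \<Longrightarrow> (\<And>Ps n s'. Q Ps n s' \<Longrightarrow> R Ps n s') \<Longrightarrow> wp orc B c R s"
  unfolding wp_def by blast

lemma wp_Assign: "val_size (eval e s) \<le> B \<Longrightarrow> Q [] 1 (s(x := eval e s)) \<Longrightarrow> wp orc B (Assign x e) Q s"
  unfolding wp_def by (blast intro: bexec.Assign)

lemma wp_Solve: "eval e s = enc_ilp P \<Longrightarrow> ilp_wf P \<Longrightarrow> val_size (enc_outcome (orc P)) \<le> B \<Longrightarrow>
    Q [P] 1 (s(x := enc_outcome (orc P))) \<Longrightarrow> wp orc B (Solve x e) Q s"
  unfolding wp_def by (blast intro: bexec.Solve)

lemma wp_Seq:
  "wp orc B c (\<lambda>Ps n s'. wp orc B d (\<lambda>Qs m. Q (Ps @ Qs) (1 + n + m)) s') s \<Longrightarrow> wp orc B (Seq c d) Q s"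
  unfolding wp_def by (blast intro: bexec.Seq)

lemma wp_Cond:
  "(truthy (eval e s) \<Longrightarrow> wp orc B c (\<lambda>Ps n. Q Ps (1 + n)) s) \<Longrightarrow>
   (\<not> truthy (eval e s) \<Longrightarrow> wp orc B d (\<lambda>Ps n. Q Ps (1 + n)) s) \<Longrightarrow> wp orc B (Cond e c d) Q s"
  unfolding wp_def by (cases "truthy (eval e s)") (blast intro: bexec.CondTrue bexec.CondFalse)+

text \<open>The invariant \<open>Inv j\<close> holds before the loop is run another \<open>j\<close> times, and the run with \<open>j\<close>
  further runs to follow solves the ILPs \<open>F j\<close>.\<close>

lemma wp_While:
  assumes init: "Inv N s"
    and body: "\<And>j s'. j < N \<Longrightarrow> Inv (Suc j) s' \<Longrightarrow> (\<And>x. x \<notin> mods c \<Longrightarrow> s' x = s x) \<Longrightarrow>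
      truthy (eval e s') \<and> wp orc B c (\<lambda>Ps n s''. Ps = F j \<and> n \<le> a \<and> Inv j s'') s'"
    and exit: "\<And>s'. Inv 0 s' \<Longrightarrow> (\<And>x. x \<notin> mods c \<Longrightarrow> s' x = s x) \<Longrightarrow> \<not> truthy (eval e s')"
    and post: "\<And>n s'. Inv 0 s' \<Longrightarrow> (\<And>x. x \<notin> mods c \<Longrightarrow> s' x = s x) \<Longrightarrow> n \<le> 1 + N * (1 + a) \<Longrightarrow>
      Q (concat (map F (rev [0..<N]))) n s'"
  shows "wp orc B (While e c) Q s"
proof -
  have "\<exists>n s''. bexec orc B (While e c) s' (concat (map F (rev [0..<j]))) n s'' \<and> Inv 0 s'' \<and> n \<le> 1 + j * (1 + a)"
    if "j \<le> N" "Inv j s'" "\<And>x. x \<notin> mods c \<Longrightarrow> s' x = s x" for j s'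
    using that
  proof (induction j arbitrary: s')
    case 0
    then show ?case using exit[of s'] by (force intro: bexec.WhileFalse)
  next
    case (Suc j)
    from body[of j s'] Suc.prems obtain n s'' where
      *: "truthy (eval e s')" "bexec orc B c s' (F j) n s''" "n \<le> a" "Inv j s''"
      unfolding wp_def by (metis Suc_le_eq)
    have "\<And>x. x \<notin> mods c \<Longrightarrow> s'' x = s x"
      using bexec_frame[OF *(2)] Suc.prems(3) by simp
    with Suc.IH[of s''] Suc.prems(1) *(4) obtain n' s3 where
      **: "bexec orc B (While e c) s'' (concat (map F (rev [0..<j]))) n' s3" "Inv 0 s3" "n' \<le> 1 + j * (1 + a)"
      by auto
    have "bexec orc B (While e c) s' (F j @ concat (map F (rev [0..<j]))) (1 + n + n') s3"
      by (rule bexec.WhileTrue[OF *(1,2) **(1)])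
    then show ?case using *(3) **(2,3)
      by (intro exI[of _ "1 + n + n'"] exI[of _ s3]) auto
  qed
  from this[OF order_refl init] obtain n s'' where
    *: "bexec orc B (While e c) s (concat (map F (rev [0..<N]))) n s''" "Inv 0 s''" "n \<le> 1 + N * (1 + a)"
    by auto
  have "\<And>x. x \<notin> mods c \<Longrightarrow> s'' x = s x"
    using bexec_frame[OF *(1)] by simp
  from post[OF *(2) this *(3)] *(1) show ?thesis
    unfolding wp_def by blast
qed

section \<open>The program\<close>

inductive_cases bexec_AssignE: "bexec orc B (Assign x e) s Ps n s'"
inductive_cases bexec_SeqE: "bexec orc B (Seq c d) s Ps n s'"
inductive_cases bexec_CondE: "bexec orc B (Cond e c d) s Ps n s'"

text \<open>As equations, this and the next rules let the simplifier run through straight-line code;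
  only \<open>Solve\<close> and \<open>While\<close> need a chosen ILP or invariant.\<close>

lemma wp_Assign_iff:
  "wp orc B (Assign x e) Q s \<longleftrightarrow> val_size (eval e s) \<le> B \<and> Q [] 1 (s(x := eval e s))"
proof
  assume "wp orc B (Assign x e) Q s"
  then obtain Ps n s' where "bexec orc B (Assign x e) s Ps n s'" "Q Ps n s'"
    unfolding wp_def by blast
  from this(1) show "val_size (eval e s) \<le> B \<and> Q [] 1 (s(x := eval e s))"
    by (rule bexec_AssignE) (use \<open>Q Ps n s'\<close> in simp)
qed (simp add: wp_Assign)

lemma wp_Seq_iff:
  "wp orc B (Seq c d) Q s \<longleftrightarrow> wp orc B c (\<lambda>Ps n. wp orc B d (\<lambda>Qs m. Q (Ps @ Qs) (1 + n + m))) s"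
proof
  assume "wp orc B (Seq c d) Q s"
  then obtain Ps n s' where "bexec orc B (Seq c d) s Ps n s'" "Q Ps n s'"
    unfolding wp_def by blast
  from this(1) show "wp orc B c (\<lambda>Ps n. wp orc B d (\<lambda>Qs m. Q (Ps @ Qs) (1 + n + m))) s"
    unfolding wp_def by (rule bexec_SeqE) (insert \<open>Q Ps n s'\<close>, simp, blast)
qed (rule wp_Seq)

lemma wp_Cond_iff:
  "wp orc B (Cond e c d) Q s \<longleftrightarrow>
    (if truthy (eval e s) then wp orc B c (\<lambda>Ps n. Q Ps (1 + n)) s else wp orc B d (\<lambda>Ps n. Q Ps (1 + n)) s)"
proof
  assume "wp orc B (Cond e c d) Q s"
  then obtain Ps n s' where "bexec orc B (Cond e c d) s Ps n s'" "Q Ps n s'"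
    unfolding wp_def by blast
  from this(1) show "if truthy (eval e s) then wp orc B c (\<lambda>Ps n. Q Ps (1 + n)) s
      else wp orc B d (\<lambda>Ps n. Q Ps (1 + n)) s"
    by (rule bexec_CondE) (use \<open>Q Ps n s'\<close> in \<open>auto simp: wp_def\<close>)
qed (auto intro: wp_Cond split: if_splits)

lemma wp_Cond_Assign_iff:
  "wp orc B (Cond e (Assign x a) (Assign x c)) Q s \<longleftrightarrow>
    val_size (if truthy (eval e s) then eval a s else eval c s) \<le> B \<and>
    Q [] 2 (s(x := if truthy (eval e s) then eval a s else eval c s))"
  by (simp add: wp_Cond_iff wp_Assign_iff numeral_2_eq_2)

lemmas wp_iffs = wp_Assign_iff wp_Seq_iff

lemma truthy_simps [simp]:
  "truthy (Atom a) \<longleftrightarrow> a \<noteq> 0" "truthy (Node vs) \<longleftrightarrow> vs \<noteq> []"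
  by (simp_all add: truthy_def)

text \<open>Goals contain the numerals, so updates of distinct variables simplify.
  \<open>vfree\<close> holds \<open>n\<close> absent bounds; \<open>vhs\<close> and
  \<open>vfs\<close> run through \<open>h\<close> and \<open>vfree\<close>; \<open>vitems\<close>
  collects \<open>l\<close>, \<open>u\<close>, \<open>q\<close>, \<open>h\<close> per coordinate,
  latest first. \<open>vmin\<close> and \<open>vmax\<close> are outcomes in the coordinate phase and
  bound lists in the grid phase.\<close>

abbreviation (input) "vIO \<equiv> 0 :: nat"
abbreviation (input) "vW \<equiv> 2 :: nat"
abbreviation (input) "vw \<equiv> 3 :: nat"
abbreviation (input) "vq \<equiv> 4 :: nat"
abbreviation (input) "vh \<equiv> 5 :: nat"
abbreviation (input) "v\<Delta> \<equiv> 6 :: nat"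
abbreviation (input) "vn \<equiv> 7 :: nat"
abbreviation (input) "vk \<equiv> 8 :: nat"
abbreviation (input) "vfree \<equiv> 9 :: nat"
abbreviation (input) "vhs \<equiv> 10 :: nat"
abbreviation (input) "vitems \<equiv> 11 :: nat"
abbreviation (input) "vfs \<equiv> 12 :: nat"
abbreviation (input) "vloop \<equiv> 13 :: nat"
abbreviation (input) "vfail \<equiv> 14 :: nat"
abbreviation (input) "vobj \<equiv> 15 :: nat"
abbreviation (input) "vi \<equiv> 16 :: nat"
abbreviation (input) "vmin \<equiv> 17 :: nat"
abbreviation (input) "vmax \<equiv> 18 :: nat"
abbreviation (input) "va \<equiv> 19 :: nat"
abbreviation (input) "vb \<equiv> 20 :: nat"
abbreviation (input) "vX \<equiv> 21 :: nat"
abbreviation (input) "vg \<equiv> 22 :: nat"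
abbreviation (input) "vc \<equiv> 23 :: nat"
abbreviation (input) "vbest \<equiv> 24 :: nat"
abbreviation (input) "vval \<equiv> 25 :: nat"
abbreviation (input) "vout \<equiv> 26 :: nat"
abbreviation (input) "vt \<equiv> 27 :: nat"

fun seqs :: "com list \<Rightarrow> com" where
  "seqs [] = Assign 0 (Var 0)"
| "seqs [c] = c"
| "seqs (c # d # cs) = Seq c (seqs (d # cs))"

definition tuple :: "expr list \<Rightarrow> expr" where
  "tuple es = foldr Prepend es Empty"

text \<open>There is no length operation: one pass over \<open>h\<close> counts \<open>n\<close> and
  builds as many copies of \<open>Node []\<close>, the encoding of an absent bound.\<close>

definition com_count :: com where
  "com_count = seqs
    [Assign vn (Plus (Var vn) (Lit 1)), Assign vfree (Prepend Empty (Var vfree)), Assign vhs (Tail (Var vhs))]"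

definition com_init :: com where
  "com_init = seqs
    [Assign vW (Head (Var vIO)), Assign vw (Head (Tail (Var vIO))), Assign vq (Head (Tail (Tail (Var vIO)))),
     Assign vh (Head (Tail (Tail (Tail (Var vIO))))), Assign v\<Delta> (Head (Tail (Tail (Tail (Tail (Var vIO)))))),
     Assign vn (Lit 0), Assign vfree Empty, Assign vhs (Var vh),
     While (Var vhs) com_count]"

text \<open>Equality with the current coordinate \<open>vk\<close> is expressed by two strict
  comparisons. Counting down makes \<open>Prepend\<close> build the unit vector in order.\<close>

definition com_unit :: com where
  "com_unit = seqs
    [Assign vi (Minus (Var vi) (Lit 1)),
     Assign vobj (Prepend (Minus (Lit 1) (Plus (Less (Var vi) (Var vk)) (Less (Var vk) (Var vi)))) (Var vobj))]"

definition com_nth :: com where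
  "com_nth = seqs
    [Assign va (Tail (Var va)), Assign vb (Tail (Var vb)), Assign vi (Minus (Var vi) (Lit 1))]"

text \<open>An outcome is a solution exactly if its encoding has a nonempty tail; otherwise
  \<open>vfail\<close> stores it. The loop continues after a failure, with missing entries read as
  \<open>Node []\<close>, so always \<open>2 k\<close> ILPs are solved. Afterwards
  \<open>vhs\<close> and \<open>vfs\<close> are just the parts beyond coordinate
  \<open>k\<close>.\<close>

definition com_coord :: com where
  "com_coord = seqs
    [Assign vobj Empty, Assign vi (Var vn), While (Var vi) com_unit,
     Solve vmin (tuple [Lit 0, Var vobj, Var vW, Var vw, Var vfree, Var vfree]),
     Solve vmax (tuple [Lit 1, Var vobj, Var vW, Var vw, Var vfree, Var vfree]),
     Assign va (Head (Tail (Var vmin))), Assign vb (Head (Tail (Var vmax))), Assign vi (Var vk),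
     While (Var vi) com_nth,
     Cond (Tail (Var vmin)) (Assign vfail (Var vfail)) (Assign vfail (Var vmin)),
     Cond (Tail (Var vmax)) (Assign vfail (Var vfail)) (Assign vfail (Var vmax)),
     Assign vitems (Prepend (tuple [Head (Var va), Head (Var vb), Head (Var vloop), Head (Var vhs)]) (Var vitems)),
     Assign vhs (Tail (Var vhs)), Assign vfs (Tail (Var vfs)), Assign vloop (Tail (Var vloop)),
     Assign vk (Plus (Var vk) (Lit 1))]"

definition com_coords :: com where
  "com_coords = seqs
    [Assign vhs (Var vh), Assign vitems Empty, Assign vfs (Var vfree), Assign vk (Lit 0),
     Assign vloop (Var vq), Assign vfail Empty, While (Var vloop) com_coord]"

section \<open>Execution of the coordinate phase\<close>

definition nthv :: "val list \<Rightarrow> nat \<Rightarrow> val" where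
  "nthv vs i = (case drop i vs of [] \<Rightarrow> Node [] | v # _ \<Rightarrow> v)"

abbreviation atoms :: "int vec \<Rightarrow> val list" where
  "atoms v \<equiv> map Atom (list_of_vec v)"

fun entries :: "outcome \<Rightarrow> val list" where
  "entries (Solution x) = atoms x"
| "entries _ = []"

lemma eval_entries: "(case tl (the_list (enc_outcome r)) of [] \<Rightarrow> Node [] | v # vs \<Rightarrow> v) = Node (entries r)"
  by (cases r) (simp_all add: enc_vec_def)

lemma truthy_tl_outcome: "tl (the_list (enc_outcome r)) \<noteq> [] \<longleftrightarrow> (\<exists>x. r = Solution x)"
  by (cases r) simp_all

lemma concat_map_Nil [simp]: "concat (map (\<lambda>_. []) xs) = []"
  by (induction xs) auto

lemma nat_bitlen_simps [simp]: "nat (bitlen 1) = 1" "nat (bitlen 2) = 2"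
  using bitlen_le_iff[of 1 0] bitlen_le_iff[of 1 1] bitlen_le_iff[of 2 1] bitlen_le_iff[of 2 2] by simp_all

lemma drop_Suc_tl: "tl (drop i xs) = drop (Suc i) xs"
  by (simp add: drop_Suc tl_drop)

lemma val_size_entries_drop: "val_size (Node (drop i (entries r))) \<le> val_size (enc_outcome r)"
proof -
  have "sum_list (map val_size (drop i vs)) \<le> sum_list (map val_size vs)" for vs
    by (metis append_take_drop_id le_add2 map_append sum_list_append)
  then show ?thesis
    by (cases r) (auto simp: enc_vec_def intro!: le_SucI trans_le_add2 simp del: map_map)
qed

text \<open>Two budgets: \<open>b\<close> bits for a single number and \<open>B\<close> for any
  stored value. A solution of the solver is stored as a whole, hence within \<open>B\<close>, but
  one entry of it enters an item and must respect \<open>b\<close>.\<close>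

locale iqp_run = iqp_alg +
  fixes b B :: nat
  assumes B: "5 * (b + 1) * (n + 1) \<le> B"
    and input_small: "val_size (iqp_input W w q h (max_subdet W) 0) \<le> B"
    and n_bits: "int n < 2 ^ b"
    and coord_small: "i < k \<Longrightarrow> val_size (enc_outcome (orc (coord_ilp mx i))) \<le> B"
    and coord_entry: "i < k \<Longrightarrow> val_size (nthv (entries (orc (coord_ilp mx i))) i) \<le> Suc b"
    and qh_bits: "i < k \<Longrightarrow> \<bar>q $ i\<bar> < 2 ^ b" "i < n \<Longrightarrow> \<bar>h $ i\<bar> < 2 ^ b"
begin

lemma B': "5 * (b + 1) * n + 5 * (b + 1) \<le> B"
  using B by (simp add: algebra_simps)

lemma B2: "2 \<le> B"
  using B' by simp

lemma small_Atom: "\<bar>a\<bar> < 2 ^ b \<Longrightarrow> val_size (Atom a) \<le> B"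
  using val_size_Atom_le[of a b] B' by simp

text \<open>An item consists of four numbers of size at most \<open>b + 1\<close> and a list node,
  which gives \<open>4 * b + 5\<close>; the budget \<open>B\<close> has room for \<open>n\<close> of
  these.\<close>

lemma small_list:
  assumes "length vs \<le> n" "\<And>v. v \<in> set vs \<Longrightarrow> val_size v \<le> 4 * b + 5"
  shows "val_size (Node vs) \<le> B"
proof -
  have "sum_list (map val_size vs) \<le> length vs * (4 * b + 5)"
    using assms(2) by (induction vs) (fastforce intro: add_mono)+
  also have "\<dots> \<le> n * (4 * b + 5)"
    using assms(1) by (rule mult_right_mono) simp
  finally show ?thesis
    using B' by (simp add: algebra_simps)
qed

lemma small_atoms:
  assumes "length as \<le> n" "\<And>a. a \<in> set as \<Longrightarrow> \<bar>a\<bar> < 2 ^ b"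
  shows "val_size (Node (map Atom as)) \<le> B"
  by (rule small_list) (use assms val_size_Atom_le in \<open>fastforce+\<close>)

definition data :: "state \<Rightarrow> bool" where
  "data s \<longleftrightarrow> s vW = enc_mat W \<and> s vw = enc_vec w \<and> s vq = Node (atoms q) \<and> s vh = Node (atoms h) \<and>
     s v\<Delta> = Atom (max_subdet W) \<and> s vn = Atom (int n) \<and> s vfree = Node (replicate n (Node []))"

lemma length_atoms: "length (atoms q) = k" "length (atoms h) = n"
  using q h by auto

lemma wp_init:
  assumes s: "s vIO = iqp_input W w q h (max_subdet W) 0"
  shows "wp orc B com_init (\<lambda>Ps t s'. Ps = [] \<and> t \<le> 20 + 6 * n \<and> data s') s"
proof -
  have sizes: "val_size (enc_mat W) \<le> B" "val_size (enc_vec w) \<le> B" "val_size (enc_vec q) \<le> B"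
    "val_size (enc_vec h) \<le> B" "val_size (Atom (max_subdet W)) \<le> B"
    using input_small by (auto simp: iqp_input_def)
  let ?Inv = "\<lambda>j s'. s' vhs = Node (drop (n - j) (atoms h)) \<and> s' vn = Atom (int (n - j)) \<and>
      s' vfree = Node (replicate (n - j) (Node []))"
  show ?thesis
    unfolding com_init_def using sizes s B2
    apply (simp add: wp_iffs iqp_input_def enc_vec_def)
    apply (rule wp_While[where Inv = ?Inv and N = n and a = 5 and F = "\<lambda>_. []"])
    subgoal by simp
    subgoal premises prems for j s'
    proof -
      let ?i = "n - Suc j"
      have i: "n - j = Suc ?i" "?i < n" using prems by auto
      have "val_size (Node (replicate (n - j) (Node []))) \<le> B"
        by (rule small_list) auto
      moreover have "val_size (Atom (int (n - j))) \<le> B"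
        using n_bits by (intro small_Atom) auto
      moreover have "val_size (Node (drop (n - j) (atoms h))) \<le> B"
        using qh_bits(2) h unfolding drop_map
        by (intro small_atoms) (auto simp: in_set_conv_nth nth_list_of_vec dest!: in_set_dropD)
      ultimately show ?thesis
        using prems i length_atoms(2) unfolding i
        by (simp add: com_count_def wp_iffs drop_Suc_tl)
    qed
    subgoal using length_atoms by simp
    subgoal by (simp add: data_def com_count_def enc_vec_def)
    done
qed

lemma small_qh_drop: "val_size (Node (drop i (atoms h))) \<le> B" "val_size (Node (drop i (atoms q))) \<le> B"
proof -
  have "\<bar>a\<bar> < 2 ^ b" if "a \<in> set (list_of_vec h)" for a
    using that qh_bits(2) h by (auto simp: in_set_conv_nth nth_list_of_vec)
  then show "val_size (Node (drop i (atoms h))) \<le> B"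
    unfolding drop_map using h by (intro small_atoms) (auto dest: in_set_dropD)
  have "\<bar>a\<bar> < 2 ^ b" if "a \<in> set (list_of_vec q)" for a
    using that qh_bits(1) q by (auto simp: in_set_conv_nth nth_list_of_vec)
  then show "val_size (Node (drop i (atoms q))) \<le> B"
    unfolding drop_map using q kn by (intro small_atoms) (auto dest: in_set_dropD)
qed

lemma small_replicate: "i \<le> n \<Longrightarrow> val_size (Node (replicate i (Node []))) \<le> B"
  by (rule small_list) auto

lemma small_nat: "i \<le> n \<Longrightarrow> val_size (Atom (int i)) \<le> B"
  using n_bits by (intro small_Atom) auto

definition item :: "nat \<Rightarrow> val" where
  "item i = Node [nthv (entries (orc (coord_ilp False i))) i, nthv (entries (orc (coord_ilp True i))) i,
     Atom (q $ i), Atom (h $ i)]"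

lemma small_items: "i \<le> k \<Longrightarrow> val_size (Node (rev (map item [0..<i]))) \<le> B"
proof (rule small_list)
  fix v assume "i \<le> k" "v \<in> set (rev (map item [0..<i]))"
  then obtain j where j: "j < i" "v = item j" by auto
  with \<open>i \<le> k\<close> have jk: "j < k" by simp
  show "val_size v \<le> 4 * b + 5"
    using coord_entry[OF jk, of False] coord_entry[OF jk, of True]
      val_size_Atom_le[of "q $ j" b] val_size_Atom_le[of "h $ j" b] qh_bits(1)[OF jk] qh_bits(2)[of j] jk kn j(2)
    by (simp add: item_def)
qed (use kn in simp)

text \<open>Which of several failing outcomes is kept does not matter, since each of them is a
  correct answer.\<close>

definition fail_inv :: "nat \<Rightarrow> val \<Rightarrow> bool" where
  "fail_inv i v \<longleftrightarrow> v = Node [] \<and> (\<forall>j<i. \<forall>mx. \<exists>x. orc (coord_ilp mx j) = Solution x) \<or>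
     (\<exists>j<i. \<exists>mx. \<not> (\<exists>x. orc (coord_ilp mx j) = Solution x) \<and> v = enc_outcome (orc (coord_ilp mx j)))"

lemma fail_inv_small: "fail_inv i v \<Longrightarrow> i \<le> k \<Longrightarrow> val_size v \<le> B"
  unfolding fail_inv_def using coord_small B2 by auto

lemma drop_atoms_q: "i < k \<Longrightarrow> drop i (atoms q) = Atom (q $ i) # drop (Suc i) (atoms q)"
  using q by (simp add: Cons_nth_drop_Suc[symmetric] nth_list_of_vec)

lemma drop_atoms_h: "i < n \<Longrightarrow> drop i (atoms h) = Atom (h $ i) # drop (Suc i) (atoms h)"
  using h by (simp add: Cons_nth_drop_Suc[symmetric] nth_list_of_vec)

lemma fail_inv_Suc:
  assumes "fail_inv i v"
    and "v' = (if \<exists>x. orc (coord_ilp False i) = Solution x then v else enc_outcome (orc (coord_ilp False i)))"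
  shows "fail_inv (Suc i) (if \<exists>x. orc (coord_ilp True i) = Solution x then v' else enc_outcome (orc (coord_ilp True i)))"
proof (cases "\<exists>mx. \<not> (\<exists>x. orc (coord_ilp mx i) = Solution x)")
  case True
  then have "\<exists>mx. \<not> (\<exists>x. orc (coord_ilp mx i) = Solution x) \<and>
      (if \<exists>x. orc (coord_ilp True i) = Solution x then v' else enc_outcome (orc (coord_ilp True i))) =
      enc_outcome (orc (coord_ilp mx i))"
    unfolding assms(2) by (metis (full_types))
  then show ?thesis
    unfolding fail_inv_def by blast
next
  case False
  then have "\<And>mx. \<exists>x. orc (coord_ilp mx i) = Solution x" by blast
  then show ?thesis
    using assms(1) unfolding assms(2) fail_inv_def by (auto simp: less_Suc_eq)
qed

definition coords_inv :: "nat \<Rightarrow> state \<Rightarrow> bool" where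
  "coords_inv i s \<longleftrightarrow> data s \<and> s vloop = Node (drop i (atoms q)) \<and> s vhs = Node (drop i (atoms h)) \<and>
     s vfs = Node (replicate (n - i) (Node [])) \<and> s vk = Atom (int i) \<and>
     s vitems = Node (rev (map item [0..<i])) \<and> fail_inv i (s vfail)"

lemma enc_coord_ilp:
  "enc_ilp (coord_ilp mx i) = Node [Atom (if mx then 1 else 0),
     Node (map (\<lambda>j. Atom (if j = i then 1 else 0)) [0..<n]), enc_mat W, enc_vec w,
     Node (replicate n (Node [])), Node (replicate n (Node []))]"
  by (simp add: enc_ilp_def coord_ilp_def enc_bounds_def enc_vec_def unit_vec_def comp_def)

lemma wp_coord:
  assumes i: "i < k" and inv: "coords_inv i s"
  shows "wp orc B com_coord (\<lambda>Ps t s'. Ps = [coord_ilp False i, coord_ilp True i] \<and> t \<le> 50 + 12 * n \<and>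
    coords_inv (Suc i) s') s"
proof -
  have inn: "i < n" using i kn by simp
  note d = inv[unfolded coords_inv_def data_def]
  let ?I1 = "\<lambda>j s'. s' vi = Atom (int j) \<and> s' vobj = Node (map (\<lambda>l. Atom (if l = i then 1 else 0)) [j..<n])"
  let ?I2 = "\<lambda>j s'. s' vi = Atom (int j) \<and> s' va = Node (drop (i - j) (entries (orc (coord_ilp False i)))) \<and>
    s' vb = Node (drop (i - j) (entries (orc (coord_ilp True i))))"
  show ?thesis
    unfolding com_coord_def using d B2 small_nat[of n] inn
    apply (simp add: wp_iffs)
    apply (rule wp_While[where Inv = ?I1 and N = n and a = 3 and F = "\<lambda>_. []"])
    subgoal by simp
    subgoal premises prems for j s'
    proof -
      have "val_size (Node (map (\<lambda>l. Atom (if l = i then 1 else 0)) [j..<n])) \<le> B"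
        by (rule small_list) (auto)
      then show ?thesis
        using prems small_nat[of j]
        by (auto simp: com_unit_def wp_iffs upt_conv_Cons)
    qed
    subgoal by simp
    subgoal premises prems for t s'
      apply (simp add: wp_iffs)
      apply (rule wp_Solve[where P = "coord_ilp False i"])
      subgoal using prems by (simp add: enc_coord_ilp tuple_def com_unit_def)
      subgoal using inn by (rule coord_ilp_wf)
      subgoal using coord_small[OF i] .
      apply (simp add: wp_iffs)
      apply (rule wp_Solve[where P = "coord_ilp True i"])
      subgoal using prems by (simp add: enc_coord_ilp tuple_def com_unit_def)
      subgoal using inn by (rule coord_ilp_wf)
      subgoal using coord_small[OF i] .
      apply (simp add: wp_iffs eval_entries)
      apply (intro conjI)
      subgoal using order_trans[OF val_size_entries_drop[of 0] coord_small[OF i]] by simp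
      subgoal using order_trans[OF val_size_entries_drop[of 0] coord_small[OF i]] by simp
      subgoal using prems small_nat[of i] by (simp add: com_unit_def)
      apply (rule wp_While[where Inv = ?I2 and N = i and a = 5 and F = "\<lambda>_. []"])
      subgoal using prems by (simp add: com_unit_def)
      subgoal premises prems' for j s3
      proof -
        have ij: "i - j = Suc (i - Suc j)" using prems'(1) by simp
        show ?thesis
          using prems' small_nat[of j] inn order_trans[OF val_size_entries_drop coord_small[OF i]] unfolding ij
          by (simp add: com_nth_def wp_iffs drop_Suc_tl)
      qed
      subgoal by simp
      subgoal premises prems' for t' s3
      proof -
        have "fail_inv i (s vfail)" using d by simp
        note fail' = fail_inv_Suc[OF this refl]
        note fs = fail' fail_inv_small[OF fail'] fail_inv_small[OF \<open>fail_inv i (s vfail)\<close>] coord_small[OF i, of False]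
        have items: "rev (map item [0..<Suc i]) = item i # rev (map item [0..<i])"
          by simp
        note sizes = small_items[of "Suc i", unfolded items] small_qh_drop[of "Suc i"]
          small_replicate[of "n - Suc i"]
        have "val_size (Atom (int i + 1)) \<le> B"
          using small_nat[of "Suc i"] inn by (simp add: add.commute)
        then show ?thesis
          using prems' prems fs sizes i
          apply (simp add: com_unit_def com_nth_def split del: if_split)
          apply (simp add: wp_iffs wp_Cond_Assign_iff truthy_tl_outcome drop_atoms_q drop_atoms_h tuple_def
              nthv_def[symmetric] item_def[symmetric] coords_inv_def data_def
              cong: if_cong split del: if_split)
          apply simp
          done
      qed
      done
    done
qed

lemma small_init: "val_size (Atom 0) \<le> B" "val_size (Node []) \<le> B"
  using B2 by simp_all

lemma wp_coords:
  assumes d: "data s"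
  shows "wp orc B com_coords (\<lambda>Ps t s'.
    Ps = concat (map (\<lambda>i. [coord_ilp False i, coord_ilp True i]) [0..<k]) \<and>
    t \<le> 20 + k * (60 + 12 * n) \<and> coords_inv k s') s"
proof -
  \<comment> \<open>The loop rule indexes rounds by those still to come, the coordinates count
    upwards; reversing the list reconciles both.\<close>
  have rev: "map (\<lambda>j. [coord_ilp False (k - Suc j), coord_ilp True (k - Suc j)]) (rev [0..<k]) =
      map (\<lambda>i. [coord_ilp False i, coord_ilp True i]) [0..<k]"
    by (rule nth_equalityI) (auto simp: rev_nth)
  note d' = d[unfolded data_def]
  show ?thesis
    unfolding com_coords_def
    using d' small_init small_qh_drop[of 0] small_replicate[of n]
    apply (simp add: wp_iffs)
    apply (rule wp_While[where Inv = "\<lambda>j. coords_inv (k - j)" and N = k and a = "50 + 12 * n"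
        and F = "\<lambda>j. [coord_ilp False (k - Suc j), coord_ilp True (k - Suc j)]"])
    subgoal by (simp add: coords_inv_def data_def fail_inv_def)
    subgoal premises prems for j s'
    proof -
      have kj: "k - j = Suc (k - Suc j)" "k - Suc j < k" using prems by auto
      have "truthy (s' vloop)"
        using prems kj drop_atoms_q by (simp add: coords_inv_def)
      then show ?thesis
        using wp_coord[of "k - Suc j" s'] prems kj by (auto simp: kj(1))
    qed
    subgoal using length_atoms by (simp add: coords_inv_def)
    subgoal by (simp add: rev algebra_simps)
    done
qed

end

section \<open>The grid phase of the program\<close>

definition com_power :: com where
  "com_power = seqs [Assign vc (Times (Var vc) (Var vg)), Assign vloop (Tail (Var vloop))]"

text \<open>The root is found by linear search. This is fast enough because at least
  \<open>g\<close> box ILPs follow, and each of their outcomes adds to the argument of the time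
  bound.\<close>

definition com_grid :: "int \<Rightarrow> com" where
  "com_grid E = seqs
    [Assign vX (Times (Times (Lit 2) (Var vn)) (Var v\<Delta>)),
     Assign vX (Times (Var vk) (Plus (Times (Var vX) (Var vX)) (Lit E))),
     Assign vg (Lit 0),
     While (Less (Times (Var vg) (Var vg)) (Var vX)) (Assign vg (Plus (Var vg) (Lit 1))),
     Assign vc (Lit 1), Assign vloop (Var vq), While (Var vloop) com_power]"

text \<open>The digit is \<open>vi - vg * (vi div vg)\<close>, as there is no remainder operation.
  Coordinates are processed from \<open>k - 1\<close> down to 0, so \<open>Prepend\<close> extends
  the lists, which start with the part beyond \<open>k\<close>, in the right order.\<close>

definition com_digit :: com where
  "com_digit = seqs
    [Assign vt (Head (Var vloop)),
     Assign va (Div (Minus (Head (Tail (Var vt))) (Head (Var vt))) (Var vg)),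
     Assign vb (Plus (Head (Var vt))
       (Times (Minus (Var vi) (Times (Var vg) (Div (Var vi) (Var vg)))) (Plus (Var va) (Lit 1)))),
     Assign va (Plus (Var vb) (Var va)),
     Assign vmin (Prepend (Var vb) (Var vmin)), Assign vmax (Prepend (Var va) (Var vmax)),
     Assign vobj (Prepend (Minus (Head (Tail (Tail (Tail (Var vt)))))
       (Times (Head (Tail (Tail (Var vt)))) (Plus (Var vb) (Var va)))) (Var vobj)),
     Assign vi (Div (Var vi) (Var vg)), Assign vloop (Tail (Var vloop))]"

text \<open>Beyond its end, the shorter list \<open>q\<close> yields \<open>Node []\<close>, which arithmetic reads as 0.\<close>

definition com_value :: com where
  "com_value = seqs
    [Assign vt (Plus (Var vt)
       (Times (Minus (Head (Var vb)) (Times (Head (Var va)) (Head (Var vloop)))) (Head (Var vloop)))),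
     Assign vloop (Tail (Var vloop)), Assign va (Tail (Var va)), Assign vb (Tail (Var vb))]"

text \<open>\<open>better\<close> on the tags 0, 1, 2 that encode infeasible, unbounded and
  solution.\<close>

definition com_update :: com where
  "com_update =
    (let keep = Assign vbest (Var vbest); replace = Seq (Assign vbest (Var vout)) (Assign vval (Var vt))
     in Cond (Tail (Var vout))
         (Cond (Less (Lit 1) (Head (Var vbest)))
           (Cond (Less (Var vt) (Var vval)) replace keep)
           (Cond (Head (Var vbest)) keep replace))
         (Cond (Head (Var vout)) (Assign vbest (Var vout)) keep))"

definition com_box :: com where
  "com_box = seqs
    [Assign vc (Minus (Var vc) (Lit 1)), Assign vi (Var vc), Assign vloop (Var vitems), Assign vobj (Var vhs),
     Assign vmin (Var vfs), Assign vmax (Var vfs), While (Var vloop) com_digit,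
     Solve vout (tuple [Lit 0, Var vobj, Var vW, Var vw, Var vmin, Var vmax]),
     Assign vt (Lit 0), Assign vloop (Head (Tail (Var vout))), Assign va (Var vq), Assign vb (Var vh),
     While (Var vloop) com_value, com_update]"

definition com_boxes :: com where
  "com_boxes = seqs
    [Assign vbest (tuple [Lit 0]), Assign vval (Lit 0), While (Var vc) com_box, Assign vIO (Var vbest)]"

definition com_iqp :: "int \<Rightarrow> com" where
  "com_iqp E = seqs
    [com_init, com_coords, Cond (Var vfail) (Assign vIO (Var vfail)) (Seq (com_grid E) com_boxes)]"

text \<open>The intermediate values of \<open>com_value\<close>, with \<open>q\<close> extended by
  zeros. They need their own size bound because summands may cancel.\<close>

definition value_sum :: "int vec \<Rightarrow> int vec \<Rightarrow> int vec \<Rightarrow> nat \<Rightarrow> int" where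
  "value_sum q h x i = (\<Sum>j<i. (h $ j - (if j < dim_vec q then q $ j else 0) * x $ j) * x $ j)"

lemma iqp_objective_eq_value_sum:
  assumes "dim_vec q \<le> dim_vec x"
  shows "iqp_objective q h x = value_sum q h x (dim_vec x)"
proof -
  have "(\<Sum>i<dim_vec q. - (q $ i) * (x $ i)\<^sup>2) =
      (\<Sum>i<dim_vec x. if i < dim_vec q then - (q $ i) * (x $ i)\<^sup>2 else 0)"
    by (rule sum.mono_neutral_cong_left) (use assms in auto)
  then show ?thesis
    by (auto simp: iqp_objective_def value_sum_def scalar_prod_def lessThan_atLeast0 sum.distrib[symmetric]
        power2_eq_square algebra_simps intro!: sum.cong)
qed

definition (in iqp_alg) coord_ilps :: "ilp list" where
  "coord_ilps = concat (map (\<lambda>i. [coord_ilp False i, coord_ilp True i]) [0..<k])"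

definition (in iqp_alg) box_ilps :: "ilp list" where
  "box_ilps = map box_ilp (rev [0..<g ^ k])"

lemma (in iqp_run) wp_iqp_failed:
  assumes failed and s: "s vIO = iqp_input W w q h (max_subdet W) 0"
  shows "wp orc B (com_iqp E) (\<lambda>Ps t s'. Ps = coord_ilps \<and> t \<le> 50 + 6 * n + k * (60 + 12 * n) \<and>
    (\<exists>i<k. \<exists>mx. \<not> (\<exists>x. orc (coord_ilp mx i) = Solution x) \<and> s' vIO = enc_outcome (orc (coord_ilp mx i)))) s"
  unfolding com_iqp_def
  apply (simp add: wp_iffs del: eval.simps)
  apply (rule wp_mono[OF wp_init[where s = s]])
  subgoal by (rule s)
  apply (elim conjE)
  apply (rule wp_Seq)
  apply (rule wp_mono[OF wp_coords])
  subgoal .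
  subgoal premises prems for Ps t s' Ps' t' s''
  proof -
    have inv: "fail_inv k (s'' vfail)"
      using prems by (simp add: coords_inv_def)
    then obtain i mx where *: "i < k" "\<not> (\<exists>x. orc (coord_ilp mx i) = Solution x)"
        "s'' vfail = enc_outcome (orc (coord_ilp mx i))"
      using \<open>failed\<close> unfolding fail_inv_def failed_def by blast
    moreover have "truthy (enc_outcome r)" for r
      by (cases r) simp_all
    ultimately have "truthy (eval (Var vfail) s'')" by simp
    moreover have "val_size (s'' vfail) \<le> B"
      using fail_inv_small[OF inv] by simp
    ultimately show ?thesis
      using prems * by (auto simp: wp_Cond_iff wp_iffs coord_ilps_def)
  qed
  done

section \<open>Execution of the grid phase\<close>

locale iqp_run_boxes = iqp_run +
  assumes nf: "\<not> failed"
    and Y_bits: "\<bar>2 * int n * max_subdet W\<bar> < 2 ^ b" and X_bits: "X < 2 ^ b" and N_bits: "int g ^ k < 2 ^ b"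
    and box_small: "c < g ^ k \<Longrightarrow> val_size (enc_outcome (orc (box_ilp c))) \<le> B"
    and wd_bits: "i < k \<Longrightarrow> \<bar>wd i\<bar> < 2 ^ b"
    and box_bits: "c < g ^ k \<Longrightarrow> i < k \<Longrightarrow> \<bar>box_lo c i\<bar> < 2 ^ b \<and> \<bar>box_hi c i\<bar> < 2 ^ b"
    and obj_bits: "c < g ^ k \<Longrightarrow> i < n \<Longrightarrow> \<bar>box_obj c $ i\<bar> < 2 ^ b"
    and value_bits: "c < g ^ k \<Longrightarrow> orc (box_ilp c) = Solution x \<Longrightarrow> i \<le> n \<Longrightarrow>
      \<bar>value_sum q h x i\<bar> < 2 ^ b"
begin

lemma g_power_le: "j \<le> k \<Longrightarrow> g ^ j \<le> g ^ k"
  using g_pos by (cases "k = 0") (auto intro: power_increasing)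

lemma small_nat_le_N: "i \<le> g ^ k \<Longrightarrow> val_size (Atom (int i)) \<le> B"
proof (rule small_Atom)
  assume "i \<le> g ^ k"
  then have "int i \<le> int g ^ k"
    by (metis of_nat_le_iff of_nat_power)
  from order_le_less_trans[OF this N_bits] show "\<bar>int i\<bar> < 2 ^ b"
    by (simp only: abs_of_nat)
qed

text \<open>Charges the search for \<open>g\<close> to the solver calls. For \<open>k = 0\<close> it
  still holds, since then \<open>X\<close> and hence \<open>g\<close> are 0.\<close>

lemma g_le_N: "g \<le> g ^ k"
proof (cases "k = 0")
  case True
  then have "X \<le> (int 0)\<^sup>2" unfolding X_def by simp
  then have "g \<le> 0" by (rule g_le)
  then show ?thesis by simp
next
  case False
  then show ?thesis using g_power_le[of 1] by simp
qed

lemma wp_grid: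
  assumes d: "coords_inv k s"
  shows "wp orc B (com_grid E) (\<lambda>Ps t s'. Ps = [] \<and> t \<le> 20 + 3 * g + 5 * k \<and>
    coords_inv k s' \<and> s' vg = Atom (int g) \<and> s' vc = Atom (int (g ^ k))) s"
proof -
  note d' = d[unfolded coords_inv_def data_def]
  have sX: "val_size (Atom X) \<le> B" "val_size (Atom (2 * int n * max_subdet W)) \<le> B"
    using X_bits Y_bits X_nonneg by (intro small_Atom; simp)+
  have X: "int k * (4 * (int n * (max_subdet W * (int n * max_subdet W))) + E) = X"
    by (simp add: X_def power2_eq_square)
  have s1: "val_size (Atom 1) \<le> B" using B2 by simp
  show ?thesis
    unfolding com_grid_def
    using d' small_init sX B2 small_qh_drop[of 0] s1
    apply (simp add: wp_iffs X)
    apply (rule wp_While[where Inv = "\<lambda>j s'. s' vg = Atom (int (g - j))" and N = g and a = 1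
        and F = "\<lambda>_. []"])
    subgoal by simp
    subgoal premises prems for j s'
    proof -
      have j: "g - j = Suc (g - Suc j)" using prems by simp
      \<comment> \<open>By minimality of \<open>g\<close>, the loop test succeeds for every smaller
        number.\<close>
      have "\<not> X \<le> (int (g - Suc j))\<^sup>2"
        using g_le[of "g - Suc j"] j by auto
      then have "int (g - Suc j) * int (g - Suc j) < X"
        by (simp add: power2_eq_square)
      moreover have "val_size (Atom (int (g - Suc j) + 1)) \<le> B"
        using small_nat_le_N[of "Suc (g - Suc j)"] g_le_N j by (simp add: add.commute)
      ultimately show ?thesis
        using prems unfolding j by (simp add: wp_iffs add.commute)
    qed
    subgoal using X_le_g by (simp add: power2_eq_square not_less)
    subgoal premises prems for t s'
      using prems
      apply (simp add: wp_iffs)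
      apply (rule wp_While[where Inv = "\<lambda>j s'. s' vc = Atom (int (g ^ (k - j))) \<and> s' vloop = Node (drop (k - j) (atoms q))"
          and N = k and a = 3 and F = "\<lambda>_. []"])
      subgoal by simp
      subgoal premises prems' for j s3
      proof -
        have j: "k - j = Suc (k - Suc j)" "k - Suc j < k" using prems' by auto
        have "val_size (Atom (int (g ^ (k - j)))) \<le> B"
          by (rule small_nat_le_N) (simp add: g_power_le)
        then show ?thesis
          using prems' j small_qh_drop[of "k - j"] unfolding j(1)
          by (simp add: com_power_def wp_iffs drop_atoms_q mult.commute)
      qed
      subgoal using length_atoms by simp
      subgoal using d by (auto simp: com_power_def coords_inv_def data_def)
      done
    done
qed

lemma item_eq: "i < k \<Longrightarrow> item i = Node [Atom (l i), Atom (u i), Atom (q $ i), Atom (h $ i)]"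
proof -
  assume i: "i < k"
  have "nthv (entries (orc (coord_ilp mx i))) i = Atom (coord_val mx i)" for mx
  proof -
    obtain x where x: "orc (coord_ilp mx i) = Solution x"
      using nf i unfolding failed_def by blast
    then have "x \<in> S"
      using coord_outcome(3)[OF i] by blast
    then have "i < length (atoms x)"
      using i kn by (auto simp: S_iff)
    then show ?thesis
      using x by (simp add: nthv_def coord_val_def Cons_nth_drop_Suc[symmetric] nth_list_of_vec)
  qed
  then show ?thesis by (simp add: item_def)
qed

definition bound_val :: "(nat \<Rightarrow> int) \<Rightarrow> nat \<Rightarrow> val" where
  "bound_val a i = (if i < k then Atom (a i) else Node [])"

lemma enc_box_ilp:
  "enc_ilp (box_ilp c) = Node [Atom 0, Node (map (\<lambda>i. Atom (box_obj c $ i)) [0..<n]), enc_mat W, enc_vec w,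
     Node (map (bound_val (box_lo c)) [0..<n]), Node (map (bound_val (box_hi c)) [0..<n])]"
  by (simp add: enc_ilp_def box_ilp_def box_bounds_def enc_bounds_def enc_vec_def bound_val_def
      list_of_vec_map box_obj_def if_distrib comp_def)

text \<open>Beyond \<open>k\<close> a box changes neither objective nor bounds, so the suffix of
  \<open>h\<close> left over by the coordinate phase is already the tail of the objective of every
  box.\<close>

lemma drop_box_obj: "drop k (atoms h) = map (\<lambda>i. Atom (box_obj c $ i)) [k..<n]"
  using h by (auto simp: list_of_vec_map drop_map drop_upt box_obj_def intro!: nth_equalityI)

lemma replicate_bound_val: "replicate (n - k) (Node []) = map (bound_val a) [k..<n]"
  by (rule nth_equalityI) (auto simp: bound_val_def)

lemma small_bounds:
  assumes "\<And>i. i < k \<Longrightarrow> \<bar>a i\<bar> < 2 ^ b"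
  shows "val_size (Node (map (bound_val a) [j..<n])) \<le> B"
proof (rule small_list)
  fix v assume "v \<in> set (map (bound_val a) [j..<n])"
  then obtain i where "v = bound_val a i" by auto
  then show "val_size v \<le> 4 * b + 5"
    using val_size_Atom_le[OF assms[of i]] by (cases "i < k") (simp_all add: bound_val_def)
qed simp

lemma small_obj:
  assumes "c < g ^ k"
  shows "val_size (Node (map (\<lambda>i. Atom (box_obj c $ i)) [j..<n])) \<le> B"
proof (rule small_list)
  fix v assume "v \<in> set (map (\<lambda>i. Atom (box_obj c $ i)) [j..<n])"
  then obtain i where "i < n" "v = Atom (box_obj c $ i)" by auto
  then show "val_size v \<le> 4 * b + 5"
    using val_size_Atom_le[OF obj_bits[OF assms, of i]] by simp
qed simp

text \<open>With \<open>j\<close> coordinates to come, \<open>vi\<close> is the box number without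
  the digits of the coordinates from \<open>j\<close> to \<open>k - 1\<close>, and the three lists
  are complete from position \<open>j\<close> on.\<close>

definition box_inv :: "nat \<Rightarrow> nat \<Rightarrow> state \<Rightarrow> bool" where
  "box_inv c j s \<longleftrightarrow> s vloop = Node (rev (map item [0..<j])) \<and> s vi = Atom (int (c div g ^ (k - j))) \<and>
     s vobj = Node (map (\<lambda>i. Atom (box_obj c $ i)) [j..<n]) \<and>
     s vmin = Node (map (bound_val (box_lo c)) [j..<n]) \<and> s vmax = Node (map (bound_val (box_hi c)) [j..<n])"

lemma wp_digit:
  assumes c: "c < g ^ k" and j: "j < k" and inv: "box_inv c (Suc j) s" and s: "s vg = Atom (int g)"
  shows "wp orc B com_digit (\<lambda>Ps t s'. Ps = [] \<and> t \<le> 20 \<and> box_inv c j s') s"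
proof -
  have jn: "j < n" using j kn by simp
  have upt: "[j..<n] = j # [Suc j..<n]" using jn by (rule upt_conv_Cons)
  have gp: "0 < g" using g_pos j by simp
  have kj: "k - j = Suc (k - Suc j)" "k - 1 - j = k - Suc j" using j by auto
  let ?c = "c div g ^ (k - Suc j)"
  have lo: "l j + int (?c mod g) * (wd j + 1) = box_lo c j"
    by (simp add: box_lo_def kj)
  have obj: "h $ j - q $ j * (box_lo c j + box_hi c j) = box_obj c $ j"
    using j jn by (simp add: box_obj_def)
  have cc: "int ?c div int g = int (c div g ^ (k - j))"
  proof -
    have "?c div g = c div (g ^ (k - Suc j) * g)"
      by (rule div_mult2_eq[symmetric])
    also have "g ^ (k - Suc j) * g = g ^ (k - j)"
      unfolding kj(1) by (simp only: power_Suc2)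
    finally show ?thesis
      by (simp only: zdiv_int[symmetric])
  qed
  have digit: "int ?c - int g * int (c div g ^ (k - j)) = int (?c mod g)"
    unfolding cc[symmetric] by (simp only: zmod_int minus_mult_div_eq_mod)
  have small_item: "val_size (item j) \<le> B"
    using small_items[of "Suc j"] j by simp
  have bnd: "bound_val (box_lo c) j = Atom (box_lo c j)" "bound_val (box_hi c) j = Atom (box_hi c j)"
    using j by (simp_all add: bound_val_def)
  have "c div g ^ (k - j) \<le> g ^ k"
    using c div_le_dividend[of c "g ^ (k - j)"] by linarith
  note sizes = small_item[unfolded item_eq[OF j]]
    small_Atom[OF wd_bits[OF j]] small_Atom[OF conjunct1[OF box_bits[OF c j]]]
    small_Atom[OF conjunct2[OF box_bits[OF c j]]]
    small_bounds[of "box_lo c" j, unfolded upt list.map bnd] small_bounds[of "box_hi c" j, unfolded upt list.map bnd]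
    small_obj[OF c, of j, unfolded upt list.map] small_nat_le_N[OF this] small_items[of j]
  have rev: "rev (map item [0..<Suc j]) = item j # rev (map item [0..<j])" by simp
  show ?thesis
    using inv[unfolded box_inv_def rev] s sizes j box_bits[OF c]
    by (simp add: com_digit_def wp_iffs item_eq wd_def[symmetric] digit lo box_hi_def[symmetric] obj cc
        box_inv_def upt bnd del: val_size.simps)
qed

definition objective_val :: "outcome \<Rightarrow> int" where
  "objective_val r = (case r of Solution x \<Rightarrow> f x | _ \<Rightarrow> 0)"

lemma box_solution_in_S:
  assumes "orc (box_ilp c) = Solution x"
  shows "x \<in> S"
proof -
  have "ilp_outcome (box_ilp c) (orc (box_ilp c))"
    using solver box_ilp_wf by (simp add: ilp_solver_def)
  then show ?thesis
    unfolding assms by (simp add: ilp_outcome_def box_ilp_feasible)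
qed

lemma head_drop_q:
  "(case drop i (atoms q) of [] \<Rightarrow> Node [] | v # vs \<Rightarrow> v) = (if i < k then Atom (q $ i) else Node [])"
  using q by (auto simp: drop_atoms_q)

lemma wp_value:
  assumes c: "c < g ^ k" and s: "s vt = Atom 0" "s vloop = Node (entries (orc (box_ilp c)))"
    "s va = Node (atoms q)" "s vb = Node (atoms h)"
  shows "wp orc B (While (Var vloop) com_value)
    (\<lambda>Ps t s'. Ps = [] \<and> t \<le> 1 + 8 * n \<and> s' vt = Atom (objective_val (orc (box_ilp c))) \<and>
      (\<forall>y. y \<notin> mods com_value \<longrightarrow> s' y = s y)) s"
proof (cases "\<exists>x. orc (box_ilp c) = Solution x")
  case False
  then have "entries (orc (box_ilp c)) = []" "objective_val (orc (box_ilp c)) = 0"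
    by (cases "orc (box_ilp c)"; simp add: objective_val_def)+
  then show ?thesis
    by (intro wp_While[where Inv = "\<lambda>j s'. s' = s" and N = 0 and F = "\<lambda>_. []"]) (use s in auto)
next
  case True
  then obtain x where x: "orc (box_ilp c) = Solution x" by blast
  then have xc: "x \<in> carrier_vec n"
    using box_solution_in_S by (auto simp: S_iff)
  have drop_x: "drop i (atoms x) = Atom (x $ i) # drop (Suc i) (atoms x)" if "i < n" for i
    using xc that by (simp add: Cons_nth_drop_Suc[symmetric] nth_list_of_vec)
  have small_x: "val_size (Node (drop i (atoms x))) \<le> B" for i
    using order_trans[OF val_size_entries_drop[of i "orc (box_ilp c)"] box_small[OF c]] x by simp
  let ?Inv = "\<lambda>j s'. s' vt = Atom (value_sum q h x (n - j)) \<and> s' vloop = Node (drop (n - j) (atoms x)) \<and>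
      s' va = Node (drop (n - j) (atoms q)) \<and> s' vb = Node (drop (n - j) (atoms h))"
  show ?thesis
  proof (rule wp_While[where Inv = ?Inv and N = n and a = 7 and F = "\<lambda>_. []"])
    show "?Inv n s" using s x by (simp add: value_sum_def)
    fix j s' assume j: "j < n" and inv: "?Inv (Suc j) s'"
    let ?i = "n - Suc j"
    have i: "n - j = Suc ?i" "?i < n" using j by auto
    have sum: "value_sum q h x ?i + (h $ ?i - (if ?i < k then q $ ?i else 0) * x $ ?i) * x $ ?i = value_sum q h x (n - j)"
      unfolding i(1) value_sum_def using q by simp
    have small: "val_size (Atom (value_sum q h x (n - j))) \<le> B"
      by (rule small_Atom, rule value_bits[OF c x]) simp
    have "val_size (Node (drop (Suc ?i) (atoms x))) \<le> B" "val_size (Node (drop (Suc ?i) (atoms q))) \<le> B"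
      "val_size (Node (drop (Suc ?i) (atoms h))) \<le> B"
      by (rule small_x small_qh_drop)+
    moreover have "the_int (if ?i < k then Atom (q $ ?i) else Node []) = (if ?i < k then q $ ?i else 0)"
      by simp
    ultimately show "truthy (eval (Var vloop) s') \<and>
        wp orc B com_value (\<lambda>Ps n s''. Ps = [] \<and> n \<le> 7 \<and> ?Inv j s'') s'"
      using inv small sum i(2)
      by (simp add: com_value_def wp_iffs drop_Suc_tl head_drop_q i(1)[symmetric] drop_x[OF i(2)] drop_atoms_h[OF i(2)]
          del: val_size.simps split del: if_split)
  next
    fix s' assume "?Inv 0 s'"
    then show "\<not> truthy (eval (Var vloop) s')" using xc by simp
  next
    fix t s' assume "?Inv 0 s'" and fr: "\<And>y. y \<notin> mods com_value \<Longrightarrow> s' y = s y" and "t \<le> 1 + n * (1 + 7)"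
    then show "concat (map (\<lambda>_. []) (rev [0..<n])) = [] \<and> t \<le> 1 + 8 * n \<and>
        s' vt = Atom (objective_val (orc (box_ilp c))) \<and> (\<forall>y. y \<notin> mods com_value \<longrightarrow> s' y = s y)"
      using x xc q kn iqp_objective_eq_value_sum[of q x h] by (simp add: objective_val_def)
  qed
qed

definition best_inv :: "nat \<Rightarrow> state \<Rightarrow> bool" where
  "best_inv j s \<longleftrightarrow> s vbest = enc_outcome (best j) \<and> (\<forall>y. best j = Solution y \<longrightarrow> s vval = Atom (f y))"

lemma small_best: "val_size (enc_outcome (best j)) \<le> B"
proof (cases "best j")
  case (Solution x)
  then have "Solution x \<in> set (map (\<lambda>c. orc (box_ilp c)) (rev [j..<g ^ k]))"
    unfolding best_def using foldl_better(3) by blast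
  then obtain c where "c < g ^ k" "orc (box_ilp c) = Solution x" by auto
  then show ?thesis using box_small[of c] Solution by simp
qed (use B' in simp_all)

lemma wp_update:
  assumes j: "j < g ^ k" and inv: "best_inv (Suc j) s"
    and s: "s vout = enc_outcome (orc (box_ilp j))" "s vt = Atom (objective_val (orc (box_ilp j)))"
  shows "wp orc B com_update (\<lambda>Ps t s'. Ps = [] \<and> t \<le> 10 \<and> best_inv j s') s"
proof -
  have small_val: "val_size (s vt) \<le> B"
  proof (cases "orc (box_ilp j)")
    case (Solution x)
    then have "x \<in> carrier_vec n"
      using box_solution_in_S by (auto simp: S_iff)
    then have "f x = value_sum q h x n"
      using iqp_objective_eq_value_sum[of q x h] q kn by simp
    with Solution show ?thesis
      using value_bits[OF j Solution, of n] s(2) by (simp add: objective_val_def small_Atom del: val_size.simps)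
  qed (use s(2) small_init in \<open>simp_all add: objective_val_def\<close>)
  note sizes = small_best[of "Suc j"] box_small[OF j] small_val
  have best: "best j = better (best (Suc j)) (orc (box_ilp j))"
    by (rule best_Suc[OF j])
  show ?thesis
    using inv s sizes unfolding com_update_def Let_def best_inv_def best
    by (cases "best (Suc j)"; cases "orc (box_ilp j)")
      (auto simp: wp_Cond_iff wp_iffs enc_vec_def objective_val_def split: if_splits)
qed

definition grid_inv :: "state \<Rightarrow> bool" where
  "grid_inv s \<longleftrightarrow> data s \<and> s vhs = Node (drop k (atoms h)) \<and> s vfs = Node (replicate (n - k) (Node [])) \<and>
     s vitems = Node (rev (map item [0..<k])) \<and> s vg = Atom (int g)"

lemma wp_box:
  assumes c: "c < g ^ k" and inv: "grid_inv s" "best_inv (Suc c) s" and s: "s vc = Atom (int (Suc c))"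
  shows "wp orc B com_box (\<lambda>Ps t s'. Ps = [box_ilp c] \<and> t \<le> 60 + 21 * k + 8 * n \<and>
    grid_inv s' \<and> best_inv c s' \<and> s' vc = Atom (int c)) s"
proof -
  note d = inv(1)[unfolded grid_inv_def data_def]
  have sc: "val_size (Atom (int c)) \<le> B"
    using c by (intro small_nat_le_N) simp
  note sizes = small_items[of k] small_qh_drop[of k] small_qh_drop[of 0] small_replicate[of "n - k"] small_init sc
  note entries_small = order_trans[OF val_size_entries_drop[of 0 "orc (box_ilp c)"] box_small[OF c]]
  have init: "box_inv c k (s(vc := Atom (int c), vi := Atom (int c), vloop := Node (rev (map item [0..<k])),
      vobj := Node (drop k (atoms h)), vmin := Node (replicate (n - k) (Node [])),
      vmax := Node (replicate (n - k) (Node []))))"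
    by (simp add: box_inv_def drop_box_obj[of c] replicate_bound_val[symmetric])
  show ?thesis
    unfolding com_box_def
    using sizes d s init
    apply (simp add: wp_iffs del: val_size.simps)
    apply (rule wp_While[where Inv = "box_inv c" and N = k and a = 20 and F = "\<lambda>_. []"])
    subgoal by simp
    subgoal premises prems for j s'
    proof -
      have "truthy (s' vloop)" using prems by (simp add: box_inv_def)
      then show ?thesis
        using wp_digit[OF c, of j s'] prems by (simp add: com_digit_def)
    qed
    subgoal by (simp add: box_inv_def)
    subgoal premises prems for t s'
    proof -
      have b: "box_inv c 0 s'" and t: "t \<le> 1 + k * (1 + 20)" by fact+
      have fr: "s' y = s y" if "y \<notin> {vc, vi, vloop, vobj, vmin, vmax, vt, va, vb}" for y
        using prems(14)[of y] that by (simp add: com_digit_def)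
      have svc: "s' vc = Atom (int c)"
        using prems(14)[of vc] by (simp add: com_digit_def)
      have d': "s' vW = enc_mat W" "s' vw = enc_vec w" "s' vq = Node (atoms q)" "s' vh = Node (atoms h)"
        "s' vbest = s vbest" "s' vval = s vval"
        using d by (simp_all add: fr)
      show ?thesis
        apply (simp add: wp_iffs)
        apply (rule wp_Solve[where P = "box_ilp c"])
        subgoal using b d' by (simp add: enc_box_ilp tuple_def box_inv_def)
        subgoal by (rule box_ilp_wf)
        subgoal by (rule box_small[OF c])
        using sizes entries_small d'
        apply (simp add: wp_iffs eval_entries del: val_size.simps)
        apply (rule wp_mono[OF wp_value[OF c]])
        subgoal by simp
        subgoal by simp
        subgoal by simp
        subgoal by simp
        subgoal premises prems' for Ps t' s3
        proof -
          have fr3: "s3 y = s y" if "y \<notin> {vc, vi, vloop, vobj, vmin, vmax, vt, va, vb, vout}" for y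
            using prems' that by (simp add: com_value_def fr)
          have s3: "s3 vc = Atom (int c)" "s3 vout = enc_outcome (orc (box_ilp c))"
            "s3 vt = Atom (objective_val (orc (box_ilp c)))"
            using prems' svc by (simp_all add: com_value_def)
          have best: "best_inv (Suc c) s3"
            using inv(2) by (simp add: best_inv_def fr3)
          have frame: "s4 y = s3 y" if "bexec orc B com_update s3 Qs m s4" "y \<notin> {vbest, vval}" for Qs m s4 y
            using bexec_frame[OF that(1)] that(2) by (simp add: com_update_def Let_def)
          from wp_update[OF c best s3(2,3)] obtain Qs m s4 where
            u: "bexec orc B com_update s3 Qs m s4" "Qs = []" "m \<le> 10" "best_inv c s4"
            unfolding wp_def by blast
          have "grid_inv s4"
            using inv(1) unfolding grid_inv_def data_def by (simp add: frame[OF u(1)] fr3)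
          moreover have "s4 vc = Atom (int c)"
            using s3(1) by (simp add: frame[OF u(1)])
          ultimately show ?thesis
            unfolding wp_def using u prems' t by (intro exI[of _ Qs] exI[of _ m] exI[of _ s4]) auto
        qed
        done
    qed
    done
qed

lemma wp_boxes:
  assumes inv: "grid_inv s" and s: "s vc = Atom (int (g ^ k))"
  shows "wp orc B com_boxes (\<lambda>Ps t s'. Ps = map box_ilp (rev [0..<g ^ k]) \<and>
    t \<le> 10 + g ^ k * (61 + 21 * k + 8 * n) \<and> s' vIO = enc_outcome (best 0)) s"
proof -
  have concat: "concat (map (\<lambda>j. [box_ilp j]) xs) = map box_ilp xs" for xs
    by (induction xs) auto
  have "best (g ^ k) = Infeasible" by (simp add: best_def)
  then have init: "best_inv (g ^ k) (s(vbest := Node [Atom 0], vval := Atom 0))"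
    by (simp add: best_inv_def)
  have grid: "grid_inv (s(vbest := Node [Atom 0], vval := Atom 0))"
    using inv by (simp add: grid_inv_def data_def)
  show ?thesis
    unfolding com_boxes_def
    using s B2 init grid
    apply (simp add: wp_iffs tuple_def)
    apply (rule wp_While[where Inv = "\<lambda>j s'. grid_inv s' \<and> best_inv j s' \<and> s' vc = Atom (int j)"
        and N = "g ^ k" and a = "60 + 21 * k + 8 * n" and F = "\<lambda>j. [box_ilp j]"])
    subgoal by simp
    subgoal for j s'
      using wp_box[of j s'] by simp
    subgoal by simp
    subgoal premises prems for t s'
      using prems small_best[of 0] by (simp add: wp_iffs best_inv_def concat algebra_simps)
    done
qed

lemma wp_iqp_boxes:
  assumes s: "s vIO = iqp_input W w q h (max_subdet W) 0"
  shows "wp orc B (com_iqp E) (\<lambda>Ps t s'. Ps = coord_ilps @ box_ilps \<and>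
    t \<le> 90 + 6 * n + k * (65 + 12 * n) + 3 * g + g ^ k * (61 + 21 * k + 8 * n) \<and>
    s' vIO = enc_outcome (best 0)) s"
  unfolding com_iqp_def
  apply (simp add: wp_iffs del: eval.simps)
  apply (rule wp_mono[OF wp_init[where s = s]])
  subgoal by (rule s)
  apply (elim conjE)
  apply (rule wp_Seq)
  apply (rule wp_mono[OF wp_coords])
  subgoal .
  apply (elim conjE)
  subgoal premises prems for Ps t s' Ps' t' s''
  proof -
    have "fail_inv k (s'' vfail)"
      using prems by (simp add: coords_inv_def)
    then have v: "s'' vfail = Node []"
      using nf unfolding fail_inv_def failed_def by blast
    show ?thesis
      apply (simp add: v wp_Cond_iff wp_Seq_iff)
      apply (rule wp_mono[OF wp_grid])
      subgoal by (rule prems)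
      apply (elim conjE)
      apply (rule wp_mono[OF wp_boxes])
      subgoal by (simp add: grid_inv_def coords_inv_def)
      subgoal .
      subgoal using prems by (auto simp: coord_ilps_def box_ilps_def algebra_simps)
      done
  qed
  done

end

section \<open>Sizes\<close>

lemma val_size_member: "v \<in> set vs \<Longrightarrow> val_size v < val_size (Node vs)"
  by (simp add: less_Suc_eq_le member_le_sum_list)

lemma length_less_val_size: "length vs < val_size (Node vs)"
proof -
  have "length vs \<le> sum_list (map val_size vs)"
  proof (induction vs)
    case (Cons v vs)
    then show ?case using val_size_pos[of v] by simp
  qed simp
  then show ?thesis by simp
qed

lemma val_size_list_le:
  assumes "\<And>v. v \<in> set vs \<Longrightarrow> val_size v \<le> c"
  shows "val_size (Node vs) \<le> 1 + length vs * c"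
  using assms by (induction vs) (fastforce intro: add_mono)+

lemma abs_less_if_val_size_le: "val_size (Atom a) \<le> b \<Longrightarrow> \<bar>a\<bar> < 2 ^ b"
  using bitlen_le_iff[of "\<bar>a\<bar>" b] by simp

lemma subdet_eq_minor:
  assumes "d \<in> subdets A"
  obtains r f g where "0 < r" "\<forall>a<r. f a < dim_row A" "\<forall>b<r. g b < dim_col A"
    "d = minor (\<lambda>i j. A $$ (i, j)) r f g"
proof -
  obtain I J where d: "d = det (submatrix A I J)" and I: "I \<subseteq> {..<dim_row A}" "I \<noteq> {}"
    and J: "J \<subseteq> {..<dim_col A}" and card: "card I = card J"
    using assms unfolding subdets_def by blast
  have "{i. i < dim_row A \<and> i \<in> I} = I" "{j. j < dim_col A \<and> j \<in> J} = J"
    using I J by auto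
  then have "submatrix A I J = mat (card I) (card I) (\<lambda>(a, b). A $$ (pick I a, pick J b))"
    by (simp add: submatrix_def card)
  then have "d = minor (\<lambda>i j. A $$ (i, j)) (card I) (pick I) (pick J)"
    by (simp add: d minor_def)
  moreover have "0 < card I"
    using I finite_subset[OF I(1)] by (simp add: card_gt_0_iff)
  moreover have "\<forall>a<card I. pick I a < dim_row A" "\<forall>b<card I. pick J b < dim_col A"
    using pick_in_set_le[of _ I] pick_in_set_le[of _ J] I J card by auto
  ultimately show ?thesis using that by blast
qed

lemma max_subdet_le:
  assumes "minors_le c (dim_row A) (dim_col A) (\<lambda>i j. A $$ (i, j))"
  shows "max_subdet A \<le> c"
proof -
  have "\<bar>d\<bar> \<le> c" if d: "d \<in> subdets A" for d
  proof -
    obtain r f g where *: "\<forall>a<r. f a < dim_row A" "\<forall>b<r. g b < dim_col A"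
      "d = minor (\<lambda>i j. A $$ (i, j)) r f g"
      by (rule subdet_eq_minor[OF d])
    from assms *(1,2) show ?thesis
      unfolding minors_le_def *(3) by blast
  qed
  then show ?thesis
    unfolding max_subdet_def using finite_subdets[of A] minors_le_nonneg[OF assms]
    by (intro Max.boundedI) auto
qed

text \<open>Makes room for the \<open>2 k\<close> coordinate ILPs beside the \<open>a ^ k\<close>
  boxes, at the price of 2 in the base.\<close>

lemma power_add_double_le: "(a :: nat) ^ k + 2 * k \<le> (a + 2) ^ k" if "1 \<le> a"
proof (induction k)
  case (Suc k)
  have "1 \<le> a ^ k" using that by simp
  moreover have "k \<le> a * k" using that by simp
  ultimately have "a ^ Suc k + 2 * Suc k \<le> (a + 2) * (a ^ k + 2 * k)"
    by (simp add: algebra_simps)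
  also have "\<dots> \<le> (a + 2) * (a + 2) ^ k"
    using Suc by (rule mult_left_mono) simp
  finally show ?case by simp
qed simp

lemma power2_le: "a \<le> b \<Longrightarrow> (2 :: int) ^ a \<le> 2 ^ b"
  by (rule power_increasing) auto

section \<open>Bit lengths of the ILP data\<close>

context iqp_alg
begin

abbreviation "sz \<equiv> iqp_size W w q h"

lemma size_parts:
  "val_size (enc_mat W) + val_size (enc_vec w) + val_size (enc_vec q) + val_size (enc_vec h) + 1 = sz"
  by (simp add: iqp_size_def)

lemma n_le_size: "n + 5 \<le> sz"
  using length_less_val_size[of "atoms h"] h val_size_pos[of "enc_mat W"] val_size_pos[of "enc_vec w"]
    val_size_pos[of "enc_vec q"] size_parts by (simp add: enc_vec_def del: val_size.simps)

lemma vec_entry_less: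
  assumes "i < dim_vec v" "val_size (enc_vec v) \<le> c"
  shows "\<bar>v $ i\<bar> < 2 ^ c"
proof -
  have "Atom (v $ i) \<in> set (atoms v)"
    using assms(1) by (auto simp: list_of_vec_map)
  then have "val_size (Atom (v $ i)) < val_size (enc_vec v)"
    unfolding enc_vec_def by (rule val_size_member)
  then show ?thesis
    using assms(2) by (intro abs_less_if_val_size_le) simp
qed

lemma entries_less:
  "i < m \<Longrightarrow> j < n \<Longrightarrow> \<bar>A i j\<bar> < 2 ^ sz" "i < m \<Longrightarrow> \<bar>w $ i\<bar> < 2 ^ sz"
  "i < k \<Longrightarrow> \<bar>q $ i\<bar> < 2 ^ sz" "i < n \<Longrightarrow> \<bar>h $ i\<bar> < 2 ^ sz"
proof -
  show "\<bar>A i j\<bar> < 2 ^ sz" if "i < m" "j < n"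
  proof -
    have "row W i \<in> set (rows W)"
      using that W by (auto simp: rows_def)
    then have "val_size (enc_vec (row W i)) < val_size (enc_mat W)"
      unfolding enc_mat_def by (intro val_size_member) simp
    then show ?thesis
      using vec_entry_less[of j "row W i" sz] that W size_parts by simp
  qed
  show "\<bar>w $ i\<bar> < 2 ^ sz" if "i < m"
    by (rule vec_entry_less) (use that w size_parts in auto)
  show "\<bar>q $ i\<bar> < 2 ^ sz" if "i < k"
    by (rule vec_entry_less) (use that q size_parts in auto)
  show "\<bar>h $ i\<bar> < 2 ^ sz" if "i < n"
    by (rule vec_entry_less) (use that h size_parts in auto)
qed

text \<open>Allows linear arithmetic to absorb constants and multiples of \<open>sz\<close> into
  multiples of \<open>sz * sz\<close> in the exponents below.\<close>

lemma size_square: "5 \<le> sz" "5 * sz \<le> sz * sz"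
  using n_le_size by auto

lemma Suc_n_less: "int (Suc n) \<le> 2 ^ sz"
proof -
  have "Suc n < 2 ^ sz"
    using n_le_size less_exp[of sz] by linarith
  then show ?thesis
    by (metis of_nat_less_iff of_nat_numeral of_nat_power order_less_imp_le)
qed

lemma n_le_power: "n \<le> 2 ^ sz"
  using n_le_size less_exp[of sz] by linarith

lemma Leibniz_bound: "(int (Suc n) * 2 ^ sz) ^ Suc n \<le> 2 ^ (2 * (sz * sz))"
proof -
  have "int (Suc n) * 2 ^ sz \<le> 2 ^ sz * 2 ^ sz"
    by (rule mult_right_mono[OF Suc_n_less]) simp
  also have "\<dots> = 2 ^ (2 * sz)"
    by (simp add: mult_2 power_add)
  finally have "(int (Suc n) * 2 ^ sz) ^ Suc n \<le> (2 ^ (2 * sz)) ^ Suc n"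
    by (rule power_mono) simp
  also have "\<dots> = 2 ^ (2 * sz * Suc n)"
    by (simp only: power_mult)
  also have "\<dots> \<le> 2 ^ (2 * (sz * sz))"
    using n_le_size unfolding mult.assoc by (intro power2_le mult_left_mono) auto
  finally show ?thesis .
qed

lemma entries_le_size: "entries_le (2 ^ sz)"
  unfolding entries_le_def using entries_less by (auto intro: less_imp_le)

lemma M_le: "M (2 ^ sz) \<le> 2 ^ (3 * (sz * sz))"
proof -
  have "M (2 ^ sz) \<le> 2 ^ sz * 2 ^ (2 * (sz * sz))"
    unfolding M_def by (intro mult_mono Suc_n_less Leibniz_bound) auto
  also have "\<dots> = 2 ^ (sz + 2 * (sz * sz))"
    by (simp only: power_add)
  also have "\<dots> \<le> 2 ^ (3 * (sz * sz))"
    using size_square by (intro power2_le) linarith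
  finally show ?thesis .
qed

lemma max_subdet_le_size: "max_subdet W \<le> 2 ^ (2 * (sz * sz))"
proof -
  have "minors_le ((int n * 2 ^ sz) ^ n) m n A"
    by (rule minors_le_Leibniz) (use entries_less in \<open>auto intro: less_imp_le\<close>)
  then have "max_subdet W \<le> (int n * 2 ^ sz) ^ n"
    using max_subdet_le[of _ W] W by simp
  also have "\<dots> \<le> (int (Suc n) * 2 ^ sz) ^ n"
    by (intro power_mono mult_right_mono) auto
  also have "\<dots> \<le> (int (Suc n) * 2 ^ sz) ^ Suc n"
    by (rule power_increasing) (auto simp: int_one_le_iff_zero_less)
  also note Leibniz_bound
  finally show ?thesis .
qed

lemma Y_le: "\<bar>2 * int n * max_subdet W\<bar> \<le> 2 ^ (3 * (sz * sz))"
proof -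
  have "\<bar>2 * int n * max_subdet W\<bar> = 2 * int n * max_subdet W"
    using max_subdet_nonneg[of W] by simp
  also have "\<dots> \<le> (2 * 2 ^ sz) * 2 ^ (2 * (sz * sz))"
    using n_le_power max_subdet_nonneg by (intro mult_mono max_subdet_le_size) auto
  also have "\<dots> = 2 ^ (1 + sz + 2 * (sz * sz))"
    by (simp add: power_add)
  also have "\<dots> \<le> 2 ^ (3 * (sz * sz))"
    using size_square by (intro power2_le) linarith
  finally show ?thesis .
qed

abbreviation "e \<equiv> nat (bitlen E)"

lemma E_less: "E < 2 ^ e"
  using bitlen_le_iff[of E e] E by simp

lemma X_le_size: "X \<le> 2 ^ (7 * (sz * sz) + e)"
proof -
  have "(2 * int n * max_subdet W)\<^sup>2 \<le> (2 ^ (3 * (sz * sz)))\<^sup>2"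
    using Y_le unfolding abs_le_square_iff[symmetric] by simp
  also have "\<dots> = 2 ^ (6 * (sz * sz))"
    unfolding power_mult[symmetric] by (rule arg_cong[where f = "power 2"]) simp
  also have "\<dots> \<le> 2 ^ (6 * (sz * sz) + e)"
    by (intro power2_le) simp
  finally have "(2 * int n * max_subdet W)\<^sup>2 \<le> 2 ^ (6 * (sz * sz) + e)" .
  moreover have "E \<le> 2 ^ (6 * (sz * sz) + e)"
    using order_trans[OF less_imp_le[OF E_less] power2_le[of e "6 * (sz * sz) + e"]] by simp
  ultimately have "(2 * int n * max_subdet W)\<^sup>2 + E \<le> 2 * 2 ^ (6 * (sz * sz) + e)"
    by linarith
  then have "X \<le> 2 ^ sz * (2 * 2 ^ (6 * (sz * sz) + e))"
    unfolding X_def using n_le_power kn E by (intro mult_mono) auto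
  also have "\<dots> = 2 ^ (sz + (1 + (6 * (sz * sz) + e)))"
    by (simp only: power_add power_one_right)
  also have "\<dots> \<le> 2 ^ (7 * (sz * sz) + e)"
    using size_square by (intro power2_le) linarith
  finally show ?thesis .
qed

lemma g_le_size: "int g \<le> 2 ^ (7 * (sz * sz) + e)"
proof -
  have "int g \<le> X"
    using g_le[OF X_le_self] X_nonneg by linarith
  with X_le_size show ?thesis by linarith
qed

lemma double_power2_le: "a \<le> 2 ^ c \<Longrightarrow> b \<le> 2 ^ c \<Longrightarrow> a + b \<le> (2 :: int) ^ Suc c"
  by simp

lemma box_sizes:
  assumes nf: "\<not> failed" and i: "i < k"
  shows "\<bar>wd i\<bar> \<le> 2 ^ (3 * (sz * sz) + 1)"
    and "\<bar>box_lo c i\<bar> \<le> 2 ^ (10 * (sz * sz) + e + 3)"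
    and "\<bar>box_hi c i\<bar> \<le> 2 ^ (10 * (sz * sz) + e + 4)"
proof -
  have gp: "0 < g" using g_pos i by simp
  have lu: "\<bar>coord_val mx i\<bar> \<le> 2 ^ (3 * (sz * sz))" for mx
    using coord_val_le[OF nf i entries_le_size] M_le by (rule order_trans)
  have "\<bar>u i - l i\<bar> \<le> \<bar>u i\<bar> + \<bar>l i\<bar>"
    by (rule abs_triangle_ineq4)
  also have "\<dots> \<le> 2 ^ Suc (3 * (sz * sz))"
    by (intro double_power2_le lu)
  finally show wd: "\<bar>wd i\<bar> \<le> 2 ^ (3 * (sz * sz) + 1)"
    unfolding wd_def using abs_div_le_abs[of "u i - l i" "int g"] by simp
  define t where "t = int (c div g ^ (k - 1 - i) mod g)"
  have t: "0 \<le> t" "t \<le> 2 ^ (7 * (sz * sz) + e)"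
    using gp g_le_size by (simp_all add: t_def) (meson mod_less_divisor of_nat_le_iff order_trans less_imp_le)
  have "\<bar>wd i + 1\<bar> \<le> 2 ^ Suc (3 * (sz * sz) + 1)"
    using abs_triangle_ineq[of "wd i" 1] double_power2_le[OF wd one_le_power[of 2]] by simp
  then have "\<bar>t * (wd i + 1)\<bar> \<le> 2 ^ (7 * (sz * sz) + e) * 2 ^ Suc (3 * (sz * sz) + 1)"
    unfolding abs_mult using t by (intro mult_mono) auto
  also have "\<dots> = 2 ^ (10 * (sz * sz) + e + 2)"
    unfolding power_add[symmetric] by (rule arg_cong[where f = "power 2"]) simp
  finally have tw: "\<bar>t * (wd i + 1)\<bar> \<le> 2 ^ (10 * (sz * sz) + e + 2)" .
  have "\<bar>l i\<bar> \<le> 2 ^ (10 * (sz * sz) + e + 2)"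
    by (rule order_trans[OF lu power2_le]) simp
  from double_power2_le[OF this tw] show lo: "\<bar>box_lo c i\<bar> \<le> 2 ^ (10 * (sz * sz) + e + 3)"
    unfolding box_lo_def t_def[symmetric] using abs_triangle_ineq[of "l i" "t * (wd i + 1)"]
    by (simp add: eval_nat_numeral)
  have "\<bar>wd i\<bar> \<le> 2 ^ (10 * (sz * sz) + e + 3)"
    by (rule order_trans[OF wd power2_le]) simp
  from double_power2_le[OF lo this] show "\<bar>box_hi c i\<bar> \<le> 2 ^ (10 * (sz * sz) + e + 4)"
    unfolding box_hi_def using abs_triangle_ineq[of "box_lo c i" "wd i"]
    by (simp add: eval_nat_numeral)
qed

lemma box_obj_size:
  assumes nf: "\<not> failed" and i: "i < n"
  shows "\<bar>box_obj c $ i\<bar> \<le> 2 ^ (12 * (sz * sz) + e)"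
proof (cases "i < k")
  case False
  then have "\<bar>box_obj c $ i\<bar> \<le> 2 ^ sz"
    using i entries_less(4)[of i] by (simp add: box_obj_def)
  also have "\<dots> \<le> 2 ^ (12 * (sz * sz) + e)"
    using size_square by (intro power2_le) linarith
  finally show ?thesis .
next
  case True
  note b = box_sizes(2,3)[OF nf True, of c]
  have "\<bar>box_lo c i\<bar> \<le> 2 ^ (10 * (sz * sz) + e + 4)"
    by (rule order_trans[OF b(1) power2_le]) simp
  from double_power2_le[OF this b(2)] have "\<bar>box_lo c i + box_hi c i\<bar> \<le> 2 ^ Suc (10 * (sz * sz) + e + 4)"
    using abs_triangle_ineq[of "box_lo c i" "box_hi c i"] by linarith
  then have "\<bar>q $ i * (box_lo c i + box_hi c i)\<bar> \<le> 2 ^ sz * 2 ^ Suc (10 * (sz * sz) + e + 4)"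
    unfolding abs_mult using entries_less(3)[OF True] by (intro mult_mono) auto
  also have "\<dots> = 2 ^ (sz + Suc (10 * (sz * sz) + e + 4))"
    by (simp only: power_add)
  finally have qb: "\<bar>q $ i * (box_lo c i + box_hi c i)\<bar> \<le> 2 ^ (sz + Suc (10 * (sz * sz) + e + 4))" .
  have "\<bar>h $ i\<bar> \<le> 2 ^ (sz + Suc (10 * (sz * sz) + e + 4))"
    by (rule order_trans[OF less_imp_le[OF entries_less(4)[OF i]] power2_le]) simp
  from double_power2_le[OF this qb] have "\<bar>box_obj c $ i\<bar> \<le> 2 ^ Suc (sz + Suc (10 * (sz * sz) + e + 4))"
    using i True abs_triangle_ineq4[of "h $ i" "q $ i * (box_lo c i + box_hi c i)"]
    by (simp add: box_obj_def)
  also have "\<dots> \<le> 2 ^ (12 * (sz * sz) + e)"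
    using size_square by (intro power2_le) linarith
  finally show ?thesis .
qed

text \<open>One exponent for all numbers: box objectives need \<open>12 * (sz * sz) + e\<close>, and
  one more square makes the bounds strict. It is taken at \<open>sz\<close> for the ILP data and at
  \<open>total\<close> for a run.\<close>

abbreviation "bits t \<equiv> 13 * (t * t) + e"

lemma box_bits_less:
  assumes nf: "\<not> failed" and sz: "sz \<le> t"
  shows "i < k \<Longrightarrow> \<bar>wd i\<bar> < 2 ^ bits t" "i < k \<Longrightarrow> \<bar>box_lo c i\<bar> < 2 ^ bits t"
    "i < k \<Longrightarrow> \<bar>box_hi c i\<bar> < 2 ^ bits t" "i < n \<Longrightarrow> \<bar>box_obj c $ i\<bar> < 2 ^ bits t"
proof -
  have t: "sz * sz \<le> t * t"
    using sz by (rule mult_le_mono) (rule sz)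
  have less: "a < 2 ^ bits t" if "a \<le> 2 ^ d" "d < bits t" for a :: int and d
    using order_le_less_trans[OF that(1) power_strict_increasing[OF that(2), of 2]] by simp
  show "\<bar>wd i\<bar> < 2 ^ bits t" if "i < k"
    by (rule less[OF box_sizes(1)[OF nf that]]) (use t size_square in linarith)
  show "\<bar>box_lo c i\<bar> < 2 ^ bits t" if "i < k"
    by (rule less[OF box_sizes(2)[OF nf that]]) (use t size_square in linarith)
  show "\<bar>box_hi c i\<bar> < 2 ^ bits t" if "i < k"
    by (rule less[OF box_sizes(3)[OF nf that]]) (use t size_square in linarith)
  show "\<bar>box_obj c $ i\<bar> < 2 ^ bits t" if "i < n"
    by (rule less[OF box_obj_size[OF nf that]]) (use t size_square in linarith)
qed

lemma ilp_size_le: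
  assumes "enc_ilp P = Node [Atom a, Node vs, enc_mat W, enc_vec w, Node us, Node us']"
    and "a = 0 \<or> a = 1" "length vs = n" "length us = n" "length us' = n"
    and "\<And>v. v \<in> set vs \<union> set us \<union> set us' \<Longrightarrow> val_size v \<le> bits sz + 1"
  shows "ilp_size P \<le> 3 * sz * (bits sz + 2)"
proof -
  have le: "val_size (Node zs) \<le> 1 + n * (bits sz + 1)"
    if "zs = vs \<or> zs = us \<or> zs = us'" for zs
    using val_size_list_le[of zs "bits sz + 1"] assms(3-6) that by auto
  have "n * (bits sz + 1) + 5 * (bits sz + 1) \<le> sz * (bits sz + 1)"
    using mult_right_mono[OF n_le_size, of "bits sz + 1"] by (simp add: distrib_right)
  moreover have "val_size (Atom a) \<le> 2"
    using assms(2) by auto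
  ultimately have "ilp_size P \<le> 3 * (sz * (bits sz + 1)) + sz"
    using le[of vs] le[of us] le[of us'] size_parts
    unfolding ilp_size_def assms(1) by (simp del: val_size.simps(1))
  also have "\<dots> \<le> 3 * sz * (bits sz + 2)"
    by (simp add: algebra_simps)
  finally show ?thesis .
qed

lemma bits_pos: "Suc 0 \<le> bits sz"
  using size_square by linarith

lemma coord_ilp_size: "ilp_size (coord_ilp mx i) \<le> 3 * sz * (bits sz + 2)"
  using bits_pos
  by (intro ilp_size_le)
    (auto simp: enc_ilp_def coord_ilp_def enc_bounds_def enc_vec_def list_of_vec_map unit_vec_def)

lemma box_ilp_size:
  assumes "\<not> failed"
  shows "ilp_size (box_ilp c) \<le> 3 * sz * (bits sz + 2)"
proof (rule ilp_size_le[of _ 0])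
  show "enc_ilp (box_ilp c) = Node [Atom 0, Node (atoms (box_obj c)), enc_mat W, enc_vec w,
     Node (map (\<lambda>i. if i < k then Atom (box_lo c i) else Node []) [0..<n]),
     Node (map (\<lambda>i. if i < k then Atom (box_hi c i) else Node []) [0..<n])]"
    by (auto simp: enc_ilp_def box_ilp_def box_bounds_def enc_bounds_def enc_vec_def)
  fix v
  assume "v \<in> set (atoms (box_obj c)) \<union>
    set (map (\<lambda>i. if i < k then Atom (box_lo c i) else Node []) [0..<n]) \<union>
    set (map (\<lambda>i. if i < k then Atom (box_hi c i) else Node []) [0..<n])"
  then consider i where "i < n" "v = Atom (box_obj c $ i)" | i where "i < k" "v = Atom (box_lo c i)"
    | i where "i < k" "v = Atom (box_hi c i)" | "v = Node []"
    by (auto simp: list_of_vec_map box_obj_def split: if_splits)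
  then show "val_size v \<le> bits sz + 1"
    using box_bits_less[OF assms order_refl] by cases (use val_size_Atom_le in force)+
qed (simp_all add: box_obj_def)

section \<open>Budgets for a whole run\<close>

definition used_ilps :: "ilp list" where
  "used_ilps = coord_ilps @ (if failed then [] else box_ilps)"

text \<open>The argument of the time bound. Since every outcome has size at least 1, it also bounds
  the number of ILPs, and with it the number of loop rounds.\<close>

definition total :: nat where
  "total = sz + (\<Sum>P\<leftarrow>used_ilps. val_size (enc_outcome (orc P)))"

lemma length_coord_ilps: "length coord_ilps = 2 * k"
  by (simp add: coord_ilps_def length_concat comp_def sum_list_triv)

lemma length_box_ilps: "length box_ilps = g ^ k"
  by (simp add: box_ilps_def)

lemma used_ilps_wf: "P \<in> set used_ilps \<Longrightarrow> ilp_wf P \<and> ilp_mat P = W"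
  using coord_ilp_wf box_ilp_wf kn
  by (auto simp: used_ilps_def coord_ilps_def box_ilps_def coord_ilp_def box_ilp_def split: if_splits)

lemma used_ilps_size: "P \<in> set used_ilps \<Longrightarrow> ilp_size P \<le> 3 * sz * (bits sz + 2)"
  using coord_ilp_size box_ilp_size
  by (auto simp: used_ilps_def coord_ilps_def box_ilps_def split: if_splits)

lemma outcome_size_le: "P \<in> set used_ilps \<Longrightarrow> val_size (enc_outcome (orc P)) \<le> total"
  unfolding total_def by (intro trans_le_add2 member_le_sum_list) auto

lemma length_used_ilps_le: "length used_ilps + sz \<le> total"
proof -
  have "length Ps \<le> (\<Sum>P\<leftarrow>Ps. val_size (enc_outcome (orc P)))" for Ps
  proof (induction Ps)
    case (Cons P Ps)
    then show ?case using val_size_pos[of "enc_outcome (orc P)"] by simp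
  qed simp
  then show ?thesis by (simp add: total_def)
qed

lemma total_square: "5 \<le> total" "sz \<le> total" "5 * total \<le> total * total"
proof -
  show "sz \<le> total" by (simp add: total_def)
  then show "5 \<le> total" using size_square(1) by linarith
  then show "5 * total \<le> total * total" by simp
qed

lemma less_power_bits:
  assumes "a \<le> 2 ^ c" "c < bits total"
  shows "a < (2 :: int) ^ bits total"
  using order_le_less_trans[OF assms(1) power_strict_increasing[OF assms(2), of 2]] by simp

text \<open>The first summand is the list budget demanded by \<open>iqp_run\<close>; the rest covers
  the input, in which \<Delta> has about \<open>2 * (sz * sz)\<close> bits, and every
  outcome.\<close>

abbreviation "cap t \<equiv> 5 * (bits t + 1) * (t + 1) + 2 * (t * t) + t + 2"

lemma val_size_nthv_entries: "val_size (nthv (entries r) i) \<le> val_size (enc_outcome r)"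
proof (cases "drop i (entries r)")
  case Nil
  then show ?thesis
    using val_size_pos by (simp add: nthv_def)
next
  case (Cons v vs)
  then have "v \<in> set (drop i (entries r))" by simp
  then have "val_size v < val_size (Node (drop i (entries r)))"
    by (rule val_size_member)
  also have "\<dots> \<le> val_size (enc_outcome r)"
    by (rule val_size_entries_drop)
  finally show ?thesis
    using Cons by (simp add: nthv_def)
qed

lemma iqp_run: "iqp_run m n k W w q h orc E (bits total) (cap total)"
proof unfold_locales
  show "5 * (bits total + 1) * (n + 1) \<le> cap total"
  proof -
    have "5 * (bits total + 1) * (n + 1) \<le> 5 * (bits total + 1) * (total + 1)"
      using n_le_size total_square by (intro mult_left_mono) auto
    then show ?thesis by linarith
  qed
  have "\<bar>max_subdet W\<bar> < 2 ^ Suc (2 * (sz * sz))"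
  proof -
    have "(2 :: int) ^ (2 * (sz * sz)) < 2 ^ Suc (2 * (sz * sz))"
      by (rule power_strict_increasing) auto
    then show ?thesis
      using max_subdet_le_size max_subdet_nonneg[of W] by linarith
  qed
  then have "val_size (Atom (max_subdet W)) \<le> Suc (Suc (2 * (sz * sz)))"
    by (rule val_size_Atom_le)
  moreover have "sz * sz \<le> total * total"
    using total_square(2) by (intro mult_le_mono)
  ultimately have "sz + val_size (Atom (max_subdet W)) \<le> cap total"
    using total_square by linarith
  then show "val_size (iqp_input W w q h (max_subdet W) 0) \<le> cap total"
    using size_parts by (simp add: iqp_input_def del: val_size.simps(1))
  have less: "a < 2 ^ bits total" if "a < 2 ^ sz" for a :: int
    by (rule less_power_bits[OF less_imp_le[OF that]]) (use total_square in linarith)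
  show "int n < 2 ^ bits total"
  proof (rule less)
    have "n < 2 ^ sz"
      using n_le_size less_exp[of sz] by linarith
    then show "int n < 2 ^ sz" by simp
  qed
  fix i mx
  show "\<bar>h $ i\<bar> < 2 ^ bits total" if "i < n"
    by (rule less[OF entries_less(4)[OF that]])
  assume i: "i < k"
  show "\<bar>q $ i\<bar> < 2 ^ bits total"
    by (rule less[OF entries_less(3)[OF i]])
  have "coord_ilp mx i \<in> set used_ilps"
    using i by (cases mx) (auto simp: used_ilps_def coord_ilps_def)
  then have T: "val_size (enc_outcome (orc (coord_ilp mx i))) \<le> total"
    by (rule outcome_size_le)
  then show "val_size (enc_outcome (orc (coord_ilp mx i))) \<le> cap total"
    by linarith
  show "val_size (nthv (entries (orc (coord_ilp mx i))) i) \<le> Suc (bits total)"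
    using order_trans[OF val_size_nthv_entries[of _ i] T] total_square by linarith
qed

lemma N_le_total: "\<not> failed \<Longrightarrow> g ^ k \<le> total"
  using length_used_ilps_le by (simp add: used_ilps_def box_ilps_def)

lemma iqp_run_boxes:
  assumes nf: "\<not> failed"
  shows "iqp_run_boxes m n k W w q h orc E (bits total) (cap total)"
proof -
  interpret iqp_run m n k W w q h orc E "bits total" "cap total"
    by (rule iqp_run)
  note bl = box_bits_less[OF nf total_square(2)]
  have ss: "sz * sz \<le> total * total"
    using total_square(2) by (intro mult_le_mono)
  show ?thesis
  proof unfold_locales
    show "\<not> failed" by (rule nf)
    show "\<bar>2 * int n * max_subdet W\<bar> < 2 ^ bits total"
      by (rule less_power_bits[OF Y_le]) (use ss total_square in linarith)
    show "X < 2 ^ bits total"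
      by (rule less_power_bits[OF X_le_size]) (use ss total_square in linarith)
    show "int g ^ k < 2 ^ bits total"
    proof (rule less_power_bits)
      have "g ^ k \<le> 2 ^ total"
        using N_le_total[OF nf] less_exp[of total] by linarith
      then show "int g ^ k \<le> 2 ^ total"
        by (metis of_nat_le_iff of_nat_numeral of_nat_power)
    qed (use total_square in linarith)
    show "\<bar>wd i\<bar> < 2 ^ bits total" if "i < k" for i by (rule bl(1)[OF that])
    show "\<bar>box_lo c i\<bar> < 2 ^ bits total \<and> \<bar>box_hi c i\<bar> < 2 ^ bits total" if "i < k" for c i
      using bl(2,3)[OF that] by blast
    show "\<bar>box_obj c $ i\<bar> < 2 ^ bits total" if "i < n" for c i by (rule bl(4)[OF that])
    fix c assume "c < g ^ k"
    then have "box_ilp c \<in> set used_ilps"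
      using nf by (auto simp: used_ilps_def box_ilps_def)
    then have T: "val_size (enc_outcome (orc (box_ilp c))) \<le> total"
      by (rule outcome_size_le)
    then show "val_size (enc_outcome (orc (box_ilp c))) \<le> cap total"
      by linarith
    fix x i assume x: "orc (box_ilp c) = Solution x" and i: "i \<le> n"
    have "ilp_outcome (box_ilp c) (orc (box_ilp c))"
      using solver box_ilp_wf by (simp add: ilp_solver_def)
    then have xc: "x \<in> carrier_vec n"
      unfolding x by (simp add: ilp_outcome_def box_ilp_feasible S_iff)
    \<comment> \<open>Entries of a returned solution are below \<open>2 ^ total\<close>, those of
      \<open>h\<close> and \<open>q\<close> below \<open>2 ^ sz\<close>. Each of the two factors
      \<open>x $ j\<close> contributes \<open>total\<close> to the exponent, and the difference one
      more bit.\<close>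
    have "\<bar>(h $ j - (if j < dim_vec q then q $ j else 0) * x $ j) * x $ j\<bar> \<le> 2 ^ (sz + total + 1 + total)"
      if j: "j < i" for j
    proof -
      have xj: "\<bar>x $ j\<bar> \<le> 2 ^ total"
        by (rule less_imp_le, rule vec_entry_less) (use j i xc T x in auto)
      have qj: "\<bar>if j < dim_vec q then q $ j else 0\<bar> \<le> 2 ^ sz"
        using entries_less(3)[of j] q by auto
      have "\<bar>(if j < dim_vec q then q $ j else 0) * x $ j\<bar> \<le> 2 ^ sz * 2 ^ total"
        unfolding abs_mult using xj qj by (intro mult_mono) auto
      also have "\<dots> = 2 ^ (sz + total)" by (simp only: power_add)
      finally have qx: "\<bar>(if j < dim_vec q then q $ j else 0) * x $ j\<bar> \<le> 2 ^ (sz + total)" .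
      have "\<bar>h $ j\<bar> \<le> 2 ^ (sz + total)"
        by (rule order_trans[OF less_imp_le[OF entries_less(4)] power2_le]) (use j i in auto)
      from double_power2_le[OF this qx]
      have "\<bar>h $ j - (if j < dim_vec q then q $ j else 0) * x $ j\<bar> \<le> 2 ^ (sz + total + 1)"
        using abs_triangle_ineq4[of "h $ j" "(if j < dim_vec q then q $ j else 0) * x $ j"] by simp
      then have "\<bar>h $ j - (if j < dim_vec q then q $ j else 0) * x $ j\<bar> * \<bar>x $ j\<bar> \<le> 2 ^ (sz + total + 1) * 2 ^ total"
        using xj by (intro mult_mono) auto
      then show ?thesis
        by (simp only: abs_mult power_add)
    qed
    note le = this
    have "\<bar>value_sum q h x i\<bar> \<le> (\<Sum>j<i. \<bar>(h $ j - (if j < dim_vec q then q $ j else 0) * x $ j) * x $ j\<bar>)"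
      unfolding value_sum_def by (rule sum_abs)
    also have "\<dots> \<le> of_nat (card {..<i}) * 2 ^ (sz + total + 1 + total)"
      by (rule sum_bounded_above) (rule le, simp)
    also have "\<dots> = int i * 2 ^ (sz + total + 1 + total)"
      by simp
    also have "\<dots> \<le> 2 ^ sz * 2 ^ (sz + total + 1 + total)"
      using i n_le_power by (intro mult_right_mono) auto
    also have "\<dots> = 2 ^ (sz + (sz + total + 1 + total))"
      by (simp only: power_add)
    finally show "\<bar>value_sum q h x i\<bar> < 2 ^ bits total"
      by (rule less_power_bits) (use total_square in linarith)
  qed
qed

lemma small_input:
  assumes "iqp_run m n k W w q h orc E b B"
  shows "val_size (iqp_input W w q h (max_subdet W) x) \<le> B"
proof -
  interpret iqp_run m n k W w q h orc E b B by (rule assms)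
  show ?thesis
    using input_small B2 by (cases "x = 0") (auto simp: iqp_input_def)
qed

lemma exec_iqp:
  assumes eps: "0 < \<epsilon>" "1 \<le> \<epsilon> * real_of_int E"
  shows "\<exists>t s r. exec orc (com_iqp E) (iqp_input W w q h (max_subdet W)) used_ilps t s \<and>
    s 0 = enc_outcome r \<and> iqp_outcome \<epsilon> W w q h r \<and>
    t \<le> 200 * (total + 1)\<^sup>2 * (com_factor (com_iqp E) * cap total)"
proof -
  let ?s = "iqp_input W w q h (max_subdet W)"
  interpret R: iqp_run m n k W w q h orc E "bits total" "cap total"
    by (rule iqp_run)
  have kt: "k \<le> total" "n \<le> total"
    using kn n_le_size total_square by auto
  have mono: "k * c \<le> total * c" "a * c \<le> total * c" if "a \<le> total" for a c :: nat
    using kt that by (auto intro: mult_right_mono)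
  have tt: "k * n \<le> total * total"
    using kt by (intro mult_le_mono)
  have "\<exists>l s r. bexec orc (cap total) (com_iqp E) ?s used_ilps l s \<and> s 0 = enc_outcome r \<and>
      iqp_outcome \<epsilon> W w q h r \<and> l \<le> 200 * (total + 1)\<^sup>2"
  proof (cases failed)
    case True
    from R.wp_iqp_failed[OF this, where s = ?s, OF refl] obtain l s i mx where
      *: "bexec orc (cap total) (com_iqp E) ?s coord_ilps l s" "l \<le> 50 + 6 * n + k * (60 + 12 * n)" "i < k"
      "\<not> (\<exists>x. orc (coord_ilp mx i) = Solution x)" "s 0 = enc_outcome (orc (coord_ilp mx i))"
      unfolding wp_def by blast
    have "l \<le> 200 * (total + 1)\<^sup>2"
      using *(2) tt kt by (simp add: power2_eq_square algebra_simps)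
    moreover have "used_ilps = coord_ilps"
      using True by (simp add: used_ilps_def)
    ultimately show ?thesis
      using * failed_outcome[OF *(3,4), of \<epsilon>] by metis
  next
    case False
    interpret Rb: iqp_run_boxes m n k W w q h orc E "bits total" "cap total"
      by (rule iqp_run_boxes[OF False])
    from Rb.wp_iqp_boxes[where s = ?s, OF refl] obtain l s where
      *: "bexec orc (cap total) (com_iqp E) ?s (coord_ilps @ box_ilps) l s" "s 0 = enc_outcome (best 0)"
      "l \<le> 90 + 6 * n + k * (65 + 12 * n) + 3 * g + g ^ k * (61 + 21 * k + 8 * n)"
      unfolding wp_def by blast
    note N = N_le_total[OF False]
    have "g \<le> total" using Rb.g_le_N N by simp
    moreover have "g ^ k * (61 + 21 * k + 8 * n) \<le> total * (61 + 21 * total + 8 * total)"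
      using N kt by (intro mult_le_mono add_mono) auto
    ultimately have "l \<le> 200 * (total + 1)\<^sup>2"
      using *(3) tt kt by (simp add: power2_eq_square algebra_simps)
    moreover have "used_ilps = coord_ilps @ box_ilps"
      using False by (simp add: used_ilps_def)
    ultimately show ?thesis
      using * best_outcome[OF False eps] by metis
  qed
  then obtain l s r where b: "bexec orc (cap total) (com_iqp E) ?s used_ilps l s" "s 0 = enc_outcome r"
    "iqp_outcome \<epsilon> W w q h r" "l \<le> 200 * (total + 1)\<^sup>2" by blast
  have "1 \<le> cap total" by simp
  from bexec_imp_exec[OF b(1) small_input[OF iqp_run] this] obtain t where
    t: "exec orc (com_iqp E) ?s used_ilps t s" "t \<le> l * (com_factor (com_iqp E) * cap total)" by blast
  note t(2)
  also have "l * (com_factor (com_iqp E) * cap total) \<le> 200 * (total + 1)\<^sup>2 * (com_factor (com_iqp E) * cap total)"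
    by (rule mult_right_mono[OF b(4)]) simp
  finally show ?thesis
    using t(1) b(2,3) by blast
qed

text \<open>Rounding \<open>1 / \<epsilon>\<close> up adds at most \<open>k\<close> to the radicand.
  Replacing \<open>G\<close> by \<open>G + 1\<close> makes up for this because
  \<open>2 k \<le> 2 n \<Delta> \<le> G\<close>, where \<Delta> is at least 1 once the coordinate
  phase has succeeded and \<open>k\<close> is positive. The remaining cases are settled by counting:
  only coordinate ILPs after a failure, a single box for \<open>k = 0\<close>.\<close>

lemma length_used_ilps:
  assumes eps: "0 < \<epsilon>" "\<epsilon> \<le> 1" "real_of_int E \<le> 1 / \<epsilon> + 1"
  shows "length used_ilps \<le>
    (3 + nat \<lceil>sqrt (real k * ((2 * real n * real_of_int (max_subdet W))\<^sup>2 + 1 / \<epsilon>))\<rceil>) ^ k"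
proof -
  define R where "R = real k * ((2 * real n * real_of_int (max_subdet W))\<^sup>2 + 1 / \<epsilon>)"
  define G where "G = nat \<lceil>sqrt R\<rceil>"
  have le: "(G + 1) ^ k + 2 * k \<le> (3 + G) ^ k"
  proof -
    have eq: "3 + G = (G + 1) + 2" by simp
    show ?thesis unfolding eq by (rule power_add_double_le) simp
  qed
  have "length used_ilps \<le> (G + 1) ^ k + 2 * k"
  proof (cases "failed \<or> k = 0")
    case True
    then have "length used_ilps \<le> 2 * k + (if k = 0 then 1 else 0)"
    proof (cases failed)
      case False
      with True have k: "k = 0" by blast
      have "g ^ k = 1" by (simp only: k power_0)
      moreover have "length used_ilps = 2 * k + g ^ k"
        using False by (simp add: used_ilps_def length_coord_ilps length_box_ilps)
      ultimately have "length used_ilps = 2 * k + 1"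
        by (simp only:)
      then show ?thesis by (simp only: k) simp
    qed (simp add: used_ilps_def length_coord_ilps)
    also have "\<dots> \<le> (G + 1) ^ k + 2 * k"
      by simp
    finally show ?thesis .
  next
    case False
    then have k: "1 \<le> k" and nf: "\<not> failed" by auto
    let ?Y = "2 * real n * real_of_int (max_subdet W)"
    have R0: "0 \<le> R" using eps by (simp add: R_def)
    have G: "sqrt R \<le> real G" unfolding G_def by linarith
    then have G2: "R \<le> (real G)\<^sup>2"
      using R0 by (metis real_le_lsqrt real_sqrt_ge_zero real_sqrt_le_iff real_sqrt_pow2 power_mono)
    have "1 \<le> max_subdet W"
      using max_subdet_ge_1[OF nf] k by simp
    then have D: "1 \<le> real_of_int (max_subdet W)" by simp
    have "2 * real k * 1 \<le> ?Y"
      using kn D by (intro mult_mono) auto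
    moreover have "?Y \<le> sqrt R"
    proof (rule real_le_rsqrt)
      have "1 * ?Y\<^sup>2 \<le> real k * (?Y\<^sup>2 + 1 / \<epsilon>)"
        using k eps by (intro mult_mono) auto
      then show "?Y\<^sup>2 \<le> R" by (simp add: R_def)
    qed
    ultimately have Gk: "2 * real k \<le> real G" using G by linarith
    have "real_of_int X = real k * (?Y\<^sup>2 + real_of_int E)"
      by (simp add: X_def)
    also have "\<dots> \<le> real k * (?Y\<^sup>2 + (1 / \<epsilon> + 1))"
      using eps by (intro mult_left_mono add_left_mono) auto
    also have "\<dots> = R + real k"
      by (simp add: R_def algebra_simps)
    also have "\<dots> \<le> (real G)\<^sup>2 + (2 * real G + 1)"
      using G2 Gk by (intro add_mono) auto
    also have "\<dots> = real_of_int ((int (G + 1))\<^sup>2)"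
      by (simp add: power2_eq_square algebra_simps)
    finally have "X \<le> (int (G + 1))\<^sup>2"
      by (simp only: of_int_le_iff)
    then have "g \<le> G + 1" by (rule g_le)
    then have "g ^ k \<le> (G + 1) ^ k" by (rule power_mono) simp
    then show ?thesis
      using nf by (simp add: used_ilps_def length_coord_ilps box_ilps_def)
  qed
  with le show ?thesis
    unfolding G_def R_def by linarith
qed

end


theorem theorem1:
  fixes \<epsilon> :: real
  assumes "0 < \<epsilon>" and "\<epsilon> \<le> 1"
  shows "\<exists>(alg :: com) (p_size :: nat poly) (p_time :: nat poly).
    \<forall>(m :: nat) (n :: nat) (k :: nat) (W :: int mat) (w :: int vec) (q :: int vec) (h :: int vec) (\<Delta> :: int).
      W \<in> carrier_mat m n \<longrightarrow> w \<in> carrier_vec m \<longrightarrow>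
      k \<le> n \<longrightarrow> q \<in> carrier_vec k \<longrightarrow> (\<forall>i<k. q $ i > 0) \<longrightarrow> h \<in> carrier_vec n \<longrightarrow>
      \<Delta> = max_subdet W \<longrightarrow>
      (\<forall>orc. ilp_solver orc \<longrightarrow>
        (\<exists>Ps t s r.
          exec orc alg (iqp_input W w q h \<Delta>) Ps t s \<and>
          s 0 = enc_outcome r \<and>
          iqp_outcome \<epsilon> W w q h r \<and>
          length Ps \<le> (3 + nat \<lceil>sqrt (real k * ((2 * real n * real_of_int \<Delta>)\<^sup>2 + 1 / \<epsilon>))\<rceil>) ^ k \<and>
          t \<le> poly p_time (iqp_size W w q h + (\<Sum>P\<leftarrow>Ps. val_size (enc_outcome (orc P)))) \<and>
          (\<forall>P\<in>set Ps.
             ilp_size P \<le> poly p_size (iqp_size W w q h) \<and>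
             dim_col (ilp_mat P) \<le> n \<and>
             dim_row (ilp_mat P) \<le> m \<and>
             (\<forall>d\<in>subdets (ilp_mat P). \<bar>d\<bar> \<le> \<Delta>))))"
proof -
  define E where "E = \<lceil>1 / \<epsilon>\<rceil>"
  have "1 \<le> 1 / \<epsilon>" using assms by simp
  then have E1: "1 \<le> E" unfolding E_def by linarith
  have E_bounds: "1 / \<epsilon> \<le> real_of_int E" "real_of_int E \<le> 1 / \<epsilon> + 1"
    unfolding E_def by linarith+
  have eps: "1 \<le> \<epsilon> * real_of_int E"
    using E_bounds(1) assms(1) by (simp add: field_simps)
  \<comment> \<open>\<open>\<epsilon>\<close> is fixed before the polynomials are chosen, so
    \<open>e\<close> may be one of their coefficients. They transcribe \<open>bits\<close>, the
    bound of \<open>ilp_size_le\<close>, and the product of step count, \<open>com_factor\<close>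
    and \<open>cap\<close>.\<close>
  define e where "e = nat (bitlen E)"
  define b :: "nat poly" where "b = [:e, 0, 13:]"
  define p_size where "p_size = [:0, 3:] * (b + [:2:])"
  define p_time where "p_time = [:200:] * [:1, 1:] ^ 2 * ([:com_factor (com_iqp E):] *
    ([:5:] * (b + [:1:]) * [:1, 1:] + [:2, 1, 2:]))"
  have b: "poly b t = 13 * (t * t) + e" for t
    by (simp add: b_def algebra_simps)
  have p_size: "poly p_size t = 3 * t * (13 * (t * t) + e + 2)" for t
    by (simp add: p_size_def b algebra_simps)
  have p_time: "poly p_time t = 200 * (t + 1)\<^sup>2 * (com_factor (com_iqp E) *
      (5 * (13 * (t * t) + e + 1) * (t + 1) + 2 * (t * t) + t + 2))" for t
    by (simp add: p_time_def b power2_eq_square algebra_simps)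
  show ?thesis
  proof (rule exI[of _ "com_iqp E"], rule exI[of _ p_size], rule exI[of _ p_time], intro allI impI, goal_cases)
    case (1 m n k W w q h \<Delta> orc)
    then interpret iqp_alg m n k W w q h orc E
      by unfold_locales (use E1 in auto)
    obtain t s r where *: "exec orc (com_iqp E) (iqp_input W w q h \<Delta>) used_ilps t s" "s 0 = enc_outcome r"
      "iqp_outcome \<epsilon> W w q h r" "t \<le> poly p_time total"
      using exec_iqp[OF assms(1) eps] unfolding p_time e_def 1(7) by blast
    have "\<forall>P\<in>set used_ilps. ilp_size P \<le> poly p_size sz \<and> dim_col (ilp_mat P) \<le> n \<and>
        dim_row (ilp_mat P) \<le> m \<and> (\<forall>d\<in>subdets (ilp_mat P). \<bar>d\<bar> \<le> \<Delta>)"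
      using used_ilps_size used_ilps_wf subdets_le_max_subdet W unfolding p_size e_def 1(7) by auto
    with * length_used_ilps[OF assms E_bounds(2)] show ?case
      unfolding total_def 1(7) by blast
  qed
qed

end
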